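(* Let $p$ be a prime number with $p\equiv 1 \bmod 8$. Then the following statements are equivalent. (1) For $j\in\mathbb{Z}$ with $j^2\equiv -1 \bmod p$ one has $\left(\frac{1+j}{p}\right)=-1$. (2) For $r\in\mathbb{Z}$ with $r^2\equiv 2\bmod p$ one has $\left(\frac{1+r}{p}\right)=-1$. (3) For $r\in\mathbb{Z}$ with $r^2\equiv 2\bmod p$ one has $(-1)^{(p-1)/8}\cdot\left(\frac{r}{p}\right)=-1$. (4) Writing $p=a^2+b^2$ with $a,b\in\mathbb{Z}$, one has $\left(\frac{a+b}{p}\right)=-1$. (5) Writing $p=a^2+b^2$ with $a,b\in\mathbb{Z}$, one has $(a+b)^2\equiv 9\bmod 16$. (6) Writing $p=a^2+4c^2$ with $a,c\in\mathbb{Z}$, one has $16\nmid p-1+4c$. (7) The (unique) Frobenius element in $G:=\mathrm{Gal}(\mathbb{Q}(\sqrt{2},\sqrt{1+i})/\mathbb{Q})$ corresponding to $p$ equals the generator of the center of $G$. (8) With $M$ the normal closure of $\mathbb{Q}(\sqrt{1+\sqrt{2}})$ over $\mathbb{Q}$, which is a dihedral extension of degree $8$, the (unique) Frobenius element in $\mathrm{Gal}(M/\mathbb{Q})$ corresponding to $p$ equals the generator of the center of $\mathrm{Gal}(M/\mathbb{Q})$.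
   Context: $\left(\frac{\cdot}{p}\right)$ denotes the Legendre symbol. Here $i^2=-1$. For a prime $p\equiv 1\bmod 8$, integers $j$, $r$ and representations $p=a^2+b^2$, $p=a^2+4c^2$ as in (1)-(6) always exist; conditions (1)-(6) are to be read as holding for every such choice of $j$, $r$, $(a,b)$ or $(a,c)$ (the choice does not matter). The field $N=\mathbb{Q}(\sqrt{2},\sqrt{1+i})$ is the splitting field over $\mathbb{Q}$ of $x^4-2x^2+2$, the minimal polynomial of $\sqrt{1+i}$; it is Galois over $\mathbb{Q}$ with dihedral Galois group of order $8$, whose center has order $2$ and has fixed field $\mathbb{Q}(i,\sqrt{2})$. The field $M$ is the splitting field of $x^4-2x^2-1$. A Frobenius element corresponding to $p$ is in general defined only up to conjugacy; for $p\equiv 1\bmod 8$ it lies in the center of the Galois group in (7) and (8), so it is well-defined. *)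

theory Defs
  imports
    "HOL-Algebra.Algebra"
    "HOL-Algebra.Algebraic_Closure_Type"
    "HOL-Analysis.Analysis"
    "HOL-Number_Theory.Number_Theory"
begin

text \<open>
  All number fields are subfields of the complex numbers, viewed as a ring of \<open>HOL-Algebra\<close>.
\<close>

abbreviation complex_field :: "complex ring" where
  "complex_field \<equiv> ring_of_type_algebra"

text \<open>
  Since the complex numbers are algebraically closed, a rational polynomial splits over a
  subfield \<open>K\<close> iff all its complex roots lie in \<open>K\<close>.
\<close>

definition normal_over_rat :: "complex set \<Rightarrow> bool" where
  "normal_over_rat K \<longleftrightarrow>
     subfield K complex_field \<and>
     (\<forall>x\<in>K. algebraic x) \<and>
     (\<forall>f :: rat poly. Factorial_Ring.irreducible f \<longrightarrow>
        (\<exists>x\<in>K. poly (map_poly of_rat f) x = 0) \<longrightarrow>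
        (\<forall>z. poly (map_poly of_rat f) z = 0 \<longrightarrow> z \<in> K))"

definition normal_closure_rat :: "complex set \<Rightarrow> complex set" where
  "normal_closure_rat K = \<Inter>{L. normal_over_rat L \<and> K \<subseteq> L}"

text \<open>
  As in \<^const>\<open>BijGroup\<close>, automorphisms are functions that are \<^const>\<open>undefined\<close> outside \<open>K\<close>,
  and the group operation is composition.
\<close>

definition Gal_rat :: "complex set \<Rightarrow> (complex \<Rightarrow> complex) monoid" where
  "Gal_rat K = BijGroup K \<lparr>carrier :=
     {\<sigma> \<in> Bij K.
        \<sigma> \<in> ring_iso (complex_field\<lparr>carrier := K\<rparr>) (complex_field\<lparr>carrier := K\<rparr>) \<and>
        (\<forall>q\<in>\<rat>. \<sigma> q = q)}\<rparr>"

definition ring_of_integers :: "complex set \<Rightarrow> complex ring" where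
  "ring_of_integers K = complex_field\<lparr>carrier := {x \<in> K. algebraic_int x}\<rparr>"

definition prime_over :: "complex set \<Rightarrow> nat \<Rightarrow> complex set \<Rightarrow> bool" where
  "prime_over K p P \<longleftrightarrow>
     primeideal P (ring_of_integers K) \<and> P \<inter> \<int> = range (\<lambda>k. of_int (int p * k))"

text \<open>
  A Frobenius element for \<open>p\<close> is a Frobenius element of some prime \<open>P\<close> above \<open>p\<close>; the
  residue field of the base field is the field with \<open>p\<close> elements, whence the exponent.
\<close>

definition is_frobenius :: "complex set \<Rightarrow> nat \<Rightarrow> (complex \<Rightarrow> complex) \<Rightarrow> bool" where
  "is_frobenius K p \<sigma> \<longleftrightarrow>
     \<sigma> \<in> carrier (Gal_rat K) \<and>
     (\<exists>P. prime_over K p P \<and> (\<forall>x\<in>carrier (ring_of_integers K). \<sigma> x - x ^ p \<in> P))"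

text \<open>Meaningful only when there is exactly one Frobenius element for \<open>p\<close>.\<close>

definition frobenius :: "complex set \<Rightarrow> nat \<Rightarrow> complex \<Rightarrow> complex" where
  "frobenius K p = (THE \<sigma>. is_frobenius K p \<sigma>)"

definition group_center :: "('a, 'b) monoid_scheme \<Rightarrow> 'a set" where
  "group_center G = {z \<in> carrier G. \<forall>g\<in>carrier G. z \<otimes>\<^bsub>G\<^esub> g = g \<otimes>\<^bsub>G\<^esub> z}"

definition generates_center :: "('a, 'b) monoid_scheme \<Rightarrow> 'a \<Rightarrow> bool" where
  "generates_center G z \<longleftrightarrow> z \<in> carrier G \<and> generate G {z} = group_center G"

text \<open>The parameter \<open>n\<close> is the order of the rotation subgroup; the group has order \<open>2 * n\<close>.\<close>

definition dihedral_group :: "('a, 'b) monoid_scheme \<Rightarrow> nat \<Rightarrow> bool" where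
  "dihedral_group G n \<longleftrightarrow>
     group G \<and> Coset.order G = 2 * n \<and>
     (\<exists>r\<in>carrier G. \<exists>s\<in>carrier G.
        carrier G = generate G {r, s} \<and> group.ord G r = n \<and> group.ord G s = 2 \<and>
        s \<otimes>\<^bsub>G\<^esub> r \<otimes>\<^bsub>G\<^esub> s = inv\<^bsub>G\<^esub> r)"

end

theory Submission
  imports Defs "Jordan_Normal_Form.Char_Poly"
begin

text \<open>
All eight conditions say that one sign is \<open>-1\<close>.  Since \<open>8\<close> divides \<open>p - 1\<close>, there is an integer \<open>z\<close> with
\<open>z ^ 4 \<equiv> -1 (mod p)\<close>, a primitive eighth root of unity; the sign is the Legendre symbol \<open>\<epsilon>\<close> of \<open>1 + z\<^sup>2\<close>.

\<^emph>\<open>Elementary conditions.\<close>  The square roots of \<open>-1\<close> and \<open>2\<close> modulo \<open>p\<close> are \<open>j = \<plusminus>z\<^sup>2\<close> and \<open>r = \<plusminus>(z - z ^ 3)\<close>.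
The identity \<open>(1 + z\<^sup>2) (1 + z - z ^ 3) \<equiv> (1 + z)\<^sup>2\<close> compares \<open>1 + j\<close> with \<open>1 + r\<close>, and \<open>1 + z\<^sup>2 \<equiv> z (z - z ^ 3)\<close>
compares \<open>1 + j\<close> with \<open>r\<close>, the symbol of \<open>z\<close> being \<open>(-1) ^ ((p - 1) / 8)\<close> by Euler's criterion.  If
\<open>p = a\<^sup>2 + b\<^sup>2\<close> with \<open>a\<close> odd, then quadratic reciprocity at the prime divisors of \<open>a\<close> shows that \<open>a\<close> is a square
modulo \<open>p\<close>, and \<open>a + b \<equiv> a (1 + j)\<close> for \<open>j = b / a\<close>, a square root of \<open>-1\<close>.  Reciprocity at the prime
divisors \<open>q\<close> of \<open>a + b\<close>, combined with \<open>2 p = (a + b)\<^sup>2 + (a - b)\<^sup>2\<close>, replaces the symbol of \<open>q\<close> modulo \<open>p\<close> by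
that of \<open>2\<close> modulo \<open>q\<close>; hence \<open>\<epsilon>\<close> depends only on \<open>a + b\<close> modulo \<open>8\<close> up to sign, that is, on \<open>(a + b)\<^sup>2\<close> modulo
\<open>16\<close>.  Writing the even one of \<open>a\<close> and \<open>b\<close> as \<open>2 c\<close> turns this into the condition on \<open>p - 1 + 4 c\<close>.

\<^emph>\<open>The fields.\<close>  With \<open>\<zeta> = (1 + \<i>) / \<surd>2\<close> the first identity reads \<open>(1 + \<i>) (1 + \<surd>2) = (1 + \<zeta>)\<^sup>2\<close> in
characteristic 0.  So \<open>\<surd>(1 + \<i>)\<close> and \<open>\<surd>(1 + \<surd>2)\<close> generate the same extension of \<open>\<rat>(\<i>, \<surd>2)\<close>, and \<open>N\<close> and \<open>M\<close> are
one and the same field (\<open>octic_eq_generate_field\<close>, \<open>octic_eq_normal_closure\<close>).  It is treated as a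
tower of three quadratic extensions, adjoining \<open>\<i>\<close>, \<open>\<alpha> = \<surd>(1 + \<i>)\<close> and \<open>\<surd>2\<close> in turn.  An automorphism is
determined by the images of \<open>\<alpha>\<close> and \<open>\<surd>2\<close>; complex conjugation and the conjugation of the last quadratic step
already produce all eight conceivable pairs of images, which gives the dihedral group.  Its centre is
generated by \<open>\<alpha> \<mapsto> -\<alpha>\<close>, \<open>\<surd>2 \<mapsto> \<surd>2\<close>, called \<open>central_rot\<close> below.

\<^emph>\<open>The Frobenius element.\<close>  Modulo a prime \<open>P\<close> above \<open>p\<close>, both \<open>\<i>\<close> and \<open>\<surd>2\<close> are congruent to integers and
are fixed by the \<open>p\<close>-th power map, while \<open>\<alpha> ^ p = \<alpha> (1 + \<i>) ^ ((p - 1) / 2) \<equiv> \<epsilon> \<alpha>\<close> by Euler's criterion.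
As \<open>P\<close> does not contain \<open>2\<close>, the possible images of \<open>\<alpha>\<close> and \<open>\<surd>2\<close> are distinct modulo \<open>P\<close>, so a Frobenius
element must be the identity if \<open>\<epsilon> = 1\<close> and \<open>central_rot\<close> if \<open>\<epsilon> = -1\<close> (\<open>is_frobenius_octic_iff\<close>).  Conversely
this automorphism satisfies the Frobenius congruence for every algebraic integer of the field and not just
for polynomials in the generators: climbing the tower, some multiple of the integer by an element outside \<open>P\<close>
is a combination of integers for which the congruence is known (\<open>frobenius_on_quad_ext\<close>).  The
closure of the algebraic integers under addition and multiplication comes from characteristic polynomials
of integer matrices, and primes above \<open>p\<close> exist by Zorn's lemma.
\<close>

section \<open>Legendre symbols\<close>

lemma Legendre_cong:
  "[a = b] (mod p) \<Longrightarrow> Legendre a p = Legendre b p"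
  by (simp add: Legendre_def QuadRes_def cong_def)

text \<open>
Legendre symbols are computed modulo \<open>p\<close>, by Euler's criterion; for \<open>p > 2\<close> a sign is
determined by its residue class.
\<close>

lemma sign_eq_if_cong:
  fixes x y :: int
  assumes "[x = y] (mod int p)" "2 < p" "x \<in> {-1, 0, 1}" "y \<in> {-1, 0, 1}"
  shows "x = y"
proof (rule ccontr)
  assume "x \<noteq> y"
  moreover have "int p dvd x - y" using assms(1) by (simp add: cong_iff_dvd_diff)
  ultimately have "int p \<le> \<bar>x - y\<bar>"
    using dvd_imp_le_int[of "x - y" "int p"] by simp
  with assms show False by auto
qed

lemma Legendre_values: "Legendre a p \<in> {-1, 0, 1}"
  by (simp add: Legendre_def)

lemma Legendre_eqI:
  assumes "Factorial_Ring.prime p" "2 < p" "[a ^ ((p - 1) div 2) = x] (mod int p)" "x \<in> {-1, 0, 1}"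
  shows "Legendre a (int p) = x"
  using sign_eq_if_cong[OF cong_trans[OF euler_criterion[OF assms(1,2)] assms(3)] assms(2)]
    Legendre_values assms(4) by blast

lemma Legendre_mult:
  assumes "Factorial_Ring.prime p" "2 < p"
  shows "Legendre (a * b) (int p) = Legendre a (int p) * Legendre b (int p)"
proof (rule Legendre_eqI[OF assms])
  show "[(a * b) ^ ((p - 1) div 2) = Legendre a (int p) * Legendre b (int p)] (mod int p)"
    unfolding power_mult_distrib
    by (intro cong_mult cong_sym[OF euler_criterion] assms)
  show "Legendre a (int p) * Legendre b (int p) \<in> {-1, 0, 1}"
    using Legendre_values[of a "int p"] Legendre_values[of b "int p"] by auto
qed

lemma Legendre_eq_0_iff: "Legendre a p = 0 \<longleftrightarrow> p dvd a"
  by (simp add: Legendre_def cong_0_iff)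

lemma Legendre_square:
  assumes "Factorial_Ring.prime p" "\<not> int p dvd a"
  shows "Legendre (a\<^sup>2) (int p) = 1"
proof -
  have "\<not> int p dvd a\<^sup>2"
    using assms by (simp add: prime_dvd_power_int_iff)
  moreover have "QuadRes (int p) (a\<^sup>2)"
    unfolding QuadRes_def using cong_refl by blast
  ultimately show ?thesis
    by (simp add: Legendre_def cong_0_iff)
qed

text \<open>
This is how two Legendre symbols are compared below: exhibit the product of the arguments as a square.
\<close>

lemma Legendre_eq_if_mult_square:
  assumes "Factorial_Ring.prime p" "2 < p" "[a * b = c\<^sup>2] (mod int p)" "\<not> int p dvd c"
  shows "Legendre a (int p) = Legendre b (int p)"
proof -
  have "Legendre a (int p) * Legendre b (int p) = 1"
    using Legendre_mult[OF assms(1,2), of a b] Legendre_cong[OF assms(3)]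
      Legendre_square[OF assms(1,4)] by simp
  then show ?thesis
    using Legendre_values[of a "int p"] Legendre_values[of b "int p"] by auto
qed

text \<open>
The second supplementary law, by Gauss's lemma: among the multiples \<open>2, 4, \<dots>, q - 1\<close> of \<open>2\<close> those
exceeding \<open>q / 2\<close> have to be counted.
\<close>

lemma Legendre_two:
  assumes "Factorial_Ring.prime q" "2 < q"
  shows "Legendre 2 (int q) = (if q mod 8 \<in> {1, 7} then 1 else -1)"
proof -
  define n where "n = (int q - 1) div 2"
  have "odd q" using assms prime_odd_nat by blast
  then have qn: "int q = 2 * n + 1" unfolding n_def by presburger
  have n0: "n > 0" using qn assms by simp
  interpret GAUSS q 2
    using assms by unfold_locales (auto simp: cong_def)
  have A: "A = {0<..n}" by (simp add: A_def n_def)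
  have "C = (\<lambda>y. 2 * y) ` A"
  proof -
    have "(x * 2) mod int q = 2 * x" if "x \<in> A" for x
      using that qn unfolding A by (intro mod_pos_pos_trivial[THEN trans]) auto
    then show ?thesis unfolding C_def B_def image_image by (intro image_cong) auto
  qed
  then have "E = (\<lambda>y. 2 * y) ` {n div 2<..n}"
    using n0 unfolding E_def A n_def[symmetric] by (auto simp: image_iff)
  then have "card E = nat (n - n div 2)"
    by (simp add: card_image inj_on_def)
  then have G: "Legendre 2 (int q) = (-1) ^ nat (n - n div 2)"
    using gauss_lemma by simp
  \<comment> \<open>The parity of the count depends on \<open>n\<close> modulo \<open>4\<close>, that is, on \<open>q\<close> modulo \<open>8\<close>.\<close>
  define k where "k = nat (n div 4)"
  have n4: "n = 4 * int k + n mod 4" using n0 by (simp add: k_def)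
  have "n mod 4 \<in> {0, 1, 2, 3}" by auto
  then show ?thesis
  proof (elim insertE emptyE)
    assume "n mod 4 = 0"
    with n4 qn have "n = 4 * int k" "q = 8 * k + 1" by linarith+
    then have "nat (n - n div 2) = 2 * k" "q mod 8 = 1" by auto
    then show ?thesis using G by simp
  next
    assume "n mod 4 = 1"
    with n4 qn have "n = 4 * int k + 1" "q = 8 * k + 3" by linarith+
    then have "nat (n - n div 2) = 2 * k + 1" "q mod 8 = 3" by (auto simp: nat_eq_iff)
    then show ?thesis using G by simp
  next
    assume "n mod 4 = 2"
    with n4 qn have "n = 4 * int k + 2" "q = 8 * k + 5" by linarith+
    then have "nat (n - n div 2) = 2 * k + 1" "q mod 8 = 5" by (auto simp: nat_eq_iff)
    then show ?thesis using G by simp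
  next
    assume "n mod 4 = 3"
    with n4 qn have "n = 4 * int k + 3" "q = 8 * k + 7" by linarith+
    then have "nat (n - n div 2) = 2 * (k + 1)" "q mod 8 = 7" by (auto simp: nat_eq_iff)
    then show ?thesis using G by (simp add: power_mult)
  qed
qed

text \<open>
Induction over the prime factorisation of \<open>m\<close>.  It replaces the Jacobi symbol: reciprocity is applied to
each prime divisor of \<open>m\<close> separately, and \<open>f\<close> records the common shape of the answers.
\<close>

lemma Legendre_eq_multiplicative:
  fixes f :: "nat \<Rightarrow> int"
  assumes p: "Factorial_Ring.prime p" "2 < p"
    and f1: "f 1 = 1"
    and f_mult: "\<And>a b. odd a \<Longrightarrow> odd b \<Longrightarrow> f (a * b) = f a * f b"
    and m: "odd m"
    and f_prime: "\<And>q. Factorial_Ring.prime q \<Longrightarrow> q dvd m \<Longrightarrow> Legendre (int q) (int p) = f q"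
  shows "Legendre (int m) (int p) = f m"
  using m f_prime
proof (induction m rule: less_induct)
  case (less m)
  show ?case
  proof (cases "m = 1")
    case True
    have "Legendre 1 (int p) = 1" using p by (intro Legendre_eqI) auto
    with True f1 show ?thesis by simp
  next
    case False
    then obtain q where q: "Factorial_Ring.prime q" "q dvd m" using prime_factor_nat by blast
    then obtain k where k: "m = q * k" by auto
    have "k < m" using k less.prems(1) prime_gt_1_nat[OF q(1)] by (cases "k = 0") auto
    moreover have "odd k" "odd q" using k less.prems(1) by auto
    ultimately have "Legendre (int k) (int p) = f k" using less k by auto
    moreover have "Legendre (int q) (int p) = f q" using less.prems(2) q by blast
    ultimately show ?thesis using f_mult \<open>odd k\<close> \<open>odd q\<close> k Legendre_mult[OF p] by simp
  qed
qed

text \<open>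
Thue's argument.  By the pigeonhole principle the map \<open>(x, y) \<mapsto> x + j y\<close> takes some value modulo \<open>p\<close> twice on
the square \<open>{0..\<lfloor>\<surd>p\<rfloor>}\<^sup>2\<close>.  The difference \<open>(a, b)\<close> of the two points satisfies \<open>a\<^sup>2 \<equiv> - b\<^sup>2\<close> and \<open>0 < a\<^sup>2 + b\<^sup>2 < 2 p\<close>.
\<close>

lemma two_squares_exist:
  fixes j :: int
  assumes p: "Factorial_Ring.prime p" and j: "[j\<^sup>2 = -1] (mod int p)"
  shows "\<exists>a b :: int. int p = a\<^sup>2 + b\<^sup>2"
proof -
  define k where "k = nat \<lfloor>sqrt p\<rfloor>"
  have k1: "real k \<le> sqrt p" unfolding k_def by simp
  have k2: "sqrt p < real k + 1" unfolding k_def by linarith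
  have "real p = (sqrt p)\<^sup>2" by simp
  also have "\<dots> < (real k + 1)\<^sup>2" using k2 by (intro power_strict_mono) auto
  finally have "real p < real ((k + 1)\<^sup>2)" by (simp add: add.commute)
  then have pk: "p < (k + 1)\<^sup>2" unfolding of_nat_less_iff .
  have "real (k\<^sup>2) = (real k)\<^sup>2" by simp
  also have "\<dots> \<le> (sqrt p)\<^sup>2" using k1 by (intro power_mono) auto
  finally have kp: "k\<^sup>2 \<le> p" by simp
  have "k\<^sup>2 \<noteq> p" using p prime_power_iff[of k 2] by auto
  with kp have kp: "k\<^sup>2 < p" by simp
  define f where "f = (\<lambda>(x, y). (x + j * y) mod int p)"
  define S where "S = {0..int k} \<times> {0..int k}"
  have "card (f ` S) \<le> card {0..<int p}"
    using prime_gt_0_nat[OF p] by (intro card_mono) (auto simp: f_def)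
  also have "\<dots> < card S"
  proof -
    have "card {0..int k} = k + 1" by simp
    then show ?thesis using pk by (simp only: S_def card_cartesian_product power2_eq_square) simp
  qed
  finally have "\<not> inj_on f S" using pigeonhole by blast
  then obtain x y x' y' where xy: "(x, y) \<in> S" "(x', y') \<in> S" "f (x, y) = f (x', y')"
      "(x, y) \<noteq> (x', y')" unfolding inj_on_def by auto
  define a b where "a = x - x'" and "b = y - y'"
  have nz: "a \<noteq> 0 \<or> b \<noteq> 0" using xy(4) unfolding a_def b_def by auto
  have "\<bar>a\<bar> \<le> int k" "\<bar>b\<bar> \<le> int k" using xy(1,2) unfolding a_def b_def S_def by auto
  then have "a\<^sup>2 \<le> (int k)\<^sup>2" "b\<^sup>2 \<le> (int k)\<^sup>2" by (simp_all add: abs_le_square_iff[symmetric])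
  moreover have "(int k)\<^sup>2 < int p" using kp by (metis of_nat_less_iff of_nat_power)
  ultimately have ub: "a\<^sup>2 + b\<^sup>2 < 2 * int p" by linarith
  have lb: "a\<^sup>2 + b\<^sup>2 > 0" using nz by (simp add: sum_power2_gt_zero_iff)
  have "[x + j * y = x' + j * y'] (mod int p)" using xy(3) by (simp add: f_def cong_def)
  then have "int p dvd a + j * b" unfolding a_def b_def cong_iff_dvd_diff by (simp add: algebra_simps)
  then have "int p dvd (a + j * b) * (a - j * b)" by simp
  moreover have "int p dvd (j\<^sup>2 + 1) * b\<^sup>2" using j by (simp add: cong_iff_dvd_diff)
  ultimately have "int p dvd (a + j * b) * (a - j * b) + (j\<^sup>2 + 1) * b\<^sup>2" by (rule dvd_add)
  moreover have "(a + j * b) * (a - j * b) + (j\<^sup>2 + 1) * b\<^sup>2 = a\<^sup>2 + b\<^sup>2"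
    by (simp add: algebra_simps power2_eq_square)
  ultimately obtain t where t: "a\<^sup>2 + b\<^sup>2 = int p * t" by auto
  have p0: "int p > 0" using prime_gt_0_nat[OF p] by simp
  have "int p * 0 < int p * t" "int p * t < int p * 2" using lb ub unfolding t by linarith+
  then have "0 < t" "t < 2"
    using mult_less_cancel_left_pos[OF p0, of 0 t] mult_less_cancel_left_pos[OF p0, of t 2] by blast+
  then have "t = 1" by simp
  then have "int p = a\<^sup>2 + b\<^sup>2" using t by simp
  then show ?thesis by blast
qed


section \<open>Primes congruent to 1 modulo 8\<close>

locale prime_1_mod_8 =
  fixes p :: nat
  assumes prime: "Factorial_Ring.prime p" and mod_8: "[p = 1] (mod 8)"
begin

lemma p_eq: "p = 8 * ((p - 1) div 8) + 1"
proof -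
  have "p mod 8 = 1" using mod_8 by (simp add: cong_def)
  then show ?thesis by presburger
qed

lemma p_gt_2: "2 < p"
proof -
  have "p \<noteq> 1" using prime by auto
  then show ?thesis using p_eq by (cases "(p - 1) div 8") auto
qed

lemma half: "(p - 1) div 2 = 4 * ((p - 1) div 8)"
  using p_eq by presburger

lemma odd_p: "odd p"
  using p_eq by presburger

lemmas L_mult = Legendre_mult[OF prime p_gt_2]
lemmas L_eq_if_mult_square = Legendre_eq_if_mult_square[OF prime p_gt_2]

lemma prime_int: "Factorial_Ring.prime (int p)"
  using prime by simp

lemma not_dvd_2: "\<not> int p dvd 2"
  using p_gt_2 zdvd_imp_le[of "int p" 2] by auto

lemma L_minus: "Legendre (- a) (int p) = Legendre a (int p)"
proof -
  have "[(- 1) ^ ((p - 1) div 2) = 1] (mod int p)"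
    unfolding half by simp
  then have "Legendre (- 1) (int p) = 1"
    by (rule Legendre_eqI[OF prime p_gt_2]) simp
  then show ?thesis using L_mult[of "-1" a] by simp
qed

lemma L_abs: "Legendre \<bar>a\<bar> (int p) = Legendre a (int p)"
  by (simp add: abs_if L_minus)

text \<open>
A primitive root has order \<open>8 n\<close>, so its \<open>4 n\<close>-th power is a square root of \<open>1\<close> other than \<open>1\<close>.
\<close>

lemma eighth_root_exists: "\<exists>z :: int. [z ^ 4 = -1] (mod int p)"
proof -
  obtain g where "\<forall>k>0. residue_primroot (p ^ k) g"
    using residue_primroot_odd_prime_power_exists[OF prime odd_p] by blast
  from spec[OF this, of 1] have "residue_primroot p g" by simp
  then have ord: "ord p g = p - 1"
    using totient_prime[OF prime] by (simp add: residue_primroot_def)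
  define n where "n = (p - 1) div 8"
  have n0: "n > 0" using p_eq p_gt_2 unfolding n_def by (cases "(p - 1) div 8") auto
  have pn: "p - 1 = 8 * n" using p_eq unfolding n_def by simp
  define w where "w = g ^ (4 * n)"
  have w2: "g ^ (8 * n) = w * w" by (simp add: w_def flip: power_add)
  have "[g ^ (8 * n) = 1] (mod p)"
    using ord_divides[of g "8 * n" p] ord pn by simp
  then have "[int (w * w) = int 1] (mod int p)"
    unfolding w2 cong_int_iff .
  then have "int p dvd (int w - 1) * (int w + 1)"
    by (simp add: cong_iff_dvd_diff algebra_simps)
  moreover have "\<not> int p dvd int w - 1"
  proof
    assume "int p dvd int w - 1"
    then have "[int w = int 1] (mod int p)" by (simp add: cong_iff_dvd_diff)
    then have "[g ^ (4 * n) = 1] (mod p)" unfolding w_def cong_int_iff .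
    then have "8 * n dvd 4 * n" using ord_divides[of g "4 * n" p] ord pn by simp
    then show False using n0 by (auto dest: dvd_imp_le)
  qed
  ultimately have "int p dvd int w + 1"
    using prime_dvd_mult_iff[OF prime_int] by blast
  moreover have "(int g ^ n) ^ 4 = int w" by (simp add: w_def mult.commute flip: power_mult)
  ultimately have "[(int g ^ n) ^ 4 = -1] (mod int p)"
    by (simp add: cong_iff_dvd_diff)
  then show ?thesis by blast
qed

lemma square_roots_cong:
  assumes "[x\<^sup>2 = y\<^sup>2] (mod int p)"
  shows "[x = y] (mod int p) \<or> [x = - y] (mod int p)"
proof -
  have "x\<^sup>2 - y\<^sup>2 = (x - y) * (x + y)" by (simp add: algebra_simps power2_eq_square)
  then have "int p dvd (x - y) * (x + y)" using assms by (simp add: cong_iff_dvd_diff)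
  then show ?thesis using prime_dvd_mult_iff[OF prime_int] by (auto simp: cong_iff_dvd_diff)
qed

lemma not_dvd_if_dvd_square_diff:
  assumes "[x\<^sup>2 = y] (mod int p)" "\<not> int p dvd y"
  shows "\<not> int p dvd x"
  using assms(2) cong_dvd_iff[OF assms(1)] dvd_trans[OF _ dvd_power[of 2 x]] by auto

text \<open>
Modulo \<open>p\<close> the number \<open>z - z ^ 3\<close> is \<open>z + 1 / z\<close>, the familiar expression of \<open>\<surd>2\<close> in terms of an eighth root of unity.
\<close>

lemma sqrt_2_square:
  assumes z: "[z ^ 4 = -1] (mod int p)"
  shows "[(z - z ^ 3)\<^sup>2 = 2] (mod int p)"
proof -
  \<comment> \<open>Only \<open>z ^ 4 \<equiv> -1\<close> is available modulo \<open>p\<close>, so identities are proved by exhibiting the factor \<open>z ^ 4 + 1\<close>.\<close>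
  have "(z - z ^ 3)\<^sup>2 - 2 = (z ^ 4 + 1) * (z\<^sup>2 - 2)"
    by (simp add: power2_eq_square power3_eq_cube power4_eq_xxxx algebra_simps)
  then show ?thesis using z by (simp add: cong_iff_dvd_diff)
qed

text \<open>
The two square roots of \<open>-1\<close> give the same symbol because \<open>(1 + \<i>) (1 - \<i>) = 2\<close> is a square modulo \<open>p\<close>.
\<close>

lemma Legendre_one_plus_i:
  assumes z: "[z ^ 4 = -1] (mod int p)" and j: "[j\<^sup>2 = -1] (mod int p)"
  shows "Legendre (1 + j) (int p) = Legendre (1 + z\<^sup>2) (int p)"
proof -
  have "[j\<^sup>2 = (z\<^sup>2)\<^sup>2] (mod int p)"
    using cong_trans[OF j cong_sym[OF z]] by (simp flip: power_mult)
  then consider "[j = z\<^sup>2] (mod int p)" | "[j = - z\<^sup>2] (mod int p)" using square_roots_cong by blast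
  then show ?thesis
  proof cases
    case 1
    then show ?thesis by (intro Legendre_cong) (simp add: cong_add_lcancel)
  next
    case 2
    have "[(1 + j) * (1 + z\<^sup>2) = (1 - z\<^sup>2) * (1 + z\<^sup>2)] (mod int p)"
      by (intro cong_mult) (use 2 in \<open>simp_all add: cong_iff_dvd_diff\<close>)
    also have "(1 - z\<^sup>2) * (1 + z\<^sup>2) = 2 - (z ^ 4 + 1)" by (simp add: algebra_simps flip: power_add)
    also have "[2 - (z ^ 4 + 1) = 2 - 0] (mod int p)"
      by (intro cong_diff) (use z in \<open>simp_all add: cong_iff_dvd_diff\<close>)
    finally have jz: "[(1 + j) * (1 + z\<^sup>2) = 2] (mod int p)" by simp
    note r = sqrt_2_square[OF z]
    show ?thesis
      using cong_trans[OF jz cong_sym[OF r]] not_dvd_if_dvd_square_diff[OF r not_dvd_2]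
      by (rule L_eq_if_mult_square)
  qed
qed

lemma sqrt_2_cases:
  assumes "[z ^ 4 = -1] (mod int p)" and "[r\<^sup>2 = 2] (mod int p)"
  shows "[r = z - z ^ 3] (mod int p) \<or> [r = - (z - z ^ 3)] (mod int p)"
  using square_roots_cong[OF cong_trans[OF assms(2) cong_sym[OF sqrt_2_square[OF assms(1)]]]] .

text \<open>
Modulo \<open>p\<close> this is \<open>(1 + \<i>) (1 + \<surd>2) = (1 + \<zeta>)\<^sup>2\<close>, where \<open>\<zeta>\<close> is the eighth root of unity with \<open>\<zeta>\<^sup>2 = \<i>\<close>.
\<close>

lemma Legendre_one_plus_sqrt_2_aux:
  assumes z: "[z ^ 4 = -1] (mod int p)"
  shows "Legendre (1 + (z - z ^ 3)) (int p) = Legendre (1 + z\<^sup>2) (int p)"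
proof (rule L_eq_if_mult_square)
  have "(1 + (z - z ^ 3)) * (1 + z\<^sup>2) - (1 + z)\<^sup>2 = (z ^ 4 + 1) * (- z)"
    by (simp add: power2_eq_square power3_eq_cube power4_eq_xxxx algebra_simps)
  then show "[(1 + (z - z ^ 3)) * (1 + z\<^sup>2) = (1 + z)\<^sup>2] (mod int p)"
    using z by (simp add: cong_iff_dvd_diff)
  show "\<not> int p dvd 1 + z"
  proof
    assume "int p dvd 1 + z"
    then have "int p dvd (1 + z) * ((z - 1) * (z\<^sup>2 + 1))" by simp
    moreover have "(1 + z) * ((z - 1) * (z\<^sup>2 + 1)) = (z ^ 4 + 1) - 2"
      by (simp add: power2_eq_square power4_eq_xxxx algebra_simps)
    moreover have "int p dvd z ^ 4 + 1" using z by (simp add: cong_iff_dvd_diff)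
    ultimately show False using not_dvd_2 by (metis dvd_diff_right_iff)
  qed
qed

text \<open>
Replacing \<open>z\<close> by \<open>- z\<close> changes the sign of \<open>z - z ^ 3\<close> but not \<open>z\<^sup>2\<close>.
\<close>

lemma Legendre_one_plus_sqrt_2:
  assumes z: "[z ^ 4 = -1] (mod int p)" and r: "[r\<^sup>2 = 2] (mod int p)"
  shows "Legendre (1 + r) (int p) = Legendre (1 + z\<^sup>2) (int p)"
  using sqrt_2_cases[OF assms]
proof
  assume "[r = z - z ^ 3] (mod int p)"
  then have "Legendre (1 + r) (int p) = Legendre (1 + (z - z ^ 3)) (int p)"
    by (intro Legendre_cong) (simp add: cong_add_lcancel)
  then show ?thesis using Legendre_one_plus_sqrt_2_aux[OF z] by simp
next
  assume "[r = - (z - z ^ 3)] (mod int p)"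
  then have "[1 + r = 1 + (- z - (- z) ^ 3)] (mod int p)"
    by (intro cong_add) simp_all
  then have "Legendre (1 + r) (int p) = Legendre (1 + (- z - (- z) ^ 3)) (int p)"
    by (rule Legendre_cong)
  also have "\<dots> = Legendre (1 + (- z)\<^sup>2) (int p)"
    by (rule Legendre_one_plus_sqrt_2_aux) (use z in simp)
  finally show ?thesis by simp
qed

text \<open>
Here \<open>1 + z\<^sup>2 \<equiv> z (z - z ^ 3)\<close>, and the symbol of \<open>z\<close> is \<open>z ^ ((p - 1) / 2) = (z ^ 4) ^ ((p - 1) / 8)\<close>.
\<close>

lemma Legendre_sqrt_2:
  assumes z: "[z ^ 4 = -1] (mod int p)" and r: "[r\<^sup>2 = 2] (mod int p)"
  shows "(-1) ^ ((p - 1) div 8) * Legendre r (int p) = Legendre (1 + z\<^sup>2) (int p)"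
proof -
  have "[z ^ ((p - 1) div 2) = (-1) ^ ((p - 1) div 8)] (mod int p)"
    unfolding half power_mult by (rule cong_pow[OF z])
  moreover have "(-1) ^ ((p - 1) div 8) \<in> {-1, 0, 1 :: int}"
    by (cases "even ((p - 1) div 8)") auto
  ultimately have Lz: "Legendre z (int p) = (-1) ^ ((p - 1) div 8)"
    by (rule Legendre_eqI[OF prime p_gt_2])
  have Lr: "Legendre r (int p) = Legendre (z - z ^ 3) (int p)"
    using sqrt_2_cases[OF assms] by (auto dest: Legendre_cong simp only: L_minus)
  have "z * (z - z ^ 3) - (1 + z\<^sup>2) = - (z ^ 4 + 1)"
    by (simp add: power2_eq_square power3_eq_cube power4_eq_xxxx algebra_simps)
  then have "[z * (z - z ^ 3) = 1 + z\<^sup>2] (mod int p)"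
    using z unfolding cong_iff_dvd_diff by (metis diff_minus_eq_add dvd_minus_iff)
  from Legendre_cong[OF this] show ?thesis unfolding L_mult Lz Lr .
qed

text \<open>
For a prime \<open>q\<close> dividing \<open>a\<close>, reciprocity gives \<open>(q / p) = (p / q)\<close> as \<open>p \<equiv> 1 (mod 4)\<close>, and \<open>p \<equiv> b\<^sup>2 (mod q)\<close>.
\<close>

lemma Legendre_two_squares_odd:
  assumes ab: "int p = a\<^sup>2 + b\<^sup>2" and a: "odd a"
  shows "Legendre a (int p) = 1"
proof -
  have "a \<noteq> 0" using a by auto
  then have b_lt: "b\<^sup>2 < int p" using ab by simp
  have "b \<noteq> 0"
  proof
    assume "b = 0"
    then have "int p = \<bar>a\<bar> ^ 2" using ab by simp
    then show False using prime_int prime_power_iff[of "\<bar>a\<bar>" 2] by simp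
  qed
  then have a_lt: "a\<^sup>2 < int p" using ab by simp
  have "Legendre (int (nat \<bar>a\<bar>)) (int p) = 1"
  proof (rule Legendre_eq_multiplicative[OF prime p_gt_2])
    show "odd (nat \<bar>a\<bar>)" using a by (simp add: even_nat_iff)
    fix q :: nat assume q: "Factorial_Ring.prime q" "q dvd nat \<bar>a\<bar>"
    have "int q dvd int (nat \<bar>a\<bar>)" using q(2) by (simp only: int_dvd_int_iff)
    then have qa: "int q dvd a" by simp
    have "odd q" using q(2) \<open>odd (nat \<bar>a\<bar>)\<close> by auto
    then have q2: "2 < q" using q(1) prime_ge_2_nat[of q] by (cases "q = 2") auto
    have qp: "q \<noteq> p"
    proof
      assume "q = p"
      then have "int p \<le> \<bar>a\<bar>" using qa \<open>a \<noteq> 0\<close> dvd_imp_le_int[of a "int p"] by simp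
      also have "\<bar>a\<bar> \<le> a\<^sup>2" using \<open>a \<noteq> 0\<close> self_le_power[of "\<bar>a\<bar>" 2] by simp
      finally show False using a_lt by simp
    qed
    have "\<not> int q dvd b"
    proof
      assume "int q dvd b"
      then have "int q dvd a\<^sup>2 + b\<^sup>2" using qa by (simp add: power2_eq_square)
      then have "q dvd p" unfolding ab[symmetric] int_dvd_int_iff .
      then show False using qp q(1) prime by (simp add: primes_dvd_imp_eq)
    qed
    moreover have "[int p = b\<^sup>2] (mod int q)"
      using qa unfolding ab cong_iff_dvd_diff by (simp add: power2_eq_square)
    ultimately have "Legendre (int p) (int q) = 1"
      using Legendre_cong[of "int p" "b\<^sup>2" "int q"] Legendre_square[OF q(1), of b] by simp
    moreover have "even ((p - 1) div 2)" unfolding half by simp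
    ultimately show "Legendre (int q) (int p) = 1"
      using Quadratic_Reciprocity[OF prime p_gt_2 q(1) q2] qp by simp
  qed auto
  then show ?thesis using L_abs by simp
qed

text \<open>
With \<open>j = b / a\<close> modulo \<open>p\<close> one has \<open>j\<^sup>2 \<equiv> -1\<close> and \<open>a + b \<equiv> a (1 + j)\<close>.
\<close>

lemma Legendre_sum_two_squares_aux:
  assumes z: "[z ^ 4 = -1] (mod int p)" and ab: "int p = a\<^sup>2 + b\<^sup>2" and a: "odd a"
  shows "Legendre (a + b) (int p) = Legendre (1 + z\<^sup>2) (int p)"
proof -
  have La: "Legendre a (int p) = 1" by (rule Legendre_two_squares_odd[OF ab a])
  then have "\<not> int p dvd a" using Legendre_eq_0_iff[of a "int p"] by simp
  then have "Rings.coprime a (int p)"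
    using prime_imp_coprime[OF prime_int] by (simp add: coprime_commute)
  then obtain a' where a': "[a * a' = 1] (mod int p)" using cong_solve_coprime_int by blast
  define j where "j = b * a'"
  have bj: "[b = a * j] (mod int p)"
    using cong_scalar_left[OF a', of b] by (simp add: j_def mult_ac cong_sym)
  have "[j\<^sup>2 = (p - a\<^sup>2) * a'\<^sup>2] (mod int p)"
    using ab by (simp add: j_def power_mult_distrib)
  also have "[(p - a\<^sup>2) * a'\<^sup>2 = (0 - a\<^sup>2) * a'\<^sup>2] (mod int p)"
    by (intro cong_mult cong_diff) (simp_all add: cong_0_iff)
  also have "(0 - a\<^sup>2) * a'\<^sup>2 = - ((a * a')\<^sup>2)" by (simp add: power_mult_distrib)
  also have "[- ((a * a')\<^sup>2) = - (1\<^sup>2)] (mod int p)"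
    using cong_pow[OF a', of 2] by (simp add: cong_minus_minus_iff)
  finally have j: "[j\<^sup>2 = -1] (mod int p)" by simp
  have "[a + b = a * (1 + j)] (mod int p)"
    using cong_add_lcancel[of a b "a * j"] bj by (simp add: distrib_left)
  then have "Legendre (a + b) (int p) = Legendre a (int p) * Legendre (1 + j) (int p)"
    unfolding L_mult[symmetric] by (rule Legendre_cong)
  then show ?thesis using La Legendre_one_plus_i[OF z j] by simp
qed

lemma parity_two_squares:
  assumes "int p = a\<^sup>2 + b\<^sup>2"
  shows "odd a \<and> even b \<or> even a \<and> odd b"
proof -
  have "odd (a\<^sup>2 + b\<^sup>2)" using odd_p unfolding assms[symmetric] by simp
  then show ?thesis by auto
qed

lemma Legendre_sum_two_squares:
  assumes z: "[z ^ 4 = -1] (mod int p)" and ab: "int p = a\<^sup>2 + b\<^sup>2"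
  shows "Legendre (a + b) (int p) = Legendre (1 + z\<^sup>2) (int p)"
  using parity_two_squares[OF ab] Legendre_sum_two_squares_aux[OF z, of a b]
    Legendre_sum_two_squares_aux[OF z, of b a] ab by (auto simp: add.commute)

text \<open>
For a prime \<open>q\<close> dividing \<open>a + b\<close>, the equation \<open>2 p = (a + b)\<^sup>2 + (a - b)\<^sup>2\<close> makes \<open>2 p\<close> a square modulo \<open>q\<close>, so
\<open>(q / p) = (p / q) = (2 / q)\<close>, and the supplementary law applies.
\<close>

lemma Legendre_sum_two_squares_mod_8:
  assumes ab: "int p = a\<^sup>2 + b\<^sup>2"
  shows "Legendre (a + b) (int p) = (if nat \<bar>a + b\<bar> mod 8 \<in> {1, 7} then 1 else -1)"
proof -
  define s d where "s = a + b" and "d = a - b"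
  have sd: "2 * int p = s\<^sup>2 + d\<^sup>2"
    unfolding ab s_def d_def by (simp add: power2_eq_square algebra_simps)
  have s: "odd s" using parity_two_squares[OF ab] by (auto simp: s_def)
  have d: "odd d" using parity_two_squares[OF ab] by (auto simp: d_def)
  have "s \<noteq> 0" "d \<noteq> 0" using s d by auto
  then have s_lt: "s\<^sup>2 < 2 * int p" using sd by simp
  define f where "f = (\<lambda>m :: nat. if m mod 8 \<in> {1, 7} then 1 else - 1 :: int)"
  have "Legendre (int (nat \<bar>s\<bar>)) (int p) = f (nat \<bar>s\<bar>)"
  proof (rule Legendre_eq_multiplicative[OF prime p_gt_2])
    show "f 1 = 1" by (simp add: f_def)
    show "f (m * n) = f m * f n" if "odd m" "odd n" for m n
    proof -
      have odd_mod: "k mod 8 = 1 \<or> k mod 8 = 3 \<or> k mod 8 = 5 \<or> k mod 8 = 7" if "odd k" for k :: nat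
        using that by presburger
      have "m mod 8 \<in> {1, 3, 5, 7}" "n mod 8 \<in> {1, 3, 5, 7}"
        using odd_mod[OF that(1)] odd_mod[OF that(2)] by auto
      moreover have "(m * n) mod 8 = ((m mod 8) * (n mod 8)) mod 8" by (simp add: mod_mult_eq)
      ultimately show ?thesis unfolding f_def by auto
    qed
    show "odd (nat \<bar>s\<bar>)" using s by (simp add: even_nat_iff)
    fix q :: nat assume q: "Factorial_Ring.prime q" "q dvd nat \<bar>s\<bar>"
    have "int q dvd int (nat \<bar>s\<bar>)" using q(2) by (simp only: int_dvd_int_iff)
    then have qs: "int q dvd s" by simp
    have "odd q" using q(2) \<open>odd (nat \<bar>s\<bar>)\<close> by auto
    then have q2: "2 < q" using q(1) prime_ge_2_nat[of q] by (cases "q = 2") auto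
    have qp: "q \<noteq> p"
    proof
      assume "q = p"
      then have "int p \<le> \<bar>s\<bar>" using qs \<open>s \<noteq> 0\<close> dvd_imp_le_int[of s "int p"] by simp
      then have "(int p)\<^sup>2 \<le> \<bar>s\<bar>\<^sup>2" by (intro power_mono) auto
      then have "int p * int p < 2 * int p" using s_lt by (simp add: power2_eq_square)
      then show False using p_gt_2 by simp
    qed
    have "\<not> int q dvd d"
    proof
      assume "int q dvd d"
      then have "int q dvd s\<^sup>2 + d\<^sup>2" using qs by (simp add: power2_eq_square)
      then have "q dvd 2 * p" using sd by (metis int_dvd_int_iff of_nat_mult of_nat_numeral)
      then have "q dvd 2 \<or> q dvd p" using q(1) prime_dvd_mult_iff by blast
      then show False using qp q(1) q2 prime by (auto simp: primes_dvd_imp_eq dest: dvd_imp_le)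
    qed
    moreover have "[2 * int p = d\<^sup>2] (mod int q)"
      using qs unfolding sd cong_iff_dvd_diff by (simp add: power2_eq_square)
    ultimately have "Legendre 2 (int q) = Legendre (int p) (int q)"
      using Legendre_eq_if_mult_square[OF q(1) q2] by blast
    moreover have "Legendre 2 (int q) = f q" using Legendre_two[OF q(1) q2] by (simp add: f_def)
    moreover have "even ((p - 1) div 2)" unfolding half by simp
    then have "Legendre (int p) (int q) * Legendre (int q) (int p) = 1"
      using Quadratic_Reciprocity[OF prime p_gt_2 q(1) q2] qp by simp
    then have "Legendre (int q) (int p) = Legendre (int p) (int q)"
      using Legendre_values[of "int p" "int q"] by auto
    ultimately show "Legendre (int q) (int p) = f q" by simp
  qed
  then show ?thesis using L_abs by (simp add: f_def s_def)
qed

lemma cong_9_mod_16_iff: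
  fixes s :: int
  assumes "odd s"
  shows "[s\<^sup>2 = 9] (mod 16) \<longleftrightarrow> nat \<bar>s\<bar> mod 8 \<notin> {1, 7}"
proof -
  define n where "n = nat \<bar>s\<bar>"
  have n: "s\<^sup>2 = int (n\<^sup>2)" "odd n" using assms by (simp_all add: n_def even_nat_iff)
  have "[s\<^sup>2 = 9] (mod 16) \<longleftrightarrow> [n\<^sup>2 = 9] (mod 16)"
    unfolding n(1) using cong_int_iff[of "n\<^sup>2" 9 16] by simp
  also have "\<dots> \<longleftrightarrow> (n mod 16)\<^sup>2 mod 16 = 9" by (simp add: cong_def power_mod)
  also have "\<dots> \<longleftrightarrow> n mod 8 \<notin> {1, 7}"
  proof -
    have "n mod 8 = (n mod 16) mod 8" by (simp add: mod_mod_cancel)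
    moreover have "n mod 16 \<in> {1, 3, 5, 7, 9, 11, 13, 15}" using n(2) by auto presburger
    ultimately show ?thesis by auto
  qed
  finally show ?thesis by (simp add: n_def)
qed

lemma Legendre_sum_two_squares_iff:
  assumes "int p = a\<^sup>2 + b\<^sup>2"
  shows "Legendre (a + b) (int p) = -1 \<longleftrightarrow> [(a + b)\<^sup>2 = 9] (mod 16)"
proof -
  have "odd (a + b)" using parity_two_squares[OF assms] by auto
  then show ?thesis using Legendre_sum_two_squares_mod_8[OF assms] cong_9_mod_16_iff by simp
qed

text \<open>
As \<open>p \<equiv> 1 (mod 8)\<close>, the number \<open>c\<close> is even.  Then \<open>(a + 2 c)\<^sup>2 = p + 4 a c \<equiv> p + 4 c (mod 16)\<close>, and both sides are
\<open>1\<close> or \<open>9\<close> modulo \<open>16\<close>.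
\<close>

lemma cong_9_mod_16_iff_not_dvd:
  assumes ac: "int p = a\<^sup>2 + 4 * c\<^sup>2"
  shows "[(a + 2 * c)\<^sup>2 = 9] (mod 16) \<longleftrightarrow> \<not> 16 dvd (int p - 1 + 4 * c)"
proof -
  obtain k where k: "int p = 8 * k + 1" using p_eq by (metis of_nat_1 of_nat_add of_nat_mult of_nat_numeral)
  have "odd a" using parity_two_squares[of a "2 * c"] ac by auto
  then obtain u where u: "a = 2 * u + 1" by (elim oddE)
  have "even (u * (u + 1))" by simp
  then obtain v where v: "u * (u + 1) = 2 * v" by (elim evenE)
  have "4 * c\<^sup>2 = 8 * (k - v)" using k ac v u by (simp add: power2_eq_square algebra_simps)
  then have "c\<^sup>2 = 2 * (k - v)" by simp
  then have "even (c\<^sup>2)" by simp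
  then obtain c' where c': "c = 2 * c'" by (auto elim: evenE)
  have "(a + 2 * c)\<^sup>2 = int p + 4 * a * c" unfolding ac by (simp add: power2_eq_square algebra_simps)
  also have "\<dots> = 8 * (k + c') + 1 + 16 * (u * c')" unfolding k u c' by (simp add: algebra_simps)
  finally have sq: "(a + 2 * c)\<^sup>2 = 8 * (k + c') + 1 + 16 * (u * c')" .
  have "[(a + 2 * c)\<^sup>2 = 9] (mod 16) \<longleftrightarrow> 16 dvd 8 * (k + c') - 8 + 16 * (u * c')"
    unfolding sq cong_iff_dvd_diff by (simp add: algebra_simps)
  also have "\<dots> \<longleftrightarrow> 16 dvd 8 * (k + c') - 8"
    by (rule dvd_add_left_iff) simp
  also have "\<dots> \<longleftrightarrow> \<not> 16 dvd 8 * (k + c')" by presburger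
  also have "8 * (k + c') = int p - 1 + 4 * c" unfolding k c' by simp
  finally show ?thesis .
qed

end

section \<open>Algebraic integers form a ring\<close>

text \<open>
The number is a root of the characteristic polynomial of the matrix, which is monic with integer coefficients.
\<close>

lemma algebraic_int_if_eigenvalue_of_int_matrix:
  fixes x :: complex and v :: "nat \<Rightarrow> complex" and A :: "nat \<Rightarrow> nat \<Rightarrow> int"
  assumes nz: "k < n" "v k \<noteq> 0"
    and eq: "\<And>k. k < n \<Longrightarrow> x * v k = (\<Sum>l<n. of_int (A k l) * v l)"
  shows "algebraic_int x"
proof -
  define M where "M = Matrix.mat n n (\<lambda>(k, l). A k l)"
  define M' where "M' = map_mat complex_of_int M"
  define w where "w = Matrix.vec n v"
  have M: "M \<in> carrier_mat n n" by (simp add: M_def)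
  then have M': "M' \<in> carrier_mat n n" by (simp add: M'_def)
  have "w \<in> carrier_vec n" by (simp add: w_def)
  moreover have "w \<noteq> 0\<^sub>v n"
  proof
    assume "w = 0\<^sub>v n"
    then have "vec_index w k = 0" using nz(1) by simp
    then show False using nz by (simp add: w_def)
  qed
  moreover have "M' *\<^sub>v w = x \<cdot>\<^sub>v w"
  proof (rule eq_vecI)
    fix i assume "i < dim_vec (x \<cdot>\<^sub>v w)"
    then have i: "i < n" by (simp add: w_def)
    then show "vec_index (M' *\<^sub>v w) i = vec_index (x \<cdot>\<^sub>v w) i"
      using eq[OF i] by (simp add: M'_def M_def w_def scalar_prod_def atLeast0LessThan)
  qed (simp add: M'_def M_def w_def)
  ultimately have "eigenvector M' w x"
    using M' by (simp add: eigenvector_def)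
  then have "poly (char_poly M') x = 0"
    using eigenvalue_root_char_poly[OF M'] by (auto simp: eigenvalue_def)
  then have "poly (map_poly of_int (char_poly M)) x = 0"
    using of_int_hom.char_poly_hom[OF M, where ?'a = complex] by (simp add: M'_def)
  moreover have "lead_coeff (char_poly M) = 1"
    using degree_monic_char_poly[OF M] by simp
  ultimately show ?thesis
    unfolding algebraic_int_altdef_ipoly by blast
qed

definition int_span :: "complex set \<Rightarrow> complex set" where
  "int_span V = {\<Sum>v\<in>V. of_int (c v) * v | c. True}"

lemma int_span_add: "x \<in> int_span V \<Longrightarrow> y \<in> int_span V \<Longrightarrow> x + y \<in> int_span V"
proof -
  assume "x \<in> int_span V" "y \<in> int_span V"
  then obtain c d where "x = (\<Sum>v\<in>V. of_int (c v) * v)" "y = (\<Sum>v\<in>V. of_int (d v) * v)"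
    by (auto simp: int_span_def)
  then have "x + y = (\<Sum>v\<in>V. of_int (c v + d v) * v)"
    by (simp add: sum.distrib distrib_right)
  then show ?thesis unfolding int_span_def by (intro CollectI exI[of _ "\<lambda>v. c v + d v"]) simp
qed

lemma int_span_scale: "x \<in> int_span V \<Longrightarrow> of_int k * x \<in> int_span V"
proof -
  assume "x \<in> int_span V"
  then obtain c where "x = (\<Sum>v\<in>V. of_int (c v) * v)"
    by (auto simp: int_span_def)
  then have "of_int k * x = (\<Sum>v\<in>V. of_int (k * c v) * v)"
    by (simp add: sum_distrib_left mult.assoc)
  then show ?thesis unfolding int_span_def by (intro CollectI exI[of _ "\<lambda>v. k * c v"]) simp
qed

lemma int_span_sum: "(\<And>i. i \<in> I \<Longrightarrow> f i \<in> int_span V) \<Longrightarrow> sum f I \<in> int_span V"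
proof (induction I rule: infinite_finite_induct)
  case (infinite I)
  have "0 \<in> int_span V" unfolding int_span_def by (intro CollectI exI[of _ "\<lambda>_. 0"]) simp
  then show ?case using infinite by simp
next
  case empty
  show ?case unfolding int_span_def by (intro CollectI exI[of _ "\<lambda>_. 0"]) simp
qed (auto intro: int_span_add)

lemma int_span_base: "finite V \<Longrightarrow> v \<in> V \<Longrightarrow> v \<in> int_span V"
  unfolding int_span_def
  by (intro CollectI exI[of _ "\<lambda>w. if w = v then 1 else 0"])
     (simp add: if_distrib[of "\<lambda>c. of_int c * _"] if_distribR sum.delta cong: if_cong)

lemma int_span_mult:
  assumes "\<And>v. v \<in> V \<Longrightarrow> x * v \<in> int_span V" and "y \<in> int_span V"
  shows "x * y \<in> int_span V"
proof -
  obtain c where "y = (\<Sum>v\<in>V. of_int (c v) * v)" using assms(2) by (auto simp: int_span_def)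
  then have "x * y = (\<Sum>v\<in>V. of_int (c v) * (x * v))" by (simp add: sum_distrib_left mult_ac)
  also have "\<dots> \<in> int_span V" by (intro int_span_sum int_span_scale assms(1))
  finally show ?thesis .
qed

text \<open>
Multiplication by \<open>x\<close> maps the finitely generated group to itself, so it is described by an integer matrix; the
list of generators is an eigenvector with eigenvalue \<open>x\<close>, nonzero because \<open>1\<close> is among them.
\<close>

lemma algebraic_int_if_int_span_stable:
  assumes "finite V" "1 \<in> V" "\<And>v. v \<in> V \<Longrightarrow> x * v \<in> int_span V"
  shows "algebraic_int x"
proof -
  obtain h where h: "bij_betw h {..<card V} V"
    using ex_bij_betw_nat_finite[OF assms(1)] by (auto simp: atLeast0LessThan)
  have "\<forall>v\<in>V. \<exists>c. x * v = (\<Sum>w\<in>V. of_int (c w) * w)"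
    using assms(3) by (simp add: int_span_def)
  from bchoice[OF this] obtain C
    where C: "\<And>v. v \<in> V \<Longrightarrow> x * v = (\<Sum>w\<in>V. of_int (C v w) * w)" by blast
  have "1 \<in> h ` {..<card V}" using h assms(2) by (simp add: bij_betw_def)
  then obtain k where k: "k < card V" "h k = 1" by auto
  show ?thesis
  proof (rule algebraic_int_if_eigenvalue_of_int_matrix)
    show "h k \<noteq> 0" using k by simp
    fix k assume "k < card V"
    then have "h k \<in> V" using h by (auto simp: bij_betw_def)
    from C[OF this] show "x * h k = (\<Sum>l<card V. of_int (C (h k) (h l)) * h l)"
      using sum.reindex_bij_betw[OF h, of "\<lambda>w. of_int (C (h k) w) * w"] by simp
  qed (rule k(1))
qed

lemma algebraic_int_power_reduce:
  fixes x :: complex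
  assumes "algebraic_int x"
  obtains n c where "n > 0" "x ^ n = (\<Sum>i<n. of_int (c i) * x ^ i)"
proof -
  obtain p :: "int poly" where p: "poly (map_poly of_int p) x = 0" "lead_coeff p = 1"
    using assms unfolding algebraic_int_altdef_ipoly by blast
  define n where "n = Polynomial.degree p"
  have deg: "Polynomial.degree (map_poly of_int p :: complex poly) = n"
    unfolding n_def by (rule degree_map_poly) auto
  have "0 = (\<Sum>i\<le>n. of_int (poly.coeff p i) * x ^ i)"
    using p(1) by (simp add: poly_altdef deg coeff_map_poly flip: n_def)
  also have "\<dots> = (\<Sum>i<n. of_int (poly.coeff p i) * x ^ i) + x ^ n"
    using p(2) by (simp add: lessThan_Suc_atMost[symmetric] n_def)
  finally have eq: "x ^ n = (\<Sum>i<n. of_int (- poly.coeff p i) * x ^ i)"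
    by (simp add: sum_negf eq_neg_iff_add_eq_0 add.commute)
  moreover have "n > 0" using eq by (cases n) auto
  ultimately show ?thesis by (intro that)
qed

text \<open>
The monomials \<open>x ^ i y ^ j\<close> with \<open>i\<close> and \<open>j\<close> below the degrees of the defining equations span a group that is
stable under multiplication by \<open>x\<close> and by \<open>y\<close>, hence by \<open>x + y\<close> and by \<open>x y\<close>.
\<close>

lemma algebraic_int_add_mult:
  fixes x y :: complex
  assumes "algebraic_int x" "algebraic_int y"
  shows algebraic_int_add: "algebraic_int (x + y)" and algebraic_int_mult: "algebraic_int (x * y)"
proof -
  obtain m c where m: "m > 0" "x ^ m = (\<Sum>i<m. of_int (c i) * x ^ i)"
    using algebraic_int_power_reduce[OF assms(1)] .
  obtain n d where n: "n > 0" "y ^ n = (\<Sum>i<n. of_int (d i) * y ^ i)"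
    using algebraic_int_power_reduce[OF assms(2)] .
  define V where "V = (\<lambda>(i, j). x ^ i * y ^ j) ` ({..<m} \<times> {..<n})"
  have fin: "finite V" by (simp add: V_def)
  have base: "x ^ i * y ^ j \<in> int_span V" if "i < m" "j < n" for i j
    using that by (intro int_span_base[OF fin]) (auto simp: V_def)
  have x: "x * v \<in> int_span V" if v: "v \<in> V" for v
  proof -
    obtain i j where ij: "v = x ^ i * y ^ j" "i < m" "j < n" using v by (auto simp: V_def)
    show ?thesis
    proof (cases "Suc i < m")
      case True
      then show ?thesis using base[of "Suc i" j] ij by (simp add: mult_ac)
    next
      case False
      then have "x * v = x ^ m * y ^ j" using ij by (cases "m = Suc i") (auto simp: mult_ac)
      also have "\<dots> = (\<Sum>i<m. of_int (c i) * (x ^ i * y ^ j))"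
        unfolding m(2) by (simp add: sum_distrib_right mult.assoc)
      also have "\<dots> \<in> int_span V" using ij(3) by (intro int_span_sum int_span_scale base) auto
      finally show ?thesis .
    qed
  qed
  have y: "y * v \<in> int_span V" if v: "v \<in> V" for v
  proof -
    obtain i j where ij: "v = x ^ i * y ^ j" "i < m" "j < n" using v by (auto simp: V_def)
    show ?thesis
    proof (cases "Suc j < n")
      case True
      then show ?thesis using base[of i "Suc j"] ij by (simp add: mult_ac)
    next
      case False
      then have "y * v = x ^ i * y ^ n" using ij by (cases "n = Suc j") (auto simp: mult_ac)
      also have "\<dots> = (\<Sum>j<n. of_int (d j) * (x ^ i * y ^ j))"
        unfolding n(2) by (simp add: sum_distrib_left mult_ac)
      also have "\<dots> \<in> int_span V" using ij(2) by (intro int_span_sum int_span_scale base) auto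
      finally show ?thesis .
    qed
  qed
  have one: "1 \<in> V" unfolding V_def using m(1) n(1) by (intro image_eqI[of _ _ "(0, 0)"]) auto
  show "algebraic_int (x + y)"
    using fin one by (rule algebraic_int_if_int_span_stable) (simp add: distrib_right int_span_add x y)
  show "algebraic_int (x * y)"
    using fin one by (rule algebraic_int_if_int_span_stable) (simp add: mult.assoc int_span_mult x y)
qed

lemma algebraic_int_power: "algebraic_int (x :: complex) \<Longrightarrow> algebraic_int (x ^ n)"
  by (induction n) (auto intro: algebraic_int_mult)

lemma algebraic_int_diff: "algebraic_int (x :: complex) \<Longrightarrow> algebraic_int y \<Longrightarrow> algebraic_int (x - y)"
  using algebraic_int_add[of x "- y"] by simp

section \<open>Subfields of the complex numbers\<close>

lemma complex_field_simps [simp]: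
  "carrier complex_field = UNIV" "monoid.mult complex_field = (*)" "monoid.one complex_field = 1"
  "ring.zero complex_field = 0" "ring.add complex_field = (+)"
  by (simp_all add: ring_of_type_algebra_def)

lemma complex_field_field: "field complex_field"
  by (rule field_from_type_algebra)

lemma complex_field_a_inv [simp]: "a_inv complex_field x = - x"
proof -
  interpret field complex_field by (rule complex_field_field)
  show ?thesis using minus_equality[of "- x" x] by simp
qed

lemma complex_field_m_inv: "x \<noteq> 0 \<Longrightarrow> m_inv complex_field x = inverse x"
proof -
  interpret field complex_field by (rule complex_field_field)
  assume "x \<noteq> 0"
  then show ?thesis using inv_unique'[of x "inverse x"] by simp
qed

lemma subfieldI_complex:
  assumes "1 \<in> K" "\<And>x. x \<in> K \<Longrightarrow> - x \<in> K" "\<And>x y. x \<in> K \<Longrightarrow> y \<in> K \<Longrightarrow> x + y \<in> K"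
    "\<And>x y. x \<in> K \<Longrightarrow> y \<in> K \<Longrightarrow> x * y \<in> K" "\<And>x. x \<in> K \<Longrightarrow> x \<noteq> 0 \<Longrightarrow> inverse x \<in> K"
  shows "subfield K complex_field"
proof -
  interpret field complex_field by (rule complex_field_field)
  show ?thesis
    using assms by (intro subfieldI' subringI) (auto simp: complex_field_m_inv)
qed

lemma
  assumes K: "subfield K complex_field"
  shows subfield_1: "1 \<in> K" and subfield_0: "0 \<in> K"
    and subfield_uminus: "\<And>x. x \<in> K \<Longrightarrow> - x \<in> K"
    and subfield_add: "\<And>x y. x \<in> K \<Longrightarrow> y \<in> K \<Longrightarrow> x + y \<in> K"
    and subfield_mult: "\<And>x y. x \<in> K \<Longrightarrow> y \<in> K \<Longrightarrow> x * y \<in> K"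
    and subfield_inverse: "\<And>x. x \<in> K \<Longrightarrow> inverse x \<in> K"
proof -
  interpret field complex_field by (rule complex_field_field)
  note R = subringE[OF subfieldE(1)[OF K]]
  show "1 \<in> K" "0 \<in> K" using R(2,3) by simp_all
  show "- x \<in> K" if "x \<in> K" for x using R(5)[OF that] by simp
  show "x + y \<in> K" "x * y \<in> K" if "x \<in> K" "y \<in> K" for x y using R(6,7)[OF that] by simp_all
  show "inverse x \<in> K" if "x \<in> K" for x
    using subfield_m_inv(1)[OF K, of x] that \<open>0 \<in> K\<close> by (cases "x = 0") (auto simp: complex_field_m_inv)
qed

lemma
  assumes K: "subfield K complex_field"
  shows subfield_diff: "\<And>x y. x \<in> K \<Longrightarrow> y \<in> K \<Longrightarrow> x - y \<in> K"
    and subfield_divide: "\<And>x y. x \<in> K \<Longrightarrow> y \<in> K \<Longrightarrow> x / y \<in> K"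
    and subfield_power: "\<And>x n. x \<in> K \<Longrightarrow> x ^ n \<in> K"
    and subfield_of_int: "of_int m \<in> K"
    and subfield_Rats: "\<rat> \<subseteq> K"
proof -
  show "x - y \<in> K" if "x \<in> K" "y \<in> K" for x y
    using subfield_add[OF K that(1) subfield_uminus[OF K that(2)]] by simp
  show div: "x / y \<in> K" if "x \<in> K" "y \<in> K" for x y
    using subfield_mult[OF K that(1) subfield_inverse[OF K that(2)]] by (simp add: divide_inverse)
  show "x ^ n \<in> K" if "x \<in> K" for x n
    by (induction n) (auto intro: subfield_1 subfield_mult K that)
  have nat: "of_nat n \<in> K" for n
    by (induction n) (auto intro: subfield_0 subfield_1 subfield_add K)
  show int: "of_int m \<in> K" for m
    by (cases m) (auto intro: nat subfield_uminus[OF K] simp del: of_nat_Suc)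
  show "\<rat> \<subseteq> K" by (auto elim!: Rats_cases' intro: div int)
qed

lemmas subfield_closed = subfield_0 subfield_1 subfield_uminus subfield_add subfield_mult
  subfield_inverse subfield_diff subfield_divide subfield_power subfield_of_int

lemma subfield_numeral: "subfield K complex_field \<Longrightarrow> numeral n \<in> K"
  using subfield_of_int[of K "numeral n"] by simp

lemma subfield_Rats_complex: "subfield \<rat> complex_field"
  by (rule subfieldI_complex) auto

text \<open>
A field homomorphism defined on a subfield, represented by a total function of which only the values
on the subfield are constrained.  Fixing the rationals is part of the notion because this is what Galois groups over \<open>\<rat>\<close> ask for.
\<close>

definition rat_hom_on :: "complex set \<Rightarrow> (complex \<Rightarrow> complex) \<Rightarrow> bool" where
  "rat_hom_on K \<phi> \<longleftrightarrow>
     (\<forall>x\<in>K. \<forall>y\<in>K. \<phi> (x + y) = \<phi> x + \<phi> y \<and> \<phi> (x * y) = \<phi> x * \<phi> y) \<and> (\<forall>q\<in>\<rat>. \<phi> q = q)"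

lemma
  assumes "rat_hom_on K \<phi>"
  shows rat_hom_add: "x \<in> K \<Longrightarrow> y \<in> K \<Longrightarrow> \<phi> (x + y) = \<phi> x + \<phi> y"
    and rat_hom_mult: "x \<in> K \<Longrightarrow> y \<in> K \<Longrightarrow> \<phi> (x * y) = \<phi> x * \<phi> y"
    and rat_hom_rat: "q \<in> \<rat> \<Longrightarrow> \<phi> q = q"
  using assms by (auto simp: rat_hom_on_def)

lemma
  assumes h: "rat_hom_on K \<phi>" and K: "subfield K complex_field" and x: "x \<in> K"
  shows rat_hom_uminus: "\<phi> (- x) = - \<phi> x"
    and rat_hom_power: "\<phi> (x ^ n) = \<phi> x ^ n"
    and rat_hom_eq_0_iff: "\<phi> x = 0 \<longleftrightarrow> x = 0"
    and rat_hom_inverse: "\<phi> (inverse x) = inverse (\<phi> x)"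
proof -
  have m1: "- 1 \<in> K" by (intro subfield_closed K)
  show "\<phi> (- x) = - \<phi> x"
    using rat_hom_mult[OF h m1 x] rat_hom_rat[OF h, of "- 1"] by simp
  show "\<phi> (x ^ n) = \<phi> x ^ n"
    by (induction n) (simp_all add: rat_hom_rat[OF h] rat_hom_mult[OF h] x subfield_power[OF K])
  have 0: "\<phi> 0 = 0" "\<phi> 1 = 1" using rat_hom_rat[OF h] by auto
  have inv: "\<phi> x * \<phi> (inverse x) = 1" if "x \<noteq> 0"
    using rat_hom_mult[OF h x subfield_inverse[OF K x]] that 0 by simp
  then show "\<phi> x = 0 \<longleftrightarrow> x = 0" using 0 by (cases "x = 0") auto
  show "\<phi> (inverse x) = inverse (\<phi> x)"
  proof (cases "x = 0")
    case False
    then show ?thesis using inv inverse_unique by metis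
  qed (simp add: 0)
qed

lemma rat_hom_diff:
  assumes h: "rat_hom_on K \<phi>" and K: "subfield K complex_field" and x: "x \<in> K" and y: "y \<in> K"
  shows "\<phi> (x - y) = \<phi> x - \<phi> y"
  using rat_hom_add[OF h x subfield_uminus[OF K y]] rat_hom_uminus[OF h K y] by simp

lemma rat_hom_divide:
  assumes h: "rat_hom_on K \<phi>" and K: "subfield K complex_field" and x: "x \<in> K" and y: "y \<in> K"
  shows "\<phi> (x / y) = \<phi> x / \<phi> y"
  using rat_hom_mult[OF h x subfield_inverse[OF K y]] rat_hom_inverse[OF h K y]
  by (simp add: divide_inverse)

lemma rat_hom_sum:
  assumes h: "rat_hom_on K \<phi>" and K: "subfield K complex_field" and f: "\<And>i. i \<in> I \<Longrightarrow> f i \<in> K"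
  shows "\<phi> (sum f I) = (\<Sum>i\<in>I. \<phi> (f i))" "sum f I \<in> K"
proof -
  have "\<phi> (sum f I) = (\<Sum>i\<in>I. \<phi> (f i)) \<and> sum f I \<in> K"
    using f
    by (induction I rule: infinite_finite_induct)
       (auto simp: rat_hom_rat[OF h] rat_hom_add[OF h] subfield_0[OF K] subfield_add[OF K])
  then show "\<phi> (sum f I) = (\<Sum>i\<in>I. \<phi> (f i))" "sum f I \<in> K" by auto
qed

lemma rat_hom_poly:
  assumes h: "rat_hom_on K \<phi>" and K: "subfield K complex_field" and x: "x \<in> K"
    and f: "\<And>i. poly.coeff f i \<in> \<rat>"
  shows "\<phi> (poly f x) = poly f (\<phi> x)"
proof -
  have fK: "poly.coeff f i \<in> K" for i using f subfield_Rats[OF K] by blast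
  show ?thesis
    unfolding poly_altdef
    by (subst rat_hom_sum[OF h K])
       (auto intro!: subfield_closed K x fK simp: rat_hom_mult[OF h] rat_hom_power[OF h K x]
         rat_hom_rat[OF h f] subfield_power[OF K x] fK)
qed

lemma rat_hom_algebraic_int:
  assumes h: "rat_hom_on K \<phi>" and K: "subfield K complex_field" and x: "x \<in> K"
    and "algebraic_int x"
  shows "algebraic_int (\<phi> x)"
proof -
  from assms(4) obtain f :: "complex poly"
    where f: "lead_coeff f = 1" "\<forall>i. poly.coeff f i \<in> \<int>" "poly f x = 0"
    by (auto elim: algebraic_int.cases)
  have "poly f (\<phi> x) = \<phi> (poly f x)"
    using f(2) Ints_subset_Rats by (intro rat_hom_poly[OF h K x, symmetric]) blast
  then show ?thesis
    using f rat_hom_rat[OF h, of 0] by (intro algebraic_int.intros[of f]) auto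
qed

lemma rat_hom_on_subset: "rat_hom_on K \<phi> \<Longrightarrow> E \<subseteq> K \<Longrightarrow> rat_hom_on E \<phi>"
  by (auto simp: rat_hom_on_def)

lemma rat_hom_on_inj_on:
  assumes h: "rat_hom_on K \<phi>" and K: "subfield K complex_field"
  shows "inj_on \<phi> K"
proof (rule inj_onI)
  fix x y assume xy: "x \<in> K" "y \<in> K" "\<phi> x = \<phi> y"
  then have "\<phi> (x - y) = 0" using rat_hom_diff[OF h K] by simp
  then show "x = y" using rat_hom_eq_0_iff[OF h K, of "x - y"] subfield_diff[OF K] xy by simp
qed

section \<open>Quadratic extensions\<close>

definition quad_ext :: "complex set \<Rightarrow> complex \<Rightarrow> complex set" where
  "quad_ext E b = {u + v * b | u v. u \<in> E \<and> v \<in> E}"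

text \<open>
The value is only meaningful when the representation \<open>u + v b\<close> is unique, that is, for \<open>b \<notin> E\<close>.
\<close>

definition quad_conj :: "complex set \<Rightarrow> complex \<Rightarrow> complex \<Rightarrow> complex" where
  "quad_conj E b x = (THE y. \<exists>u\<in>E. \<exists>v\<in>E. x = u + v * b \<and> y = u - v * b)"

lemma quad_extI: "u \<in> E \<Longrightarrow> v \<in> E \<Longrightarrow> u + v * b \<in> quad_ext E b"
  by (auto simp: quad_ext_def)

lemma quad_extE:
  assumes "x \<in> quad_ext E b"
  obtains u v where "u \<in> E" "v \<in> E" "x = u + v * b"
  using assms by (auto simp: quad_ext_def)

lemma quad_ext_hom_eqI:
  assumes "rat_hom_on (quad_ext E b) \<phi>" "rat_hom_on (quad_ext E b) \<psi>"
    and E: "subfield E complex_field"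
    and "\<And>u. u \<in> E \<Longrightarrow> \<phi> u = \<psi> u" "\<phi> b = \<psi> b" "x \<in> quad_ext E b"
  shows "\<phi> x = \<psi> x"
proof -
  obtain u v where uv: "u \<in> E" "v \<in> E" "x = u + v * b" using assms(6) by (rule quad_extE)
  have E_sub: "w \<in> quad_ext E b" if "w \<in> E" for w
    using quad_extI[OF that subfield_0[OF E]] by simp
  have b: "b \<in> quad_ext E b"
    using quad_extI[OF subfield_0[OF E] subfield_1[OF E], of b] by simp
  have vb: "v * b \<in> quad_ext E b" using quad_extI[OF subfield_0[OF E] uv(2), of b] by simp
  show ?thesis
    using uv assms(4,5) E_sub b vb
    by (simp add: rat_hom_add[OF assms(1)] rat_hom_add[OF assms(2)]
        rat_hom_mult[OF assms(1)] rat_hom_mult[OF assms(2)])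
qed

locale quadratic_extension =
  fixes E :: "complex set" and b :: complex
  assumes E: "subfield E complex_field" and b2: "b\<^sup>2 \<in> E" and b: "b \<notin> E"
begin

lemma zero_iff: "u \<in> E \<Longrightarrow> v \<in> E \<Longrightarrow> u + v * b = 0 \<longleftrightarrow> u = 0 \<and> v = 0"
proof
  assume uv: "u \<in> E" "v \<in> E" "u + v * b = 0"
  show "u = 0 \<and> v = 0"
  proof (cases "v = 0")
    case False
    then have "b = - u / v" using uv(3) by (simp add: field_simps eq_neg_iff_add_eq_0)
    then have "b \<in> E" using uv E by (auto intro: subfield_closed)
    then show ?thesis using b by simp
  qed (use uv in auto)
qed auto

lemma eq_iff:
  assumes "u \<in> E" "v \<in> E" "u' \<in> E" "v' \<in> E"
  shows "u + v * b = u' + v' * b \<longleftrightarrow> u = u' \<and> v = v'"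
  using zero_iff[of "u - u'" "v - v'"] assms subfield_diff[OF E] by (auto simp: algebra_simps)

lemma quad_conj_eq: "u \<in> E \<Longrightarrow> v \<in> E \<Longrightarrow> quad_conj E b (u + v * b) = u - v * b"
  unfolding quad_conj_def by (rule the_equality) (auto simp: eq_iff)

lemma base_subset: "E \<subseteq> quad_ext E b"
  using quad_extI[OF _ subfield_0[OF E]] by force

lemma generator_in: "b \<in> quad_ext E b"
  using quad_extI[OF subfield_0[OF E] subfield_1[OF E], of b] by simp

lemma mult_eq: "(u + v * b) * (u' + v' * b) = (u * u' + v * v' * b\<^sup>2) + (u * v' + v * u') * b"
  by (simp add: algebra_simps power2_eq_square)

lemma subfield_quad_ext: "subfield (quad_ext E b) complex_field"
proof (rule subfieldI_complex)
  note closed = subfield_closed[OF E] b2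
  show "1 \<in> quad_ext E b" using base_subset subfield_1[OF E] by auto
  show "- x \<in> quad_ext E b" if "x \<in> quad_ext E b" for x
    using that
  proof (rule quad_extE)
    fix u v assume uv: "u \<in> E" "v \<in> E" "x = u + v * b"
    then have x: "- x = - u + (- v) * b" by simp
    show ?thesis unfolding x by (intro quad_extI closed uv)
  qed
  fix x assume x: "x \<in> quad_ext E b"
  then obtain u v where uv: "u \<in> E" "v \<in> E" "x = u + v * b" by (rule quad_extE)
  {
    fix y assume "y \<in> quad_ext E b"
    then obtain u' v' where uv': "u' \<in> E" "v' \<in> E" "y = u' + v' * b" by (rule quad_extE)
    have xy: "x + y = (u + u') + (v + v') * b" unfolding uv uv' by (simp add: algebra_simps)
    show "x + y \<in> quad_ext E b" unfolding xy by (intro quad_extI closed uv uv')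
    show "x * y \<in> quad_ext E b"
      unfolding uv(3) uv'(3) mult_eq by (intro quad_extI closed uv uv')
  }
  assume "x \<noteq> 0"
  define n where "n = u\<^sup>2 - v\<^sup>2 * b\<^sup>2"
  have n: "n \<in> E" unfolding n_def using uv by (auto intro!: closed)
  have n_eq: "n = (u + v * b) * (u + (- v) * b)"
    by (simp add: n_def power2_eq_square algebra_simps)
  have "u \<noteq> 0 \<or> v \<noteq> 0" using \<open>x \<noteq> 0\<close> uv by auto
  then have "n \<noteq> 0"
    unfolding n_eq mult_eq_0_iff zero_iff[OF uv(1,2)] zero_iff[OF uv(1) subfield_uminus[OF E uv(2)]]
    by auto
  have "u / n + (- v / n) * b = (u + (- v) * b) / n" by (simp add: add_divide_distrib diff_divide_distrib)
  then have "x * (u / n + (- v / n) * b) = n / n" unfolding uv(3) n_eq by simp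
  then have inv: "inverse x = u / n + (- v / n) * b"
    using \<open>n \<noteq> 0\<close> by (intro inverse_unique) simp
  show "inverse x \<in> quad_ext E b" unfolding inv by (intro quad_extI closed uv n)
qed

lemma quad_conj_base: "u \<in> E \<Longrightarrow> quad_conj E b u = u"
  using quad_conj_eq[OF _ subfield_0[OF E]] by simp

lemma quad_conj_generator: "quad_conj E b b = - b"
  using quad_conj_eq[OF subfield_0[OF E] subfield_1[OF E]] by simp

lemma quad_conj_in: "x \<in> quad_ext E b \<Longrightarrow> quad_conj E b x \<in> quad_ext E b"
proof (elim quad_extE)
  fix u v assume uv: "u \<in> E" "v \<in> E" "x = u + v * b"
  have "u + (- v) * b \<in> quad_ext E b" by (intro quad_extI subfield_uminus[OF E] uv)
  then show ?thesis using uv by (simp add: quad_conj_eq)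
qed

lemma rat_hom_on_quad_conj: "rat_hom_on (quad_ext E b) (quad_conj E b)"
  unfolding rat_hom_on_def
proof (intro conjI ballI)
  note closed = subfield_closed[OF E] b2
  fix x y assume "x \<in> quad_ext E b" "y \<in> quad_ext E b"
  then obtain u v u' v' where uv: "u \<in> E" "v \<in> E" "x = u + v * b" "u' \<in> E" "v' \<in> E" "y = u' + v' * b"
    by (auto elim!: quad_extE)
  have qx: "quad_conj E b x = u - v * b" and qy: "quad_conj E b y = u' - v' * b"
    using uv by (simp_all add: quad_conj_eq)
  have "x + y = (u + u') + (v + v') * b" unfolding uv by (simp add: algebra_simps)
  moreover have "quad_conj E b ((u + u') + (v + v') * b) = (u + u') - (v + v') * b"
    by (intro quad_conj_eq closed uv)
  ultimately show "quad_conj E b (x + y) = quad_conj E b x + quad_conj E b y"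
    unfolding qx qy by (simp add: algebra_simps)
  have "quad_conj E b (x * y) = (u * u' + v * v' * b\<^sup>2) - (u * v' + v * u') * b"
    unfolding uv(3,6) mult_eq by (intro quad_conj_eq closed uv)
  then show "quad_conj E b (x * y) = quad_conj E b x * quad_conj E b y"
    unfolding qx qy by (simp add: power2_eq_square algebra_simps)
next
  fix q :: complex assume "q \<in> \<rat>"
  then show "quad_conj E b q = q" using quad_conj_base subfield_Rats[OF E] by blast
qed

lemma fixed_iff: "x \<in> quad_ext E b \<Longrightarrow> quad_conj E b x = x \<longleftrightarrow> x \<in> E"
proof (elim quad_extE)
  fix u v assume uv: "u \<in> E" "v \<in> E" "x = u + v * b"
  have b0: "b \<noteq> 0" using b subfield_0[OF E] by auto
  show "quad_conj E b x = x \<longleftrightarrow> x \<in> E"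
  proof
    assume "quad_conj E b x = x"
    then have "v = 0" using uv b0 by (auto simp: quad_conj_eq)
    then show "x \<in> E" using uv by simp
  qed (rule quad_conj_base)
qed

text \<open>
As \<open>b \<notin> E\<close>, the line through \<open>b\<close> extends the one-dimensional space \<open>E\<close> by one dimension.
\<close>

lemma dimension_quad_ext: "ring.dimension complex_field 2 E (quad_ext E b)"
proof -
  interpret field complex_field by (rule complex_field_field)
  have "dimension (Suc 1) E (line_extension E b E)"
    using b by (intro Suc_dim dimension_one[OF E]) auto
  moreover have "line_extension E b E = quad_ext E b"
    by (auto simp: line_extension_mem_iff quad_ext_def add.commute)
       (metis add.commute)+
  ultimately show ?thesis by (simp add: numeral_2_eq_2)
qed

end

section \<open>Automorphisms and normality\<close>

lemma Gal_rat_iff: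
  "\<sigma> \<in> carrier (Gal_rat K) \<longleftrightarrow> \<sigma> \<in> extensional K \<and> bij_betw \<sigma> K K \<and> rat_hom_on K \<sigma>"
  by (auto simp: Gal_rat_def Bij_def ring_iso_def Ring.ring_hom_def rat_hom_on_def dest: bij_betwE)

lemma Gal_rat_imp_Bij: "\<sigma> \<in> carrier (Gal_rat K) \<Longrightarrow> \<sigma> \<in> Bij K"
  by (simp add: Gal_rat_iff Bij_def)

lemma Gal_rat_hom: "\<sigma> \<in> carrier (Gal_rat K) \<Longrightarrow> rat_hom_on K \<sigma>"
  by (simp add: Gal_rat_iff)

lemma Gal_rat_in: "\<sigma> \<in> carrier (Gal_rat K) \<Longrightarrow> x \<in> K \<Longrightarrow> \<sigma> x \<in> K"
  by (auto simp: Gal_rat_iff bij_betw_def)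

lemma Gal_rat_one: "\<one>\<^bsub>Gal_rat K\<^esub> = (\<lambda>x\<in>K. x)"
  by (simp add: Gal_rat_def BijGroup_def)

lemma Gal_rat_mult:
  "\<sigma> \<in> carrier (Gal_rat K) \<Longrightarrow> \<tau> \<in> carrier (Gal_rat K) \<Longrightarrow> \<sigma> \<otimes>\<^bsub>Gal_rat K\<^esub> \<tau> = compose K \<sigma> \<tau>"
  using Gal_rat_imp_Bij[of \<sigma> K] Gal_rat_imp_Bij[of \<tau> K] by (simp add: Gal_rat_def BijGroup_def)

lemma Gal_rat_mult_apply:
  "\<sigma> \<in> carrier (Gal_rat K) \<Longrightarrow> \<tau> \<in> carrier (Gal_rat K) \<Longrightarrow> x \<in> K \<Longrightarrow>
     (\<sigma> \<otimes>\<^bsub>Gal_rat K\<^esub> \<tau>) x = \<sigma> (\<tau> x)"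
  by (simp add: Gal_rat_mult compose_eq)

lemma restrict_in_Gal_rat:
  assumes K: "subfield K complex_field" and h: "rat_hom_on K \<phi>" and surj: "\<phi> ` K = K"
  shows "restrict \<phi> K \<in> carrier (Gal_rat K)"
proof -
  have "rat_hom_on K (restrict \<phi> K)"
    using h subfield_Rats[OF K] by (auto simp: rat_hom_on_def subfield_add[OF K] subfield_mult[OF K])
  moreover have "bij_betw (restrict \<phi> K) K K"
    using rat_hom_on_inj_on[OF h K] surj by (simp add: bij_betw_def)
  ultimately show ?thesis by (simp add: Gal_rat_iff)
qed

lemma group_Gal_rat:
  assumes K: "subfield K complex_field"
  shows "Group.group (Gal_rat K)"
proof -
  define H where "H = carrier (Gal_rat K)"
  have "subgroup H (BijGroup K)"
  proof (rule group.subgroupI[OF group_BijGroup])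
    show "H \<subseteq> carrier (BijGroup K)"
      using Gal_rat_imp_Bij by (auto simp: H_def BijGroup_def)
    show "H \<noteq> {}"
      using restrict_in_Gal_rat[OF K, of "\<lambda>x. x"] by (auto simp: H_def rat_hom_on_def)
  next
    fix \<sigma> assume \<sigma>: "\<sigma> \<in> H"
    define \<tau> where "\<tau> = inv_into K \<sigma>"
    have bij: "bij_betw \<sigma> K K" and h: "rat_hom_on K \<sigma>" using \<sigma> by (auto simp: H_def Gal_rat_iff)
    have im: "\<tau> ` K = K" using bij_betw_inv_into[OF bij] by (simp add: \<tau>_def bij_betw_def)
    then have in_K: "\<tau> x \<in> K" if "x \<in> K" for x using that by blast
    have inv1: "\<sigma> (\<tau> x) = x" if "x \<in> K" for x
      using bij that by (simp add: \<tau>_def bij_betw_def f_inv_into_f)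
    have inv2: "\<tau> (\<sigma> x) = x" if "x \<in> K" for x
      using bij that by (simp add: \<tau>_def bij_betw_def)
    have "rat_hom_on K \<tau>"
      unfolding rat_hom_on_def
    proof (intro conjI ballI)
      fix x y assume xy: "x \<in> K" "y \<in> K"
      show "\<tau> (x + y) = \<tau> x + \<tau> y"
        using inv2[of "\<tau> x + \<tau> y"] xy in_K
        by (simp add: rat_hom_add[OF h] inv1 subfield_add[OF K])
      show "\<tau> (x * y) = \<tau> x * \<tau> y"
        using inv2[of "\<tau> x * \<tau> y"] xy in_K
        by (simp add: rat_hom_mult[OF h] inv1 subfield_mult[OF K])
    next
      fix q :: complex assume "q \<in> \<rat>"
      then show "\<tau> q = q" using inv2[of q] rat_hom_rat[OF h] subfield_Rats[OF K] by auto
    qed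
    then have "restrict \<tau> K \<in> H" unfolding H_def using im by (intro restrict_in_Gal_rat K)
    moreover have "inv\<^bsub>BijGroup K\<^esub> \<sigma> = restrict \<tau> K"
      using \<sigma> Gal_rat_imp_Bij by (simp add: H_def inv_BijGroup \<tau>_def)
    ultimately show "inv\<^bsub>BijGroup K\<^esub> \<sigma> \<in> H" by simp
  next
    fix \<sigma> \<tau> assume \<sigma>: "\<sigma> \<in> H" and \<tau>: "\<tau> \<in> H"
    then have "\<sigma> \<otimes>\<^bsub>BijGroup K\<^esub> \<tau> = restrict (\<sigma> \<circ> \<tau>) K"
      using Gal_rat_imp_Bij by (simp add: H_def BijGroup_def compose_def o_def)
    moreover have "(\<sigma> \<circ> \<tau>) ` K = \<sigma> ` \<tau> ` K" by (rule image_comp[symmetric])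
    then have "(\<sigma> \<circ> \<tau>) ` K = K"
      using \<sigma> \<tau> by (simp only: H_def Gal_rat_iff bij_betw_def)
    moreover have "rat_hom_on K (\<sigma> \<circ> \<tau>)"
      using Gal_rat_hom[OF \<sigma>[unfolded H_def]] Gal_rat_hom[OF \<tau>[unfolded H_def]]
        Gal_rat_in[OF \<tau>[unfolded H_def]]
      by (auto simp: rat_hom_on_def)
    ultimately show "\<sigma> \<otimes>\<^bsub>BijGroup K\<^esub> \<tau> \<in> H"
      unfolding H_def using restrict_in_Gal_rat[OF K] by simp
  qed
  then have "Group.group (BijGroup K\<lparr>carrier := H\<rparr>)"
    using group_BijGroup by (rule subgroup.subgroup_is_group)
  then show ?thesis by (simp add: H_def Gal_rat_def)
qed

text \<open>
A homomorphism acts on a product of linear factors over its domain by acting on the roots.  The statement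
speaks about single coefficients since \<open>\<phi>\<close> is a homomorphism on \<open>K\<close> only, not on all complex numbers.
\<close>

lemma rat_hom_coeff_prod:
  assumes K: "subfield K complex_field" and h: "rat_hom_on K \<phi>" and a: "\<And>i. i \<in> I \<Longrightarrow> a i \<in> K"
  shows "poly.coeff (\<Prod>i\<in>I. [:- a i, 1:]) n \<in> K \<and>
    \<phi> (poly.coeff (\<Prod>i\<in>I. [:- a i, 1:]) n) = poly.coeff (\<Prod>i\<in>I. [:- \<phi> (a i), 1:]) n"
  using a
proof (induction I arbitrary: n rule: infinite_finite_induct)
  case (infinite I)
  then show ?case using subfield_0[OF K] subfield_1[OF K] by (simp add: coeff_1 rat_hom_rat[OF h])
next
  case empty
  then show ?case using subfield_0[OF K] subfield_1[OF K] by (simp add: coeff_1 rat_hom_rat[OF h])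
next
  case (insert i I)
  have ai: "a i \<in> K" using insert by simp
  have IH: "poly.coeff (\<Prod>i\<in>I. [:- a i, 1:]) m \<in> K"
    "\<phi> (poly.coeff (\<Prod>i\<in>I. [:- a i, 1:]) m) = poly.coeff (\<Prod>i\<in>I. [:- \<phi> (a i), 1:]) m" for m
    using insert by auto
  show ?case
    using insert.hyps
    by (cases n)
       (auto simp: IH ai subfield_closed[OF K] rat_hom_diff[OF h K] rat_hom_add[OF h] rat_hom_mult[OF h]
         rat_hom_uminus[OF h K])
qed

lemma poly_map_of_rat_mult:
  "poly (map_poly of_rat (f * g)) (x :: complex) = poly (map_poly of_rat f) x * poly (map_poly of_rat g) x"
proof -
  interpret h: map_poly_comm_ring_hom "of_rat :: rat \<Rightarrow> complex" ..
  show ?thesis by (simp add: h.hom_mult)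
qed

lemma poly_map_of_rat_add:
  "poly (map_poly of_rat (f + g)) (x :: complex) = poly (map_poly of_rat f) x + poly (map_poly of_rat g) x"
proof -
  interpret h: map_poly_comm_ring_hom "of_rat :: rat \<Rightarrow> complex" ..
  show ?thesis by (simp add: h.hom_add)
qed

lemma rat_coeffs_imp_map_poly_of_rat:
  fixes g :: "complex poly"
  assumes "\<And>i. poly.coeff g i \<in> \<rat>"
  obtains f :: "rat poly" where "g = map_poly of_rat f"
proof
  define r where "r = inv_into UNIV (of_rat :: rat \<Rightarrow> complex)"
  have r: "of_rat (r q) = q" if "q \<in> \<rat>" for q
    unfolding r_def by (rule f_inv_into_f) (use that in \<open>simp add: Rats_def\<close>)
  have "r 0 = 0" using r[of 0] by simp
  then show "g = map_poly of_rat (map_poly r g)"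
    by (intro poly_eqI) (simp add: coeff_map_poly r assms)
qed

text \<open>
Otherwise the two polynomials are coprime, and a Bezout identity evaluated at the common root gives \<open>0 = 1\<close>.
\<close>

lemma irreducible_dvd_if_common_root:
  fixes f g :: "rat poly"
  assumes "Factorial_Ring.irreducible f" "poly (map_poly of_rat f) (x :: complex) = 0"
    "poly (map_poly of_rat g) x = 0"
  shows "f dvd g"
proof (rule ccontr)
  assume "\<not> f dvd g"
  then have "Rings.coprime f g"
    using assms(1) by (simp add: irreducible_imp_prime_elem prime_elem_imp_coprime)
  then have "gcd f g = 1" by simp
  then obtain u v where "u * f + v * g = 1"
    using bezout_coefficients_fst_snd[of f g] by metis
  then have "poly (map_poly of_rat (u * f + v * g)) x = 1" by simp
  then show False using assms(2,3) by (simp add: poly_map_of_rat_mult poly_map_of_rat_add)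
qed

text \<open>
Take a nonzero rational polynomial of least degree that vanishes at \<open>x\<close>.
\<close>

lemma irreducible_with_root_exists:
  fixes f :: "rat poly"
  assumes "f \<noteq> 0" "poly (map_poly of_rat f) (x :: complex) = 0"
  obtains g :: "rat poly" where "Factorial_Ring.irreducible g" "poly (map_poly of_rat g) x = 0"
proof -
  define P where "P g \<longleftrightarrow> g \<noteq> 0 \<and> poly (map_poly of_rat g) x = 0" for g :: "rat poly"
  have "P f" using assms by (simp add: P_def)
  then obtain g where g: "P g" and min: "\<And>h. P h \<Longrightarrow> Polynomial.degree g \<le> Polynomial.degree h"
    using arg_min_nat_lemma[of P f Polynomial.degree] by blast
  have "Factorial_Ring.irreducible g"
  proof (rule Factorial_Ring.irreducibleI)
    show "g \<noteq> 0" using g by (simp add: P_def)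
    show "\<not> g dvd 1"
    proof
      assume "g dvd 1"
      then obtain h where "1 = g * h" by (elim dvdE)
      have "poly (map_poly of_rat (1 :: rat poly)) x = 1" by simp
      then show False using g unfolding \<open>1 = g * h\<close> by (simp add: P_def poly_map_of_rat_mult)
    qed
    fix a b assume ab: "g = a * b"
    have "a \<noteq> 0" "b \<noteq> 0" using \<open>g \<noteq> 0\<close> ab by auto
    then have deg: "Polynomial.degree g = Polynomial.degree a + Polynomial.degree b"
      unfolding ab by (rule degree_mult_eq)
    have "P a \<or> P b"
      using g \<open>a \<noteq> 0\<close> \<open>b \<noteq> 0\<close> by (simp add: P_def ab poly_map_of_rat_mult)
    then have "Polynomial.degree b = 0 \<or> Polynomial.degree a = 0" using min deg by force
    then show "a dvd 1 \<or> b dvd 1"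
      using \<open>a \<noteq> 0\<close> \<open>b \<noteq> 0\<close> by (auto simp: is_unit_iff_degree)
  qed
  then show ?thesis using that g by (simp add: P_def)
qed

text \<open>
For \<open>x \<in> K\<close> the polynomial \<open>\<Prod>\<sigma>. (X - \<sigma> x)\<close> has coefficients fixed by the Galois group, hence rational ones.
An irreducible rational polynomial with root \<open>x\<close> divides it, so all its roots are conjugates \<open>\<sigma> x\<close>, which lie in \<open>K\<close>.
\<close>

lemma normal_over_rat_if_fixed_field_Rats:
  assumes K: "subfield K complex_field" and fin: "finite (carrier (Gal_rat K))"
    and fixed: "\<And>x. x \<in> K \<Longrightarrow> (\<And>\<sigma>. \<sigma> \<in> carrier (Gal_rat K) \<Longrightarrow> \<sigma> x = x) \<Longrightarrow> x \<in> \<rat>"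
  shows "normal_over_rat K"
proof -
  define G where "G = Gal_rat K"
  interpret G: Group.group G unfolding G_def by (rule group_Gal_rat[OF K])
  define g where "g x = (\<Prod>\<sigma>\<in>carrier G. [:- \<sigma> x, 1:])" for x
  have coeff_g: "poly.coeff (g x) n \<in> \<rat>" if x: "x \<in> K" for x n
  proof (rule fixed)
    have in_K: "\<sigma> x \<in> K" if "\<sigma> \<in> carrier G" for \<sigma> using Gal_rat_in that x by (simp add: G_def)
    show "poly.coeff (g x) n \<in> K"
      using rat_hom_coeff_prod[OF K Gal_rat_hom[OF G.one_closed[unfolded G_def]], of "carrier G" "\<lambda>\<sigma>. \<sigma> x"]
        in_K by (simp add: g_def)
    fix \<tau> assume \<tau>: "\<tau> \<in> carrier (Gal_rat K)"
    have "\<tau> (poly.coeff (g x) n) = poly.coeff (\<Prod>\<sigma>\<in>carrier G. [:- \<tau> (\<sigma> x), 1:]) n"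
      using rat_hom_coeff_prod[OF K Gal_rat_hom[OF \<tau>], of "carrier G" "\<lambda>\<sigma>. \<sigma> x"] in_K
      by (simp add: g_def)
    also have "(\<Prod>\<sigma>\<in>carrier G. [:- \<tau> (\<sigma> x), 1:]) = (\<Prod>\<sigma>\<in>carrier G. [:- (\<tau> \<otimes>\<^bsub>G\<^esub> \<sigma>) x, 1:])"
      using \<tau> x by (intro prod.cong) (simp_all add: G_def Gal_rat_mult_apply)
    also have "\<dots> = g x"
      unfolding g_def using \<tau> G.inj_on_cmult G.surj_const_mult
      by (intro prod.reindex_bij_betw) (simp add: bij_betw_def G_def)
    finally show "\<tau> (poly.coeff (g x) n) = poly.coeff (g x) n" .
  qed
  have root_g: "poly (g x) x = 0" if "x \<in> K" for x
    using fin G.one_closed that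
    by (auto simp: g_def poly_prod prod_zero_iff G_def Gal_rat_one intro!: bexI[of _ "\<lambda>x\<in>K. x"])
  have g_nz: "g x \<noteq> 0" for x using fin by (simp add: g_def G_def)
  show ?thesis
    unfolding normal_over_rat_def
  proof (intro conjI ballI allI impI K)
    show "algebraic x" if "x \<in> K" for x
      unfolding algebraic_altdef using coeff_g[OF that] root_g[OF that] g_nz by blast
    fix f :: "rat poly" and z :: complex
    assume f: "Factorial_Ring.irreducible f" and "\<exists>x\<in>K. poly (map_poly of_rat f) x = 0"
      and z: "poly (map_poly of_rat f) z = 0"
    then obtain x where x: "x \<in> K" "poly (map_poly of_rat f) x = 0" by blast
    obtain h where h: "g x = map_poly of_rat h"
      using rat_coeffs_imp_map_poly_of_rat coeff_g[OF x(1)] by metis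
    have "f dvd h"
      using irreducible_dvd_if_common_root[OF f x(2), of h] root_g[OF x(1)] by (simp add: h)
    then obtain k where "h = f * k" by (elim dvdE)
    then have "poly (g x) z = 0" using z by (simp add: h poly_map_of_rat_mult)
    then obtain \<sigma> where "\<sigma> \<in> carrier G" "z = \<sigma> x"
      using fin by (auto simp: g_def poly_prod prod_zero_iff G_def)
    then show "z \<in> K" using Gal_rat_in x(1) by (simp add: G_def)
  qed
qed

section \<open>The octic field\<close>

definition alpha :: complex where "alpha = csqrt (1 + \<i>)"
definition rt2 :: complex where "rt2 = complex_of_real (sqrt 2)"

abbreviation "Qi \<equiv> quad_ext \<rat> \<i>"
abbreviation "Qalpha \<equiv> quad_ext Qi alpha"
text \<open>
The field is built as a tower of quadratic steps over \<open>\<rat>\<close>, adjoining \<open>\<i>\<close>, then \<open>\<surd>(1 + \<i>)\<close>, then \<open>\<surd>2\<close>.  In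
this order the conjugation of the top step fixes \<open>alpha\<close>, which makes it a reflection of the dihedral group.
\<close>

definition octic_field :: "complex set" where "octic_field = quad_ext Qalpha rt2"

lemma alpha_square: "alpha\<^sup>2 = 1 + \<i>"
  by (simp add: alpha_def)

lemma rt2_square: "rt2\<^sup>2 = 2"
  by (simp add: rt2_def flip: of_real_power)

lemma alpha_neq_0: "alpha \<noteq> 0"
  using alpha_square by (auto simp: complex_eq_iff)

lemma rt2_neq_0: "rt2 \<noteq> 0"
  by (simp add: rt2_def)

lemma norm_alpha: "(cmod alpha)\<^sup>2 = sqrt 2"
proof -
  have "(cmod alpha)\<^sup>2 = cmod (1 + \<i>)" by (simp add: alpha_square flip: norm_power)
  then show ?thesis by (simp add: cmod_def)
qed

text \<open>
The other square root needed in the field, \<open>\<surd>(1 - \<i>)\<close>, comes for free: \<open>alpha\<close> times its complex conjugate is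
\<open>\<bar>alpha\<bar>\<^sup>2 = \<bar>1 + \<i>\<bar> = \<surd>2\<close>.
\<close>

lemma cnj_alpha: "cnj alpha = rt2 / alpha"
  using complex_norm_square[of alpha] alpha_neq_0
  by (simp add: norm_alpha rt2_def field_simps)

lemma cnj_alpha_square: "(cnj alpha)\<^sup>2 = 1 - \<i>"
proof -
  have "(cnj alpha)\<^sup>2 = cnj (alpha\<^sup>2)" by simp
  then show ?thesis by (simp add: alpha_square)
qed

lemma sqrt_2_irrational: "sqrt 2 \<notin> \<rat>"
proof
  assume "sqrt 2 \<in> \<rat>"
  moreover have "algebraic_int (sqrt 2)" by (intro algebraic_int_sqrt) simp
  ultimately have "sqrt 2 \<in> \<int>" by (intro rational_algebraic_int_is_int)
  then obtain n where "sqrt 2 = of_int n" by (elim Ints_cases)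
  moreover have "1 < sqrt 2" "sqrt 2 < 2" by (simp_all add: real_less_lsqrt)
  ultimately show False by simp
qed

lemma Rats_complexE:
  assumes "z \<in> (\<rat> :: complex set)"
  shows "Re z \<in> \<rat>" "Im z = 0"
proof -
  obtain a b :: int where "z = of_int a / of_int b" using assms by (elim Rats_cases')
  then have "z = complex_of_real (of_int a / of_int b)" by simp
  then show "Re z \<in> \<rat>" "Im z = 0" by (simp_all only: Re_complex_of_real Im_complex_of_real) simp
qed

text \<open>
Both steps above \<open>\<rat>(\<i>)\<close> are proper because real parts and squared absolute values of elements of \<open>\<rat>(\<i>)\<close> are
rational, whereas those of \<open>\<surd>2\<close> and \<open>alpha\<close>, respectively, equal \<open>\<surd>2\<close>.
\<close>

lemma Qi_Re_norm:
  assumes "x \<in> Qi"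
  shows "Re x \<in> \<rat>" "(cmod x)\<^sup>2 \<in> \<rat>"
proof -
  obtain u v where uv: "u \<in> \<rat>" "v \<in> \<rat>" "x = u + v * \<i>" using assms by (rule quad_extE)
  then have "Re x = Re u" "Im x = Re v" using Rats_complexE by auto
  then show "Re x \<in> \<rat>" "(cmod x)\<^sup>2 \<in> \<rat>"
    using Rats_complexE(1)[OF uv(1)] Rats_complexE(1)[OF uv(2)] by (auto simp: cmod_power2)
qed

interpretation Qi: quadratic_extension \<rat> \<i>
proof (rule quadratic_extension.intro)
  show "\<i> \<notin> \<rat>" using Rats_complexE(2)[of \<i>] by auto
qed (auto simp: subfield_Rats_complex)

interpretation Qalpha: quadratic_extension Qi alpha
proof (rule quadratic_extension.intro)
  show Qi: "subfield Qi complex_field" by (rule Qi.subfield_quad_ext)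
  show "alpha\<^sup>2 \<in> Qi"
    unfolding alpha_square by (intro subfield_add[OF Qi] subfield_1[OF Qi] Qi.generator_in)
  show "alpha \<notin> Qi" using Qi_Re_norm(2)[of alpha] sqrt_2_irrational by (auto simp: norm_alpha)
qed

interpretation octic: quadratic_extension Qalpha rt2
proof (rule quadratic_extension.intro)
  show Qalpha: "subfield Qalpha complex_field" by (rule Qalpha.subfield_quad_ext)
  show "rt2\<^sup>2 \<in> Qalpha" unfolding rt2_square by (rule subfield_numeral[OF Qalpha])
  note Qi = Qi.subfield_quad_ext
  show "rt2 \<notin> Qalpha"
  proof
    assume "rt2 \<in> Qalpha"
    then obtain u v where uv: "u \<in> Qi" "v \<in> Qi" "rt2 = u + v * alpha" by (rule quad_extE)
    \<comment> \<open>Comparing the coefficients of \<open>alpha\<close> in \<open>2 = (u + v alpha)\<^sup>2\<close> yields \<open>u v = 0\<close>.\<close>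
    have "2 + 0 * alpha = rt2 * rt2" using rt2_square by (simp add: power2_eq_square)
    also have "\<dots> = (u * u + v * v * alpha\<^sup>2) + (u * v + v * u) * alpha"
      unfolding uv(3) Qalpha.mult_eq ..
    finally have "0 = u * v + v * u"
      using uv subfield_numeral[OF Qi] Qalpha.b2
      by (subst (asm) Qalpha.eq_iff) (auto intro!: subfield_closed Qi)
    then have "u = 0 \<or> v = 0" by simp
    then show False
    proof
      assume "v = 0"
      then have "rt2 \<in> Qi" using uv by simp
      then show False using Qi_Re_norm(1)[of rt2] sqrt_2_irrational by (simp add: rt2_def)
    next
      assume "u = 0"
      then have "rt2 = v * alpha" using uv by simp
      then have "(cmod rt2)\<^sup>2 = (cmod v)\<^sup>2 * (cmod alpha)\<^sup>2"
        by (metis norm_mult power_mult_distrib)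
      then have "sqrt 2 * sqrt 2 = (cmod v)\<^sup>2 * sqrt 2" by (simp add: norm_alpha rt2_def)
      then have "sqrt 2 = (cmod v)\<^sup>2"
        by (metis mult_right_cancel real_sqrt_eq_zero_cancel_iff zero_neq_numeral)
      then show False using Qi_Re_norm(2)[OF uv(2)] sqrt_2_irrational by simp
    qed
  qed
qed

lemma subfield_octic: "subfield octic_field complex_field"
  unfolding octic_field_def by (rule octic.subfield_quad_ext)

lemma octic_subsets: "\<rat> \<subseteq> Qi" "Qi \<subseteq> Qalpha" "Qalpha \<subseteq> octic_field"
  unfolding octic_field_def by (rule Qi.base_subset Qalpha.base_subset octic.base_subset)+

lemma octic_generators: "\<i> \<in> octic_field" "alpha \<in> octic_field" "rt2 \<in> octic_field"
  using Qi.generator_in Qalpha.generator_in octic.generator_in octic_subsets by (auto simp: octic_field_def)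

lemma octic_subset_if_generators:
  assumes L: "subfield L complex_field" and "alpha \<in> L" "rt2 \<in> L"
  shows "octic_field \<subseteq> L"
proof
  have i_eq: "\<i> = alpha\<^sup>2 - 1" by (simp add: alpha_square)
  have i: "\<i> \<in> L"
    unfolding i_eq by (intro subfield_diff[OF L] subfield_power[OF L] subfield_1[OF L] assms)
  fix x assume "x \<in> octic_field"
  then show "x \<in> L"
    unfolding octic_field_def using subfield_Rats[OF L] assms i
    by (auto elim!: quad_extE intro!: subfield_add[OF L] subfield_mult[OF L])
qed

lemma octic_eq_generate_field:
  "octic_field = generate_field complex_field {complex_of_real (sqrt 2), csqrt (1 + \<i>)}"
proof -
  interpret field complex_field by (rule complex_field_field)
  show ?thesis
    using octic_generators octic_subset_if_generators
    by (intro generate_fieldI subfield_octic) (auto simp: alpha_def rt2_def)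
qed

lemma dimension_octic: "ring.dimension complex_field 8 \<rat> octic_field"
proof -
  interpret field complex_field by (rule complex_field_field)
  have "dimension (2 * 2) \<rat> Qalpha"
    by (rule telescopic_base[OF Qi.E Qalpha.E Qi.dimension_quad_ext Qalpha.dimension_quad_ext])
  from telescopic_base[OF Qi.E octic.E this octic.dimension_quad_ext] show ?thesis
    by (simp add: octic_field_def)
qed

lemma octic_hom_i:
  assumes h: "rat_hom_on octic_field \<phi>"
  shows "\<phi> \<i> = (\<phi> alpha)\<^sup>2 - 1"
proof -
  note F = subfield_octic
  have "\<i> = alpha\<^sup>2 - 1" by (simp add: alpha_square)
  also have "\<phi> (alpha\<^sup>2 - 1) = \<phi> (alpha\<^sup>2) - \<phi> 1"
    by (intro rat_hom_diff[OF h F] subfield_power[OF F] subfield_1[OF F] octic_generators)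
  also have "\<dots> = (\<phi> alpha)\<^sup>2 - 1"
    using rat_hom_power[OF h F octic_generators(2)] rat_hom_rat[OF h, of 1] by simp
  finally show ?thesis .
qed

text \<open>
The image of \<open>\<i> = alpha\<^sup>2 - 1\<close> is determined as well; then climb the tower.
\<close>

lemma octic_hom_eqI:
  assumes "rat_hom_on octic_field \<phi>" "rat_hom_on octic_field \<psi>"
    and "\<phi> alpha = \<psi> alpha" "\<phi> rt2 = \<psi> rt2" "x \<in> octic_field"
  shows "\<phi> x = \<psi> x"
proof -
  have "\<phi> \<i> = \<psi> \<i>" unfolding octic_hom_i[OF assms(1)] octic_hom_i[OF assms(2)] assms(3) ..
  have sub: "rat_hom_on Qalpha \<phi>" "rat_hom_on Qalpha \<psi>" "rat_hom_on Qi \<phi>" "rat_hom_on Qi \<psi>"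
    using assms(1,2) octic_subsets by (auto intro: rat_hom_on_subset[of octic_field])
  have "\<phi> x = \<psi> x" if "x \<in> Qi" for x
    by (rule quad_ext_hom_eqI[OF sub(3,4) Qi.E _ \<open>\<phi> \<i> = \<psi> \<i>\<close> that])
       (simp add: rat_hom_rat[OF assms(1)] rat_hom_rat[OF assms(2)])
  then have "\<phi> x = \<psi> x" if "x \<in> Qalpha" for x
    by (rule quad_ext_hom_eqI[OF sub(1,2) Qalpha.E _ assms(3) that])
  then show ?thesis
    by (rule quad_ext_hom_eqI[OF assms(1,2)[unfolded octic_field_def] octic.E _ assms(4)
          assms(5)[unfolded octic_field_def]])
qed

section \<open>The Galois group of the octic field\<close>

abbreviation octic_gal :: "(complex \<Rightarrow> complex) monoid" where "octic_gal \<equiv> Gal_rat octic_field"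

interpretation octic_gal: Group.group octic_gal
  by (rule group_Gal_rat[OF subfield_octic])

lemma Gal_octic_eqI:
  assumes "\<sigma> \<in> carrier octic_gal" "\<tau> \<in> carrier octic_gal" "\<sigma> alpha = \<tau> alpha" "\<sigma> rt2 = \<tau> rt2"
  shows "\<sigma> = \<tau>"
proof (rule extensionalityI)
  show "\<sigma> \<in> extensional octic_field" "\<tau> \<in> extensional octic_field"
    using assms by (simp_all add: Gal_rat_iff)
  show "\<sigma> x = \<tau> x" if "x \<in> octic_field" for x
    using octic_hom_eqI[OF Gal_rat_hom[OF assms(1)] Gal_rat_hom[OF assms(2)] assms(3,4) that] .
qed

lemma
  assumes "\<sigma> \<in> carrier octic_gal"
  shows Gal_octic_uminus: "x \<in> octic_field \<Longrightarrow> \<sigma> (- x) = - \<sigma> x"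
    and Gal_octic_cnj_alpha: "\<sigma> (cnj alpha) = \<sigma> rt2 / \<sigma> alpha"
    and Gal_octic_rt2: "\<sigma> rt2 \<in> {rt2, - rt2}"
    and Gal_octic_alpha: "\<sigma> alpha \<in> {alpha, - alpha, cnj alpha, - cnj alpha}"
proof -
  note h = Gal_rat_hom[OF assms] and F = subfield_octic
  show "\<sigma> (- x) = - \<sigma> x" if "x \<in> octic_field" using rat_hom_uminus[OF h F that] .
  show "\<sigma> (cnj alpha) = \<sigma> rt2 / \<sigma> alpha"
    unfolding cnj_alpha by (intro rat_hom_divide[OF h F] octic_generators)
  have "(\<sigma> rt2)\<^sup>2 = \<sigma> (rt2\<^sup>2)" using rat_hom_power[OF h F octic_generators(3)] by simp
  also have "\<dots> = rt2\<^sup>2" unfolding rt2_square by (rule rat_hom_rat[OF h]) simp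
  finally show "\<sigma> rt2 \<in> {rt2, - rt2}" unfolding power2_eq_iff by blast
  have "(\<sigma> \<i>)\<^sup>2 = \<sigma> (- 1)" using rat_hom_power[OF h F octic_generators(1), of 2] by simp
  also have "\<dots> = \<i>\<^sup>2" using rat_hom_rat[OF h, of "- 1"] by simp
  finally have i: "\<sigma> \<i> = \<i> \<or> \<sigma> \<i> = - \<i>" unfolding power2_eq_iff .
  have "(\<sigma> alpha)\<^sup>2 = \<sigma> (1 + \<i>)"
    using rat_hom_power[OF h F octic_generators(2), of 2] by (simp add: alpha_square)
  also have "\<dots> = 1 + \<sigma> \<i>"
    using rat_hom_add[OF h subfield_1[OF F] octic_generators(1)] rat_hom_rat[OF h, of 1] by simp
  finally have "(\<sigma> alpha)\<^sup>2 = alpha\<^sup>2 \<or> (\<sigma> alpha)\<^sup>2 = (cnj alpha)\<^sup>2"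
    using i unfolding alpha_square cnj_alpha_square by auto
  then show "\<sigma> alpha \<in> {alpha, - alpha, cnj alpha, - cnj alpha}"
    unfolding power2_eq_iff by blast
qed

lemma cnj_alpha_neq: "alpha \<noteq> cnj alpha" "alpha \<noteq> - cnj alpha" "cnj alpha \<noteq> alpha" "- cnj alpha \<noteq> alpha"
proof -
  have "alpha\<^sup>2 \<noteq> (cnj alpha)\<^sup>2" unfolding alpha_square cnj_alpha_square by (simp add: complex_eq_iff)
  then have neq: "alpha \<noteq> w" if "w\<^sup>2 = (cnj alpha)\<^sup>2" for w using that by blast
  note A = neq[OF refl] neq[OF power2_minus]
  show "alpha \<noteq> cnj alpha" "alpha \<noteq> - cnj alpha" "cnj alpha \<noteq> alpha" "- cnj alpha \<noteq> alpha"
    using A A[THEN not_sym] by blast+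
qed

lemma finite_Gal_octic: "finite (carrier octic_gal)"
proof -
  have "inj_on (\<lambda>\<sigma>. (\<sigma> alpha, \<sigma> rt2)) (carrier octic_gal)"
    by (auto intro!: inj_onI Gal_octic_eqI)
  moreover have "(\<lambda>\<sigma>. (\<sigma> alpha, \<sigma> rt2)) ` carrier octic_gal
      \<subseteq> {alpha, - alpha, cnj alpha, - cnj alpha} \<times> {rt2, - rt2}"
    using Gal_octic_alpha Gal_octic_rt2 by auto
  then have "finite ((\<lambda>\<sigma>. (\<sigma> alpha, \<sigma> rt2)) ` carrier octic_gal)"
    by (rule finite_subset) simp
  ultimately show ?thesis using finite_image_iff by blast
qed

definition refl_rt2 :: "complex \<Rightarrow> complex" where
  "refl_rt2 = restrict (quad_conj Qalpha rt2) octic_field"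

definition refl_cnj :: "complex \<Rightarrow> complex" where
  "refl_cnj = restrict cnj octic_field"

text \<open>
A rotation of order \<open>4\<close> in the dihedral group.
\<close>

definition rot :: "complex \<Rightarrow> complex" where
  "rot = refl_cnj \<otimes>\<^bsub>octic_gal\<^esub> refl_rt2"

text \<open>
The half turn \<open>alpha \<mapsto> - alpha\<close>, \<open>\<surd>2 \<mapsto> \<surd>2\<close>, which generates the centre.
\<close>

definition central_rot :: "complex \<Rightarrow> complex" where
  "central_rot = rot \<otimes>\<^bsub>octic_gal\<^esub> rot"

lemma refl_rt2_in: "refl_rt2 \<in> carrier octic_gal"
  unfolding refl_rt2_def
proof (rule restrict_in_Gal_rat[OF subfield_octic])
  show "rat_hom_on octic_field (quad_conj Qalpha rt2)"
    unfolding octic_field_def by (rule octic.rat_hom_on_quad_conj)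
  show "quad_conj Qalpha rt2 ` octic_field = octic_field"
  proof (intro equalityI subsetI)
    fix x assume x: "x \<in> octic_field"
    then obtain u v where uv: "u \<in> Qalpha" "v \<in> Qalpha" "x = u + v * rt2"
      unfolding octic_field_def by (rule quad_extE)
    then have "x = quad_conj Qalpha rt2 (u + (- v) * rt2)"
      by (subst octic.quad_conj_eq) (auto intro: subfield_uminus[OF octic.E])
    moreover have "u + (- v) * rt2 \<in> octic_field"
      unfolding octic_field_def by (intro quad_extI uv subfield_uminus[OF octic.E])
    ultimately show "x \<in> quad_conj Qalpha rt2 ` octic_field" by blast
  qed (auto simp: octic_field_def octic.quad_conj_in)
qed

lemma cnj_in_octic: "x \<in> octic_field \<Longrightarrow> cnj x \<in> octic_field"
proof -
  note F = subfield_octic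
  have cnj_alpha_in: "cnj alpha \<in> octic_field"
    unfolding cnj_alpha by (intro subfield_divide[OF F] octic_generators)
  have Rats: "cnj x = x" if "x \<in> \<rat>" for x using Rats_complexE(2)[OF that] by (simp add: complex_eq_iff)
  have Qi: "cnj x \<in> octic_field" if "x \<in> Qi" for x
    using that Rats octic_generators subfield_Rats[OF F]
    by (auto elim!: quad_extE intro!: subfield_diff[OF F] subfield_mult[OF F])
  have Qalpha: "cnj x \<in> octic_field" if "x \<in> Qalpha" for x
    using that
  proof (rule quad_extE)
    fix u v assume "u \<in> Qi" "v \<in> Qi" "x = u + v * alpha"
    then show ?thesis
      using subfield_add[OF F Qi subfield_mult[OF F Qi cnj_alpha_in]] by simp
  qed
  assume "x \<in> octic_field"
  then obtain u v where uv: "u \<in> Qalpha" "v \<in> Qalpha" "x = u + v * rt2"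
    unfolding octic_field_def by (rule quad_extE)
  have "cnj rt2 = rt2" by (simp add: rt2_def)
  then show ?thesis
    using uv Qalpha octic_generators by (auto intro!: subfield_add[OF F] subfield_mult[OF F])
qed

lemma refl_cnj_in: "refl_cnj \<in> carrier octic_gal"
  unfolding refl_cnj_def
proof (rule restrict_in_Gal_rat[OF subfield_octic])
  show "rat_hom_on octic_field cnj"
    unfolding rat_hom_on_def using Rats_complexE(2) by (auto simp: complex_eq_iff)
  show "cnj ` octic_field = octic_field"
  proof (intro equalityI subsetI)
    fix x assume "x \<in> octic_field"
    then show "x \<in> cnj ` octic_field"
      using cnj_in_octic by (intro image_eqI[of _ _ "cnj x"]) auto
  qed (auto simp: cnj_in_octic)
qed

lemma rot_in: "rot \<in> carrier octic_gal" and central_rot_in: "central_rot \<in> carrier octic_gal"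
  using refl_cnj_in refl_rt2_in by (simp_all add: rot_def central_rot_def)

lemma refl_rt2_values: "refl_rt2 alpha = alpha" "refl_rt2 rt2 = - rt2"
  using octic_generators octic.quad_conj_base[OF Qalpha.generator_in] octic.quad_conj_generator
  by (simp_all add: refl_rt2_def)

lemma rot_values: "rot alpha = cnj alpha" "rot rt2 = - rt2"
  using octic_generators refl_cnj_in refl_rt2_in Gal_octic_uminus[OF refl_cnj_in octic_generators(3)]
  by (simp_all add: rot_def Gal_rat_mult_apply refl_rt2_values) (simp_all add: refl_cnj_def rt2_def)

lemma central_rot_values: "central_rot alpha = - alpha" "central_rot rt2 = rt2"
  using octic_generators rot_in Gal_octic_cnj_alpha[OF rot_in] Gal_octic_uminus[OF rot_in] rt2_neq_0 alpha_neq_0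
  by (simp_all add: central_rot_def Gal_rat_mult_apply rot_values) (simp add: cnj_alpha)

text \<open>
Descend along the tower: being fixed by \<open>refl_rt2\<close>, by \<open>central_rot\<close> and by complex conjugation removes the
components at \<open>\<surd>2\<close>, at \<open>alpha\<close> and at \<open>\<i>\<close> in turn.
\<close>

lemma normal_octic: "normal_over_rat octic_field"
proof (rule normal_over_rat_if_fixed_field_Rats[OF subfield_octic finite_Gal_octic])
  fix x assume x: "x \<in> octic_field" and fixed: "\<And>\<sigma>. \<sigma> \<in> carrier octic_gal \<Longrightarrow> \<sigma> x = x"
  have "quad_conj Qalpha rt2 x = x" using fixed[OF refl_rt2_in] x by (simp add: refl_rt2_def)
  then have "x \<in> Qalpha" using x octic.fixed_iff by (simp add: octic_field_def)
  then obtain u v where uv: "u \<in> Qi" "v \<in> Qi" "x = u + v * alpha" by (rule quad_extE)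
  note h = Gal_rat_hom[OF central_rot_in]
  have h2: "rat_hom_on Qalpha central_rot" by (rule rat_hom_on_subset[OF h octic_subsets(3)])
  have "central_rot y = quad_conj Qi alpha y" if "y \<in> Qalpha" for y
  proof (rule quad_ext_hom_eqI[OF h2 Qalpha.rat_hom_on_quad_conj Qalpha.E _ _ that])
    have i: "central_rot \<i> = \<i>"
      using octic_hom_i[OF h] by (simp add: central_rot_values alpha_square)
    have h1: "rat_hom_on Qi central_rot" by (rule rat_hom_on_subset[OF h2 octic_subsets(2)])
    have id: "rat_hom_on Qi (\<lambda>x. x)" by (simp add: rat_hom_on_def)
    have "central_rot w = w" if "w \<in> Qi" for w
      using quad_ext_hom_eqI[OF h1 id Qi.E rat_hom_rat[OF h] i that] .
    then show "central_rot w = quad_conj Qi alpha w" if "w \<in> Qi" for w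
      using that Qalpha.quad_conj_base by simp
    show "central_rot alpha = quad_conj Qi alpha alpha"
      by (simp add: central_rot_values Qalpha.quad_conj_generator)
  qed
  then have "quad_conj Qi alpha x = x" using fixed[OF central_rot_in] \<open>x \<in> Qalpha\<close> by simp
  then have "x \<in> Qi" using Qalpha.fixed_iff \<open>x \<in> Qalpha\<close> by simp
  then obtain a b where ab: "a \<in> \<rat>" "b \<in> \<rat>" "x = a + b * \<i>" by (rule quad_extE)
  have "cnj x = x" using fixed[OF refl_cnj_in] x by (simp add: refl_cnj_def)
  then have "Im x = 0" by (simp add: complex_eq_iff)
  then have "Re b = 0" using ab Rats_complexE(2)[of a] by simp
  then have "b = 0" using Rats_complexE(2)[OF ab(2)] by (simp add: complex_eq_iff)
  then show "x \<in> \<rat>" using ab by simp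
qed

lemma one_values: "\<one>\<^bsub>octic_gal\<^esub> alpha = alpha" "\<one>\<^bsub>octic_gal\<^esub> rt2 = rt2"
  using octic_generators by (simp_all add: Gal_rat_one)

lemma cnj_alpha_in_octic: "cnj alpha \<in> octic_field"
  by (intro cnj_in_octic octic_generators)

lemma rt2_div_cnj_alpha: "rt2 / cnj alpha = alpha"
  using alpha_neq_0 rt2_neq_0 by (simp add: cnj_alpha)

lemma mult_values:
  assumes "\<sigma> \<in> carrier octic_gal" "\<tau> \<in> carrier octic_gal"
  shows "(\<sigma> \<otimes>\<^bsub>octic_gal\<^esub> \<tau>) alpha = \<sigma> (\<tau> alpha)" "(\<sigma> \<otimes>\<^bsub>octic_gal\<^esub> \<tau>) rt2 = \<sigma> (\<tau> rt2)"
  using assms octic_generators by (simp_all add: Gal_rat_mult_apply)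

lemma uminus_values:
  assumes "\<sigma> \<in> carrier octic_gal"
  shows "\<sigma> (- alpha) = - \<sigma> alpha" "\<sigma> (- rt2) = - \<sigma> rt2" "\<sigma> (- cnj alpha) = - \<sigma> (cnj alpha)"
  using assms octic_generators cnj_alpha_in_octic Gal_octic_uminus by blast+

lemmas Gal_octic_eval = mult_values uminus_values Gal_octic_cnj_alpha one_values
  refl_rt2_values rot_values central_rot_values refl_rt2_in rot_in central_rot_in
  rt2_div_cnj_alpha cnj_alpha[symmetric]

lemma refl_rt2_squared: "refl_rt2 \<otimes>\<^bsub>octic_gal\<^esub> refl_rt2 = \<one>\<^bsub>octic_gal\<^esub>"
  by (rule Gal_octic_eqI) (simp_all add: Gal_octic_eval)

lemma central_rot_squared: "central_rot \<otimes>\<^bsub>octic_gal\<^esub> central_rot = \<one>\<^bsub>octic_gal\<^esub>"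
  by (rule Gal_octic_eqI) (simp_all add: Gal_octic_eval)

lemma central_rot_neq_one: "central_rot \<noteq> \<one>\<^bsub>octic_gal\<^esub>"
  using central_rot_values(1) one_values(1) alpha_neq_0 by auto

lemma refl_rot_refl: "refl_rt2 \<otimes>\<^bsub>octic_gal\<^esub> rot \<otimes>\<^bsub>octic_gal\<^esub> refl_rt2 = inv\<^bsub>octic_gal\<^esub> rot"
proof (rule octic_gal.inv_equality[symmetric])
  show "refl_rt2 \<otimes>\<^bsub>octic_gal\<^esub> rot \<otimes>\<^bsub>octic_gal\<^esub> refl_rt2 \<otimes>\<^bsub>octic_gal\<^esub> rot = \<one>\<^bsub>octic_gal\<^esub>"
    by (rule Gal_octic_eqI) (simp_all add: Gal_octic_eval)
qed (simp_all add: Gal_octic_eval)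

text \<open>
The eight words \<open>1\<close>, \<open>r\<close>, \<open>r\<^sup>2\<close>, \<open>r ^ 3\<close>, \<open>s\<close>, \<open>r\<^sup>2 s\<close>, \<open>r s\<close>, \<open>r ^ 3 s\<close> in the rotation \<open>r\<close> and the reflection \<open>s\<close> realise the
eight pairs of images.  This gives both the order of the group and its generation by \<open>r\<close> and \<open>s\<close>.
\<close>

lemma Gal_octic_attains:
  assumes "y \<in> {alpha, - alpha, cnj alpha, - cnj alpha}" "w \<in> {rt2, - rt2}"
  shows "\<exists>\<sigma>\<in>generate octic_gal {rot, refl_rt2}. \<sigma> alpha = y \<and> \<sigma> rt2 = w"
proof -
  let ?H = "generate octic_gal {rot, refl_rt2}"
  note eng = generate.eng[of _ octic_gal "{rot, refl_rt2}"]
  have r: "rot \<in> ?H" and s: "refl_rt2 \<in> ?H" and one: "\<one>\<^bsub>octic_gal\<^esub> \<in> ?H"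
    by (auto intro: generate.incl generate.one)
  have z: "central_rot \<in> ?H" unfolding central_rot_def by (intro eng r)
  note words = one r z eng[OF z r] s eng[OF z s] eng[OF r s] eng[OF z eng[OF r s]]
  note witness = words[THEN rev_bexI]
  \<comment> \<open>The pairs are listed in the order of the words that realise them.\<close>
  have "(y, w) \<in> {(alpha, rt2), (cnj alpha, - rt2), (- alpha, rt2), (- cnj alpha, - rt2),
      (alpha, - rt2), (- alpha, - rt2), (cnj alpha, rt2), (- cnj alpha, rt2)}"
    using assms by auto
  then show ?thesis
    by (elim insertE emptyE Pair_inject; hypsubst)
       ((rule witness(1), simp add: Gal_octic_eval; fail) | (rule witness(2), simp add: Gal_octic_eval; fail) |
        (rule witness(3), simp add: Gal_octic_eval; fail) | (rule witness(4), simp add: Gal_octic_eval; fail) |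
        (rule witness(5), simp add: Gal_octic_eval; fail) | (rule witness(6), simp add: Gal_octic_eval; fail) |
        (rule witness(7), simp add: Gal_octic_eval; fail) | (rule witness(8), simp add: Gal_octic_eval; fail))+
qed

lemma carrier_Gal_octic_generate: "carrier octic_gal = generate octic_gal {rot, refl_rt2}"
proof
  show gen: "generate octic_gal {rot, refl_rt2} \<subseteq> carrier octic_gal"
    using rot_in refl_rt2_in by (intro octic_gal.generate_incl) auto
  show "carrier octic_gal \<subseteq> generate octic_gal {rot, refl_rt2}"
  proof
    fix \<sigma> assume \<sigma>: "\<sigma> \<in> carrier octic_gal"
    obtain \<tau> where \<tau>: "\<tau> \<in> generate octic_gal {rot, refl_rt2}" "\<tau> alpha = \<sigma> alpha" "\<tau> rt2 = \<sigma> rt2"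
      using Gal_octic_attains[OF Gal_octic_alpha[OF \<sigma>] Gal_octic_rt2[OF \<sigma>]] by blast
    then have "\<sigma> = \<tau>" using gen \<sigma> by (intro Gal_octic_eqI) auto
    then show "\<sigma> \<in> generate octic_gal {rot, refl_rt2}" using \<tau> by simp
  qed
qed

lemma order_Gal_octic: "Coset.order octic_gal = 8"
proof -
  let ?v = "\<lambda>\<sigma>. (\<sigma> alpha, \<sigma> rt2)"
  have "?v ` carrier octic_gal = {alpha, - alpha, cnj alpha, - cnj alpha} \<times> {rt2, - rt2}"
  proof
    show "?v ` carrier octic_gal \<subseteq> {alpha, - alpha, cnj alpha, - cnj alpha} \<times> {rt2, - rt2}"
      using Gal_octic_alpha Gal_octic_rt2 by auto
    show "{alpha, - alpha, cnj alpha, - cnj alpha} \<times> {rt2, - rt2} \<subseteq> ?v ` carrier octic_gal"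
    proof
      fix yw assume "yw \<in> {alpha, - alpha, cnj alpha, - cnj alpha} \<times> {rt2, - rt2}"
      then obtain \<sigma> where "\<sigma> \<in> carrier octic_gal" "\<sigma> alpha = fst yw" "\<sigma> rt2 = snd yw"
        using Gal_octic_attains[of "fst yw" "snd yw"] carrier_Gal_octic_generate by (auto simp: mem_Times_iff)
      then show "yw \<in> ?v ` carrier octic_gal" by (intro image_eqI[of _ _ \<sigma>]) auto
    qed
  qed
  moreover have "card ({alpha, - alpha, cnj alpha, - cnj alpha} \<times> {rt2, - rt2}) = 8"
  proof -
    have "- alpha \<noteq> cnj alpha" "- alpha \<noteq> - cnj alpha" using cnj_alpha_neq by (auto simp: minus_equation_iff)
    then show ?thesis
      using cnj_alpha_neq alpha_neq_0 rt2_neq_0 by (simp add: card_cartesian_product equation_minus_iff)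
  qed
  moreover have "inj_on ?v (carrier octic_gal)" by (auto intro!: inj_onI Gal_octic_eqI)
  ultimately show ?thesis by (simp add: Coset.order_def card_image[symmetric])
qed

lemma ord_rot: "group.ord octic_gal rot = 4"
proof -
  have sq: "rot [^]\<^bsub>octic_gal\<^esub> (2 :: nat) = central_rot"
    using rot_in by (simp add: numeral_2_eq_2 central_rot_def)
  have "rot [^]\<^bsub>octic_gal\<^esub> (4 :: nat) = (rot [^]\<^bsub>octic_gal\<^esub> (2 :: nat)) [^]\<^bsub>octic_gal\<^esub> (2 :: nat)"
    using rot_in by (simp add: octic_gal.nat_pow_pow)
  also have "\<dots> = \<one>\<^bsub>octic_gal\<^esub>"
    unfolding sq using central_rot_in central_rot_squared by (simp add: numeral_2_eq_2)
  finally have "group.ord octic_gal rot dvd 4" using octic_gal.pow_eq_id[OF rot_in] by blast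
  then have "group.ord octic_gal rot dvd 2 ^ 2" by simp
  then obtain k where k: "k \<le> 2" "group.ord octic_gal rot = 2 ^ k"
    using divides_primepow_nat[of 2 "group.ord octic_gal rot" 2] two_is_prime_nat by blast
  moreover have "\<not> group.ord octic_gal rot dvd 2"
    using octic_gal.pow_eq_id[OF rot_in, of 2] sq central_rot_neq_one by simp
  ultimately show ?thesis by (cases "k = 2") (auto simp: le_Suc_eq numeral_2_eq_2)
qed

lemma ord_refl_rt2: "group.ord octic_gal refl_rt2 = 2"
proof -
  have "refl_rt2 [^]\<^bsub>octic_gal\<^esub> (2 :: nat) = \<one>\<^bsub>octic_gal\<^esub>"
    using refl_rt2_in refl_rt2_squared by (simp add: numeral_2_eq_2)
  then have "group.ord octic_gal refl_rt2 dvd 2" using octic_gal.pow_eq_id[OF refl_rt2_in] by blast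
  then have "group.ord octic_gal refl_rt2 \<in> {1, 2}" using prime_nat_iff two_is_prime_nat by blast
  moreover have "refl_rt2 \<noteq> \<one>\<^bsub>octic_gal\<^esub>" using refl_rt2_values(2) one_values(2) rt2_neq_0 by auto
  then have "group.ord octic_gal refl_rt2 \<noteq> 1" using octic_gal.ord_eq_1[OF refl_rt2_in] by simp
  ultimately show ?thesis by simp
qed

lemma dihedral_Gal_octic: "dihedral_group octic_gal 4"
  unfolding dihedral_group_def
  using octic_gal.group_axioms order_Gal_octic rot_in refl_rt2_in carrier_Gal_octic_generate
    ord_rot ord_refl_rt2 refl_rot_refl by (intro conjI) auto

text \<open>
Commuting with \<open>refl_rt2\<close>, which fixes \<open>alpha\<close> and negates its complex conjugate, forces \<open>\<sigma> alpha = \<plusminus>alpha\<close>.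
Commuting with \<open>rot\<close> then forces \<open>\<sigma>\<close> to fix \<open>\<surd>2\<close>.
\<close>

lemma group_center_Gal_octic: "group_center octic_gal = {\<one>\<^bsub>octic_gal\<^esub>, central_rot}"
proof
  show "group_center octic_gal \<subseteq> {\<one>\<^bsub>octic_gal\<^esub>, central_rot}"
  proof
    fix \<sigma> assume "\<sigma> \<in> group_center octic_gal"
    then have \<sigma>: "\<sigma> \<in> carrier octic_gal" and comm: "\<And>\<tau>. \<tau> \<in> carrier octic_gal \<Longrightarrow> \<sigma> \<otimes>\<^bsub>octic_gal\<^esub> \<tau> = \<tau> \<otimes>\<^bsub>octic_gal\<^esub> \<sigma>"
      by (auto simp: group_center_def)
    have comm_alpha: "\<sigma> (\<tau> alpha) = \<tau> (\<sigma> alpha)" if \<tau>: "\<tau> \<in> carrier octic_gal" for \<tau>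
      using arg_cong[OF comm[OF \<tau>], of "\<lambda>\<phi>. \<phi> alpha"] \<sigma> \<tau> by (simp add: mult_values)
    have "refl_rt2 (\<sigma> alpha) = \<sigma> alpha"
      using comm_alpha[OF refl_rt2_in] by (simp add: refl_rt2_values)
    moreover have "refl_rt2 (cnj alpha) = - cnj alpha" "refl_rt2 (- cnj alpha) = cnj alpha"
      by (simp_all add: Gal_octic_eval)
    moreover have "cnj alpha \<noteq> 0" using alpha_neq_0 by simp
    ultimately have \<sigma>_alpha: "\<sigma> alpha \<in> {alpha, - alpha}"
      using Gal_octic_alpha[OF \<sigma>] by auto
    have "\<sigma> (cnj alpha) = rot (\<sigma> alpha)"
      using comm_alpha[OF rot_in] by (simp add: rot_values)
    then have "\<sigma> rt2 / \<sigma> alpha = rt2 / \<sigma> alpha"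
      using \<sigma>_alpha \<sigma> by (auto simp: Gal_octic_eval)
    then have "\<sigma> rt2 = rt2" using \<sigma>_alpha alpha_neq_0 by auto
    then have "\<sigma> = \<one>\<^bsub>octic_gal\<^esub> \<or> \<sigma> = central_rot"
      using \<sigma>_alpha \<sigma> Gal_octic_eqI[OF \<sigma> octic_gal.one_closed] Gal_octic_eqI[OF \<sigma> central_rot_in]
      by (auto simp: Gal_octic_eval)
    then show "\<sigma> \<in> {\<one>\<^bsub>octic_gal\<^esub>, central_rot}" by simp
  qed
  have "central_rot \<otimes>\<^bsub>octic_gal\<^esub> \<sigma> = \<sigma> \<otimes>\<^bsub>octic_gal\<^esub> central_rot" if \<sigma>: "\<sigma> \<in> carrier octic_gal" for \<sigma>
    using Gal_octic_alpha[OF \<sigma>] Gal_octic_rt2[OF \<sigma>] \<sigma>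
    by (intro Gal_octic_eqI) (auto simp: Gal_octic_eval)
  then show "{\<one>\<^bsub>octic_gal\<^esub>, central_rot} \<subseteq> group_center octic_gal"
    using central_rot_in by (auto simp: group_center_def)
qed

lemma generates_center_Gal_octic_iff:
  assumes "\<sigma> \<in> {\<one>\<^bsub>octic_gal\<^esub>, central_rot}"
  shows "generates_center octic_gal \<sigma> \<longleftrightarrow> \<sigma> = central_rot"
proof -
  have "x = \<one>\<^bsub>octic_gal\<^esub>" if "x \<in> generate octic_gal {\<one>\<^bsub>octic_gal\<^esub>}" for x
    using that by (induction rule: generate.induct) auto
  then have "central_rot \<notin> generate octic_gal {\<one>\<^bsub>octic_gal\<^esub>}" using central_rot_neq_one by blast
  then have "\<not> generates_center octic_gal \<one>\<^bsub>octic_gal\<^esub>"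
    by (auto simp: generates_center_def group_center_Gal_octic)
  moreover have "generates_center octic_gal central_rot"
  proof -
    have inv: "inv\<^bsub>octic_gal\<^esub> central_rot = central_rot"
      using central_rot_squared central_rot_in by (intro octic_gal.inv_equality) auto
    have "x \<in> {\<one>\<^bsub>octic_gal\<^esub>, central_rot}" if "x \<in> generate octic_gal {central_rot}" for x
      using that by (induction rule: generate.induct) (auto simp: inv central_rot_squared central_rot_in)
    moreover have "{\<one>\<^bsub>octic_gal\<^esub>, central_rot} \<subseteq> generate octic_gal {central_rot}"
      by (auto intro: generate.one generate.incl)
    ultimately show ?thesis
      using central_rot_in by (auto simp: generates_center_def group_center_Gal_octic)
  qed
  ultimately show ?thesis using assms by auto
qed

section \<open>The two descriptions of the octic field\<close>

definition beta :: complex where "beta = complex_of_real (sqrt (1 + sqrt 2))"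

lemma beta_square: "beta\<^sup>2 = 1 + rt2"
  by (simp add: beta_def rt2_def flip: of_real_power)

text \<open>
The identity \<open>(1 + \<i>) (1 + \<surd>2) = (1 + \<zeta>)\<^sup>2\<close> with \<open>\<zeta> = (1 + \<i>) / \<surd>2\<close>, which makes the two fields of the theorem equal.
\<close>

lemma alpha_mult_beta:
  "alpha * beta = 1 + (1 + \<i>) / rt2 \<or> alpha * beta = - (1 + (1 + \<i>) / rt2)"
proof -
  have "(alpha * beta)\<^sup>2 = (1 + \<i>) * (1 + rt2)"
    by (simp add: power_mult_distrib alpha_square beta_square)
  also have "\<dots> = (1 + (1 + \<i>) / rt2)\<^sup>2"
  proof -
    have "rt2 * rt2 = 2" using rt2_square by (simp add: power2_eq_square)
    then have "(1 + \<i>) * (1 + rt2) * rt2\<^sup>2 = (rt2 + (1 + \<i>))\<^sup>2"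
      by (simp add: power2_eq_square algebra_simps)
    then have "(1 + \<i>) * (1 + rt2) = (rt2 + (1 + \<i>))\<^sup>2 / rt2\<^sup>2"
      using rt2_neq_0 by (intro eq_divide_imp) simp_all
    moreover have "1 + (1 + \<i>) / rt2 = (rt2 + (1 + \<i>)) / rt2"
      using rt2_neq_0 by (simp add: add_divide_distrib)
    ultimately show ?thesis by (simp only: power_divide)
  qed
  finally show ?thesis unfolding power2_eq_iff .
qed

lemma beta_neq_0: "beta \<noteq> 0"
proof
  assume "beta = 0"
  then have "Re (1 + rt2) = 0" using beta_square by simp
  moreover have "sqrt 2 > 0" by simp
  ultimately show False by (simp add: rt2_def)
qed

lemma beta_in_octic: "beta \<in> octic_field"
proof -
  note F = subfield_octic
  have "1 + (1 + \<i>) / rt2 \<in> octic_field"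
    by (intro subfield_add[OF F] subfield_divide[OF F] subfield_1[OF F] octic_generators)
  then have "alpha * beta \<in> octic_field"
    using alpha_mult_beta subfield_uminus[OF F, of "1 + (1 + \<i>) / rt2"] by metis
  then have "alpha * beta / alpha \<in> octic_field" by (intro subfield_divide[OF F] octic_generators)
  then show ?thesis using alpha_neq_0 by simp
qed

text \<open>
An irreducible polynomial with root \<open>beta\<close> also has the root \<open>refl_rt2 beta\<close>, a square root of \<open>1 - \<surd>2\<close>, which is
therefore in \<open>L\<close>.  The product of the two roots is a square root of \<open>1 - 2\<close>, so \<open>\<i> \<in> L\<close>; together with
\<open>\<surd>2 = beta\<^sup>2 - 1\<close> this puts \<open>alpha\<close>, which is \<open>\<plusminus>(1 + \<zeta>) / beta\<close>, into \<open>L\<close>.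
\<close>

lemma octic_subset_if_normal:
  assumes L: "normal_over_rat L" and "beta \<in> L"
  shows "octic_field \<subseteq> L"
proof -
  have F: "subfield L complex_field" using L by (simp add: normal_over_rat_def)
  note h = Gal_rat_hom[OF refl_rt2_in]
  \<comment> \<open>This is \<open>(X\<^sup>2 - 1)\<^sup>2 - 2\<close>.\<close>
  define f :: "rat poly" where "f = [:-1, 0, -2, 0, 1:]"
  have "beta ^ 4 = (1 + rt2)\<^sup>2" unfolding beta_square[symmetric] by simp
  also have "\<dots> = 2 * (1 + rt2) + 1"
    using rt2_square by (simp add: power2_eq_square algebra_simps)
  also have "\<dots> = 2 * beta\<^sup>2 + 1" by (simp only: beta_square)
  finally have "poly (map_poly of_rat f) beta = 0"
    by (simp add: f_def map_poly_pCons power4_eq_xxxx power2_eq_square algebra_simps)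
  moreover have "f \<noteq> 0" by (simp add: f_def)
  ultimately obtain g :: "rat poly"
    where g: "Factorial_Ring.irreducible g" "poly (map_poly of_rat g) beta = 0"
    using irreducible_with_root_exists by blast
  have "refl_rt2 (poly (map_poly of_rat g) beta) = poly (map_poly of_rat g) (refl_rt2 beta)"
    by (rule rat_hom_poly[OF h subfield_octic beta_in_octic]) (simp add: coeff_map_poly)
  then have "poly (map_poly of_rat g) (refl_rt2 beta) = 0" using g(2) rat_hom_rat[OF h, of 0] by simp
  then have conj: "refl_rt2 beta \<in> L" using L g \<open>beta \<in> L\<close> by (auto simp: normal_over_rat_def)
  have "(refl_rt2 beta)\<^sup>2 = refl_rt2 (1 + rt2)"
    using rat_hom_power[OF h subfield_octic beta_in_octic, of 2] by (simp add: beta_square)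
  also have "\<dots> = 1 - rt2"
    using rat_hom_add[OF h subfield_1[OF subfield_octic] octic_generators(3)] rat_hom_rat[OF h, of 1]
    by (simp add: refl_rt2_values)
  finally have "(beta * refl_rt2 beta)\<^sup>2 = (1 + rt2) * (1 - rt2)"
    by (simp add: power_mult_distrib beta_square)
  also have "\<dots> = 1 - rt2\<^sup>2" by (simp add: power2_eq_square algebra_simps)
  also have "\<dots> = \<i>\<^sup>2" by (simp add: rt2_square)
  finally have "beta * refl_rt2 beta = \<i> \<or> beta * refl_rt2 beta = - \<i>" unfolding power2_eq_iff .
  moreover have "beta * refl_rt2 beta \<in> L" by (intro subfield_mult[OF F] conj \<open>beta \<in> L\<close>)
  ultimately have i: "\<i> \<in> L" using subfield_uminus[OF F, of "- \<i>"] by auto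
  have "rt2 = beta\<^sup>2 - 1" by (simp add: beta_square)
  then have rt2: "rt2 \<in> L"
    using subfield_diff[OF F subfield_power[OF F \<open>beta \<in> L\<close>, of 2] subfield_1[OF F]] by simp
  have "1 + (1 + \<i>) / rt2 \<in> L"
    by (intro subfield_add[OF F] subfield_divide[OF F] subfield_1[OF F] i rt2)
  then have "alpha * beta \<in> L"
    using alpha_mult_beta subfield_uminus[OF F, of "1 + (1 + \<i>) / rt2"] by metis
  then have "alpha * beta / beta \<in> L" by (intro subfield_divide[OF F] \<open>beta \<in> L\<close>)
  then have "alpha \<in> L" using beta_neq_0 by simp
  then show ?thesis using rt2 by (rule octic_subset_if_generators[OF F])
qed

lemma octic_eq_normal_closure:
  "octic_field = normal_closure_rat
     (generate_field complex_field {complex_of_real (sqrt (1 + sqrt 2))})"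
proof
  interpret field complex_field by (rule complex_field_field)
  show "octic_field \<subseteq> normal_closure_rat (generate_field complex_field {complex_of_real (sqrt (1 + sqrt 2))})"
    unfolding normal_closure_rat_def
  proof (rule Inter_greatest, clarify)
    fix L x assume "normal_over_rat L" "generate_field complex_field {complex_of_real (sqrt (1 + sqrt 2))} \<subseteq> L"
      "x \<in> octic_field"
    then show "x \<in> L"
      using octic_subset_if_normal[of L] generate_field.incl[of beta "{beta}" complex_field] by (auto simp: beta_def)
  qed
  have "generate_field complex_field {complex_of_real (sqrt (1 + sqrt 2))} \<subseteq> octic_field"
    using beta_in_octic by (intro generate_field_min_subfield1 subfield_octic) (auto simp: beta_def)
  then show "normal_closure_rat (generate_field complex_field {complex_of_real (sqrt (1 + sqrt 2))}) \<subseteq> octic_field"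
    unfolding normal_closure_rat_def using normal_octic by blast
qed

section \<open>Primes above a rational prime\<close>

abbreviation integers_of :: "complex set \<Rightarrow> complex set" where
  "integers_of K \<equiv> {x \<in> K. algebraic_int x}"

lemma integers_of_closed:
  assumes K: "subfield K complex_field"
  shows "0 \<in> integers_of K" "1 \<in> integers_of K" "of_int m \<in> integers_of K"
    and "x \<in> integers_of K \<Longrightarrow> - x \<in> integers_of K"
    and "x \<in> integers_of K \<Longrightarrow> y \<in> integers_of K \<Longrightarrow> x + y \<in> integers_of K"
    and "x \<in> integers_of K \<Longrightarrow> y \<in> integers_of K \<Longrightarrow> x - y \<in> integers_of K"
    and "x \<in> integers_of K \<Longrightarrow> y \<in> integers_of K \<Longrightarrow> x * y \<in> integers_of K"
    and "x \<in> integers_of K \<Longrightarrow> x ^ n \<in> integers_of K"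
  by (auto intro: subfield_closed[OF K] algebraic_int_add algebraic_int_diff algebraic_int_mult
      algebraic_int_power)

lemma ring_of_integers_simps [simp]:
  "carrier (ring_of_integers K) = integers_of K" "monoid.mult (ring_of_integers K) = (*)"
  "monoid.one (ring_of_integers K) = 1" "ring.zero (ring_of_integers K) = 0"
  "ring.add (ring_of_integers K) = (+)"
  by (simp_all add: ring_of_integers_def)

lemma cring_ring_of_integers:
  assumes K: "subfield K complex_field"
  shows "cring (ring_of_integers K)"
proof (rule cringI)
  show "abelian_group (ring_of_integers K)"
  proof (rule abelian_groupI)
    fix x assume "x \<in> carrier (ring_of_integers K)"
    then have "- x \<in> integers_of K" using integers_of_closed(4)[OF K] by simp
    then show "\<exists>y\<in>carrier (ring_of_integers K). y \<oplus>\<^bsub>ring_of_integers K\<^esub> x = \<zero>\<^bsub>ring_of_integers K\<^esub>"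
      by (intro bexI[of _ "- x"]) auto
  qed (use integers_of_closed(1,5)[OF K] in auto)
  show "comm_monoid (ring_of_integers K)"
    using integers_of_closed(2,7)[OF K] by (intro comm_monoidI) auto
qed (auto simp: distrib_right)

lemma ideal_ring_of_integers_iff:
  assumes K: "subfield K complex_field"
  shows "ideal I (ring_of_integers K) \<longleftrightarrow>
    I \<subseteq> integers_of K \<and> 0 \<in> I \<and> (\<forall>x\<in>I. \<forall>y\<in>I. x + y \<in> I) \<and>
    (\<forall>x\<in>integers_of K. \<forall>y\<in>I. x * y \<in> I)" (is "_ \<longleftrightarrow> ?R")
proof
  interpret O: cring "ring_of_integers K" by (rule cring_ring_of_integers[OF K])
  show ?R if "ideal I (ring_of_integers K)"
  proof -
    interpret ideal I "ring_of_integers K" by fact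
    show ?thesis
      using a_subset additive_subgroup.zero_closed[OF additive_subgroup_axioms] a_closed I_l_closed by auto
  qed
  assume R: ?R
  have minus: "- x \<in> I" if "x \<in> I" for x
    using R that integers_of_closed(3)[OF K, of "- 1"] by force
  show "ideal I (ring_of_integers K)"
  proof (rule idealI)
    show "ring (ring_of_integers K)" by (rule O.ring_axioms)
    have inv: "\<ominus>\<^bsub>ring_of_integers K\<^esub> x = - x" if "x \<in> I" for x
      using O.minus_equality[of "- x" x] that R minus by auto
    show "subgroup I (add_monoid (ring_of_integers K))"
      using R minus by (intro O.add.subgroupI) (auto simp: inv)
    fix a x assume "a \<in> I" "x \<in> carrier (ring_of_integers K)"
    then have "x * a \<in> I" using R by simp
    then show "x \<otimes>\<^bsub>ring_of_integers K\<^esub> a \<in> I" "a \<otimes>\<^bsub>ring_of_integers K\<^esub> x \<in> I"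
      by (simp_all add: mult.commute)
  qed
qed

locale prime_above =
  fixes K :: "complex set" and p :: nat and P :: "complex set"
  assumes K: "subfield K complex_field" and prime: "Factorial_Ring.prime p"
    and prime_over: "prime_over K p P"
begin

lemma primeideal: "primeideal P (ring_of_integers K)"
  using prime_over by (simp add: prime_over_def)

lemma P_ideal: "ideal P (ring_of_integers K)"
  using primeideal by (simp add: primeideal_def)

lemma P_0: "0 \<in> P"
  and P_add: "\<And>x y. x \<in> P \<Longrightarrow> y \<in> P \<Longrightarrow> x + y \<in> P"
  and P_mult: "\<And>x y. x \<in> integers_of K \<Longrightarrow> y \<in> P \<Longrightarrow> x * y \<in> P"
  using P_ideal unfolding ideal_ring_of_integers_iff[OF K] by auto

lemma P_prime: "x \<in> integers_of K \<Longrightarrow> y \<in> integers_of K \<Longrightarrow> x * y \<in> P \<Longrightarrow> x \<in> P \<or> y \<in> P"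
  using primeideal.I_prime[OF primeideal, of x y] by simp

lemma P_minus: "x \<in> P \<Longrightarrow> - x \<in> P"
  using P_mult[of "- 1" x] integers_of_closed(3)[OF K, of "- 1"] by simp

lemma P_diff: "x \<in> P \<Longrightarrow> y \<in> P \<Longrightarrow> x - y \<in> P"
  using P_add[of x "- y"] P_minus by simp

lemma P_mult_right: "x \<in> P \<Longrightarrow> y \<in> integers_of K \<Longrightarrow> x * y \<in> P"
  using P_mult[of y x] by (simp add: mult.commute)

lemma P_sum: "(\<And>i. i \<in> I \<Longrightarrow> f i \<in> P) \<Longrightarrow> sum f I \<in> P"
  by (induction I rule: infinite_finite_induct) (auto intro: P_0 P_add)

lemma P_of_int_iff: "of_int m \<in> P \<longleftrightarrow> int p dvd m"
proof
  have PZ: "P \<inter> \<int> = range (\<lambda>k. of_int (int p * k))" using prime_over by (simp add: prime_over_def)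
  assume "of_int m \<in> P"
  then have "of_int m \<in> P \<inter> \<int>" by simp
  then obtain k where "complex_of_int m = of_int (int p * k)" unfolding PZ by (elim rangeE)
  then show "int p dvd m" unfolding of_int_eq_iff by (rule dvdI)
next
  have PZ: "P \<inter> \<int> = range (\<lambda>k. of_int (int p * k))" using prime_over by (simp add: prime_over_def)
  assume "int p dvd m"
  then obtain k where "m = int p * k" by (elim dvdE)
  then have "of_int m \<in> P \<inter> \<int>" unfolding PZ by (intro range_eqI[of _ _ k]) simp
  then show "of_int m \<in> P" by simp
qed

lemma P_of_int_cong: "[m = n] (mod int p) \<Longrightarrow> of_int m - of_int n \<in> P"
  using P_of_int_iff[of "m - n"] by (simp add: cong_iff_dvd_diff)

lemma P_cong_trans: "x - y \<in> P \<Longrightarrow> y - z \<in> P \<Longrightarrow> x - z \<in> P"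
  using P_add[of "x - y" "y - z"] by simp

lemma P_cong_mult:
  assumes "x - x' \<in> P" "y - y' \<in> P" "x' \<in> integers_of K" "y \<in> integers_of K"
  shows "x * y - x' * y' \<in> P"
proof -
  have "(x - x') * y + x' * (y - y') \<in> P" by (intro P_add P_mult P_mult_right assms)
  then show ?thesis by (simp add: algebra_simps)
qed

lemma P_cong_power:
  assumes "x - y \<in> P" "x \<in> integers_of K" "y \<in> integers_of K"
  shows "x ^ n - y ^ n \<in> P"
proof (induction n)
  case (Suc n)
  show ?case
    unfolding power_Suc by (intro P_cong_mult assms Suc integers_of_closed(8)[OF K])
qed (simp add: P_0)

lemma P_power_imp: "x \<in> integers_of K \<Longrightarrow> x ^ n \<in> P \<Longrightarrow> x \<in> P"
proof (induction n)
  case 0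
  then have "of_int 1 \<in> P" by simp
  then show ?case using P_of_int_iff[of 1] prime by (auto dest: not_prime_unit)
next
  case (Suc n)
  then show ?case using P_prime[of x "x ^ n"] integers_of_closed(8)[OF K] by auto
qed

text \<open>
The binomial coefficients strictly between the ends are multiples of \<open>p\<close>.
\<close>

lemma power_p_add:
  assumes x: "x \<in> integers_of K" and y: "y \<in> integers_of K"
  shows "(x + y) ^ p - (x ^ p + y ^ p) \<in> P"
proof -
  have p0: "p > 0" using prime prime_gt_0_nat by blast
  let ?t = "\<lambda>k. of_nat (p choose k) * x ^ k * y ^ (p - k)"
  have "(x + y) ^ p = (\<Sum>k\<le>p. ?t k)" by (rule binomial_ring)
  also have "{..p} = insert 0 (insert p {1..<p})" using p0 by auto
  also have "(\<Sum>k\<in>insert 0 (insert p {1..<p}). ?t k) = y ^ p + (x ^ p + (\<Sum>k\<in>{1..<p}. ?t k))"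
    using p0 by simp
  finally have eq: "(x + y) ^ p - (x ^ p + y ^ p) = (\<Sum>k\<in>{1..<p}. ?t k)" by simp
  show ?thesis
    unfolding eq
  proof (rule P_sum)
    fix k assume "k \<in> {1..<p}"
    then have "p dvd p choose k" using prime by (intro dvd_choose_prime) auto
    then have "of_int (int (p choose k)) \<in> P" by (subst P_of_int_iff) simp
    then have "of_nat (p choose k) \<in> P" by simp
    then show "?t k \<in> P" by (intro P_mult_right integers_of_closed(8)[OF K] x y)
  qed
qed

end

text \<open>
The ideal generated by \<open>p\<close> is proper since \<open>1 / p\<close> is rational but no integer, hence no algebraic integer.
Zorn's lemma provides a maximal ideal containing it, and its intersection with \<open>\<int>\<close> is \<open>p \<int>\<close> as it does not
contain \<open>1\<close>.
\<close>

lemma prime_over_exists: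
  assumes K: "subfield K complex_field" and p: "Factorial_Ring.prime p"
  shows "\<exists>P. prime_over K p P"
proof -
  define R where "R = ring_of_integers K"
  interpret R: cring R unfolding R_def by (rule cring_ring_of_integers[OF K])
  note iff = ideal_ring_of_integers_iff[OF K, folded R_def]
  note closed = integers_of_closed[OF K]
  define A where "A = {I. ideal I R \<and> of_nat p \<in> I \<and> 1 \<notin> I}"
  define J where "J = (\<lambda>x. of_nat p * x) ` integers_of K"
  have "ideal J R"
    unfolding iff J_def
  proof (intro conjI ballI subsetI)
    show "0 \<in> (\<lambda>x. of_nat p * x) ` integers_of K" using closed(1) by force
    fix x y assume "x \<in> (\<lambda>x. of_nat p * x) ` integers_of K" "y \<in> (\<lambda>x. of_nat p * x) ` integers_of K"
    then show "x + y \<in> (\<lambda>x. of_nat p * x) ` integers_of K"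
      using closed(5) by (auto simp flip: distrib_left)
  next
    fix x y assume "x \<in> integers_of K" "y \<in> (\<lambda>x. of_nat p * x) ` integers_of K"
    then obtain z where "y = of_nat p * z" "x * z \<in> integers_of K" using closed(7) by blast
    then show "x * y \<in> (\<lambda>x. of_nat p * x) ` integers_of K" by (intro image_eqI[of _ _ "x * z"]) auto
  next
    fix y assume "y \<in> (\<lambda>x. of_nat p * x) ` integers_of K"
    then show "y \<in> integers_of K" using closed(7)[OF closed(3)[of "int p"]] by auto
  qed
  moreover have "of_nat p \<in> J" unfolding J_def using closed(2) by force
  moreover have "1 \<notin> J"
  proof
    assume "1 \<in> J"
    then obtain x where x: "algebraic_int x" "of_nat p * x = (1 :: complex)" by (auto simp: J_def)
    have p0: "of_nat p \<noteq> (0 :: complex)" using p prime_gt_0_nat by fastforce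
    then have "x = 1 / of_nat p" using x(2) by (simp add: field_simps)
    then have "x \<in> \<rat>" by simp
    then have "x \<in> \<int>" using x(1) by (intro rational_algebraic_int_is_int)
    then obtain k where "x = of_int k" by (elim Ints_cases)
    then have "complex_of_int (int p * k) = of_int 1" using x(2) by simp
    then have "int p * k = 1" unfolding of_int_eq_iff .
    then have "int p dvd 1" by (metis dvd_triv_left)
    then show False using p by auto
  qed
  ultimately have J: "J \<in> A" by (simp add: A_def)
  have chain: "\<exists>U\<in>A. \<forall>Q\<in>C. Q \<subseteq> U" if C: "subset.chain A C" for C
  proof (cases "C = {}")
    case False
    have sub: "C \<subseteq> A" and lin: "\<And>Q Y. Q \<in> C \<Longrightarrow> Y \<in> C \<Longrightarrow> Q \<subseteq> Y \<or> Y \<subseteq> Q"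
      using C by (auto simp: subset.chain_def)
    have id: "ideal Q R" if "Q \<in> C" for Q using sub that by (auto simp: A_def)
    have "ideal (\<Union>C) R"
      unfolding iff
    proof (intro conjI ballI)
      fix x y assume "x \<in> \<Union>C" "y \<in> \<Union>C"
      then obtain Q Y where XY: "Q \<in> C" "Y \<in> C" "x \<in> Q" "y \<in> Y" by blast
      then obtain Z where "Z \<in> C" "x \<in> Z" "y \<in> Z" using lin by blast
      then show "x + y \<in> \<Union>C" using id[of Z] unfolding iff by blast
    qed (use False id in \<open>unfold iff, blast+\<close>)
    moreover have "of_nat p \<in> \<Union>C" "1 \<notin> \<Union>C" using sub False by (auto simp: A_def)
    ultimately show ?thesis by (intro bexI[of _ "\<Union>C"]) (auto simp: A_def)
  qed (use J in auto)
  have "\<exists>P\<in>A. \<forall>Q\<in>A. P \<subseteq> Q \<longrightarrow> Q = P"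
    by (rule subset_Zorn) (rule chain)
  then obtain P where P: "P \<in> A" "\<forall>Q\<in>A. P \<subseteq> Q \<longrightarrow> Q = P"
    by (elim bexE)
  have id: "ideal P R" and pP: "of_nat p \<in> P" and one: "1 \<notin> P" using P(1) by (auto simp: A_def)
  have "maximalideal P R"
  proof (rule maximalidealI[OF id])
    show "carrier R \<noteq> P" using one closed(2) by (auto simp: R_def)
    fix I assume I: "ideal I R" "P \<subseteq> I" "I \<subseteq> carrier R"
    show "I = P \<or> I = carrier R"
    proof (cases "1 \<in> I")
      case True
      have "carrier R \<subseteq> I"
      proof
        fix x assume "x \<in> carrier R"
        then have "x \<in> integers_of K" by (simp add: R_def)
        then have "x * 1 \<in> I" using True I(1) unfolding iff by blast
        then show "x \<in> I" by simp
      qed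
      then show ?thesis using I by blast
    next
      case False
      then have "I \<in> A" using I pP by (auto simp: A_def)
      then show ?thesis using P(2) I by blast
    qed
  qed
  then have "primeideal P R" by (rule R.maximalideal_prime)
  moreover have "P \<inter> \<int> = range (\<lambda>k. of_int (int p * k))"
  proof (intro equalityI subsetI)
    fix x assume "x \<in> P \<inter> \<int>"
    then obtain m where m: "x = of_int m" "of_int m \<in> P" by (auto elim: Ints_cases)
    have "int p dvd m"
    proof (rule ccontr)
      assume "\<not> int p dvd m"
      then have "Rings.coprime (int p) m" using p by (intro prime_imp_coprime) auto
      then obtain u v where uv: "u * int p + v * m = 1"
        using bezout_int[of "int p" m] by (metis coprime_imp_gcd_eq_1)
      have "of_int u * of_nat p + of_int v * of_int m \<in> P"
        using id closed(3) pP m(2) unfolding iff by blast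
      also have "of_int u * of_nat p + of_int v * of_int m = complex_of_int (u * int p + v * m)" by simp
      finally show False using one uv by simp
    qed
    then obtain k where "m = int p * k" by (elim dvdE)
    then show "x \<in> range (\<lambda>k. of_int (int p * k))" unfolding m(1) by blast
  next
    fix x :: complex assume "x \<in> range (\<lambda>k. of_int (int p * k))"
    then obtain k where "x = of_int k * of_nat p" by (auto simp: mult.commute)
    moreover have "of_int k * of_nat p \<in> P" using id closed(3) pP unfolding iff by blast
    ultimately show "x \<in> P \<inter> \<int>" by auto
  qed
  ultimately show ?thesis unfolding prime_over_def R_def by blast
qed

section \<open>Frobenius elements in quadratic towers\<close>

text \<open>
If \<open>x = u + v b\<close> has the conjugate \<open>x' = u - v b\<close>, then \<open>s = x + x' = 2 u\<close> and \<open>t = (x - x') b = 2 v b\<^sup>2\<close>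
are algebraic integers in the base field.  This is a substitute for knowing an integral basis.
\<close>

lemma (in quadratic_extension) integral_multiple:
  assumes x: "x \<in> quad_ext E b" "algebraic_int x" and bi: "algebraic_int b"
  obtains s t where "s \<in> E" "algebraic_int s" "t \<in> E" "algebraic_int t"
    "2 * b\<^sup>2 * x = b\<^sup>2 * s + t * b"
proof -
  obtain u v where uv: "u \<in> E" "v \<in> E" "x = u + v * b" using x(1) by (rule quad_extE)
  define x' where "x' = quad_conj E b x"
  have x': "x' = u - v * b" unfolding x'_def uv(3) by (rule quad_conj_eq[OF uv(1,2)])
  have xi': "algebraic_int x'"
    unfolding x'_def by (rule rat_hom_algebraic_int[OF rat_hom_on_quad_conj subfield_quad_ext x])
  have "algebraic_int (x + x')" "algebraic_int ((x - x') * b)"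
    by (intro algebraic_int_add algebraic_int_mult algebraic_int_diff x(2) bi xi')+
  moreover have "x + x' = 2 * u" "(x - x') * b = 2 * v * b\<^sup>2"
    by (simp_all add: uv(3) x' power2_eq_square)
  ultimately have "algebraic_int (2 * u)" "algebraic_int (2 * v * b\<^sup>2)" by simp_all
  moreover have "2 * u \<in> E" "2 * v * b\<^sup>2 \<in> E"
    by (intro subfield_mult[OF E] subfield_numeral[OF E] uv b2)+
  moreover have "2 * b\<^sup>2 * x = b\<^sup>2 * (2 * u) + (2 * v * b\<^sup>2) * b"
    by (simp add: uv(3) algebra_simps)
  ultimately show ?thesis by (intro that[of "2 * u" "2 * v * b\<^sup>2"])
qed

context prime_above
begin

text \<open>
Fermat's little theorem.
\<close>

lemma frobenius_on_Rats:
  assumes h: "rat_hom_on K \<sigma>" and x: "x \<in> \<rat>" "algebraic_int x"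
  shows "\<sigma> x - x ^ p \<in> P"
proof -
  obtain m where m: "x = of_int m" using rational_algebraic_int_is_int[OF x(2,1)] by (elim Ints_cases)
  have "[m = m ^ p] (mod int p)"
  proof (cases "int p dvd m")
    case True
    moreover have "m dvd m ^ p" using prime prime_gt_0_nat by (intro dvd_power) auto
    ultimately have "int p dvd m ^ p" by (rule dvd_trans)
    then show ?thesis using True by (simp add: cong_iff_dvd_diff)
  next
    case False
    have pp: "p = Suc (p - 1)" using prime prime_gt_0_nat[of p] by simp
    define n where "n = nat (m mod int p)"
    have p0: "int p > 0" using prime prime_gt_0_nat by auto
    have mn: "[m = int n] (mod int p)" using p0 by (simp add: n_def cong_def)
    then have "\<not> p dvd n" using False cong_dvd_iff[OF mn] by simp
    then have "[n ^ (p - 1) = 1] (mod p)" by (rule fermat_theorem[OF prime])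
    then have "[n * n ^ (p - 1) = n * 1] (mod p)" by (rule cong_scalar_left)
    moreover have "n * n ^ (p - 1) = n ^ p" by (subst (2) pp) simp
    ultimately have "[n ^ p = n] (mod p)" by simp
    then have "[int (n ^ p) = int n] (mod int p)" unfolding cong_int_iff .
    then have "[int n = m ^ p] (mod int p)"
      using cong_trans[OF cong_sym cong_sym[OF cong_pow[OF mn, of p]]] by simp
    then show ?thesis by (rule cong_trans[OF mn])
  qed
  from P_of_int_cong[OF this] show ?thesis using rat_hom_rat[OF h x(1)] by (simp add: m)
qed

text \<open>
One step up the tower.  As \<open>2 b\<^sup>2 x\<close> is expressed through \<open>b\<close> and integers of \<open>E\<close> (\<open>integral_multiple\<close>), the
congruence holds for \<open>c x\<close> with \<open>c = 2 b\<^sup>2\<close>; it also holds for \<open>c\<close>, and \<open>c\<close> can be cancelled because \<open>P\<close> is prime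
and does not contain \<open>c\<close>.
\<close>

lemma frobenius_on_quad_ext:
  assumes h: "rat_hom_on K \<sigma>" and im: "\<And>x. x \<in> K \<Longrightarrow> \<sigma> x \<in> K"
    and quad: "quadratic_extension E b" and sub: "quad_ext E b \<subseteq> K"
    and bi: "algebraic_int b" and two: "2 \<notin> P" and b2_P: "b\<^sup>2 \<notin> P"
    and frob_E: "\<And>x. x \<in> E \<Longrightarrow> algebraic_int x \<Longrightarrow> \<sigma> x - x ^ p \<in> P"
    and frob_b: "\<sigma> b - b ^ p \<in> P"
    and x: "x \<in> quad_ext E b" "algebraic_int x"
  shows "\<sigma> x - x ^ p \<in> P"
proof -
  interpret quadratic_extension E b by (rule quad)
  note closed = integers_of_closed[OF K]
  have \<sigma>_closed: "\<sigma> y \<in> integers_of K" if "y \<in> integers_of K" for y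
    using that im rat_hom_algebraic_int[OF h K] by auto
  have E_K: "E \<subseteq> K" using base_subset sub by blast
  obtain s t where st: "s \<in> E" "algebraic_int s" "t \<in> E" "algebraic_int t"
    and eq: "2 * b\<^sup>2 * x = b\<^sup>2 * s + t * b"
    using integral_multiple[OF x bi] .
  define c where "c = 2 * b\<^sup>2"
  have s: "s \<in> integers_of K" and t: "t \<in> integers_of K" and xO: "x \<in> integers_of K"
    and bO: "b \<in> integers_of K"
    using st E_K x sub bi generator_in by auto
  have b2O: "b\<^sup>2 \<in> integers_of K" by (rule closed(8)[OF bO])
  have cO: "c \<in> integers_of K" unfolding c_def using closed(7)[OF closed(3)[of 2] b2O] by simp
  have cE: "c \<in> E" unfolding c_def by (intro subfield_mult[OF E] subfield_numeral[OF E] b2)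
  have c: "c \<notin> P" using P_prime[of 2 "b\<^sup>2"] two b2_P b2O closed(3)[of 2] by (auto simp: c_def)
  have frob_b2: "\<sigma> (b\<^sup>2) - (b\<^sup>2) ^ p \<in> P" using frob_E[OF b2] b2O by simp
  have "\<sigma> (b\<^sup>2 * s + t * b) = \<sigma> (b\<^sup>2) * \<sigma> s + \<sigma> t * \<sigma> b"
    using s t bO b2O subfield_mult[OF K] by (simp add: rat_hom_add[OF h] rat_hom_mult[OF h])
  moreover have "(\<sigma> (b\<^sup>2) * \<sigma> s - (b\<^sup>2) ^ p * s ^ p) + (\<sigma> t * \<sigma> b - t ^ p * b ^ p) \<in> P"
    by (intro P_add P_cong_mult frob_b2 frob_b frob_E st closed \<sigma>_closed s b2O t bO)
  ultimately have "\<sigma> (b\<^sup>2 * s + t * b) - ((b\<^sup>2 * s) ^ p + (t * b) ^ p) \<in> P"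
    by (simp add: power_mult_distrib add_diff_add)
  moreover have "((b\<^sup>2 * s) ^ p + (t * b) ^ p) - (b\<^sup>2 * s + t * b) ^ p \<in> P"
    using P_minus[OF power_p_add[OF closed(7)[OF b2O s] closed(7)[OF t bO]]] by simp
  ultimately have "\<sigma> (c * x) - (c * x) ^ p \<in> P"
    unfolding c_def eq by (rule P_cong_trans)
  then have 1: "\<sigma> c * \<sigma> x - c ^ p * x ^ p \<in> P"
    using cO xO by (simp add: rat_hom_mult[OF h] power_mult_distrib)
  have "\<sigma> c * \<sigma> x - c ^ p * \<sigma> x \<in> P"
    using P_mult_right[OF frob_E[OF cE] \<sigma>_closed[OF xO]] cO by (simp add: left_diff_distrib)
  from P_diff[OF 1 this] have "c ^ p * (\<sigma> x - x ^ p) \<in> P" by (simp add: right_diff_distrib)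
  then have "c ^ p \<in> P \<or> \<sigma> x - x ^ p \<in> P"
    by (intro P_prime closed \<sigma>_closed cO xO)
  then show ?thesis using c P_power_imp[OF cO] by blast
qed

end

section \<open>The Frobenius element of the octic field\<close>

lemma octic_integers: "\<i> \<in> integers_of octic_field" "alpha \<in> integers_of octic_field"
  "rt2 \<in> integers_of octic_field"
proof -
  have "algebraic_int alpha"
    unfolding alpha_def by (intro algebraic_int_csqrt algebraic_int_add) auto
  moreover have "algebraic_int rt2"
    unfolding rt2_def by (intro algebraic_int_of_real algebraic_int_sqrt) auto
  ultimately show "\<i> \<in> integers_of octic_field" "alpha \<in> integers_of octic_field"
    "rt2 \<in> integers_of octic_field"
    using octic_generators by auto
qed

text \<open>
From \<open>(x - n) (x + n) = m - n\<^sup>2 \<in> P\<close> it follows that \<open>x\<close> is congruent to \<open>n\<close> or to \<open>- n\<close>.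
\<close>

lemma (in prime_above) square_root_residue:
  assumes x: "x \<in> integers_of K" "x\<^sup>2 = of_int m" and n: "[n\<^sup>2 = m] (mod int p)"
  obtains k where "[k\<^sup>2 = m] (mod int p)" "x - of_int k \<in> P"
proof -
  have "(x - of_int n) * (x + of_int n) = of_int m - of_int (n\<^sup>2)"
    by (simp add: x(2)[symmetric] power2_eq_square algebra_simps)
  also have "\<dots> \<in> P" using n by (intro P_of_int_cong) (rule cong_sym)
  finally have "x - of_int n \<in> P \<or> x + of_int n \<in> P"
    by (intro P_prime integers_of_closed[OF K] x(1))
  then show ?thesis
  proof
    assume "x - of_int n \<in> P"
    then show ?thesis by (intro that[of n] n)
  next
    assume "x + of_int n \<in> P"
    then show ?thesis using n by (intro that[of "- n"]) simp_all
  qed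
qed

locale octic_prime = prime_1_mod_8 p + prime_above octic_field p P for p P +
  fixes z :: int
  assumes z: "[z ^ 4 = -1] (mod int p)"
begin

abbreviation eps :: int where "eps \<equiv> Legendre (1 + z\<^sup>2) (int p)"

lemmas integers_closed = integers_of_closed[OF subfield_octic]

lemma two_notin: "2 \<notin> P"
  using P_of_int_iff[of 2] not_dvd_2 by simp

lemma four_notin: "4 \<notin> P"
  using P_prime[of 2 2] integers_closed(3)[of 2] two_notin by auto

lemma one_plus_i_notin: "1 + \<i> \<notin> P"
proof
  assume "1 + \<i> \<in> P"
  then have "(1 - \<i>) * (1 + \<i>) \<in> P"
    by (intro P_mult integers_closed octic_integers)
  moreover have "(1 - \<i>) * (1 + \<i>) = 2" by (simp add: algebra_simps)
  ultimately show False using two_notin by simp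
qed

lemma i_power_p: "\<i> ^ p = \<i>"
proof -
  have "\<i> ^ p = (\<i> ^ 4) ^ (2 * ((p - 1) div 8)) * \<i>"
    by (subst p_eq) (simp add: power_mult[symmetric])
  then show ?thesis by simp
qed

lemma rt2_power_p: "rt2 - rt2 ^ p \<in> P"
proof -
  obtain r where r: "rt2 - of_int r \<in> P"
    using square_root_residue[OF octic_integers(3), of 2] sqrt_2_square[OF z] rt2_square by auto
  have "of_int r - of_int r ^ p \<in> P"
    using frobenius_on_Rats[of "\<lambda>x. x" "of_int r"] by (simp add: rat_hom_on_def)
  moreover have "of_int r ^ p - rt2 ^ p \<in> P"
    using P_minus[OF P_cong_power[OF r octic_integers(3) integers_closed(3), of p]] by simp
  ultimately show ?thesis using r P_cong_trans by blast
qed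

text \<open>
Modulo \<open>P\<close>, with \<open>\<i> \<equiv> j\<close>, one has \<open>alpha ^ p = alpha (1 + \<i>) ^ ((p - 1) / 2) \<equiv> alpha (1 + j) ^ ((p - 1) / 2)\<close>,
and Euler's criterion evaluates the last power.
\<close>

lemma alpha_power_p: "of_int eps * alpha - alpha ^ p \<in> P"
proof -
  have "(z\<^sup>2)\<^sup>2 = z ^ 4" by simp
  then obtain j where j: "[j\<^sup>2 = -1] (mod int p)" "\<i> - of_int j \<in> P"
    using square_root_residue[OF octic_integers(1), of "-1" "z\<^sup>2"] z by auto
  define n where "n = (p - 1) div 2"
  have p_n: "p = 2 * n + 1" using odd_p by (simp add: n_def)
  have "(1 + \<i>) - of_int (1 + j) \<in> P" using j(2) by simp
  then have "(1 + \<i>) ^ n - of_int (1 + j) ^ n \<in> P"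
    by (intro P_cong_power integers_closed octic_integers)
  moreover have "[eps = (1 + j) ^ n] (mod int p)"
    using euler_criterion[OF prime p_gt_2, of "1 + j"] Legendre_one_plus_i[OF z j(1)] by (simp add: n_def)
  then have "of_int ((1 + j) ^ n) - of_int eps \<in> P"
    by (intro P_of_int_cong) (rule cong_sym)
  then have "of_int (1 + j) ^ n - of_int eps \<in> P" by simp
  ultimately have "(1 + \<i>) ^ n - of_int eps \<in> P" by (rule P_cong_trans)
  then have "((1 + \<i>) ^ n - of_int eps) * alpha \<in> P" by (intro P_mult_right octic_integers)
  then have "- (((1 + \<i>) ^ n - of_int eps) * alpha) \<in> P" by (rule P_minus)
  moreover have "alpha ^ p = (1 + \<i>) ^ n * alpha"
    by (simp add: p_n power_mult alpha_square)
  ultimately show ?thesis by (simp add: algebra_simps)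
qed

lemma eps_cases: "eps = 1 \<or> eps = -1"
proof -
  have "\<not> int p dvd 1 + z\<^sup>2"
  proof
    assume "int p dvd 1 + z\<^sup>2"
    then have "int p dvd (1 + z\<^sup>2) * (1 - z\<^sup>2)" by simp
    moreover have "(1 + z\<^sup>2) * (1 - z\<^sup>2) = 2 - (z ^ 4 + 1)" by (simp add: algebra_simps flip: power_add)
    moreover have "int p dvd z ^ 4 + 1" using z by (simp add: cong_iff_dvd_diff)
    ultimately show False using not_dvd_2 dvd_diff_left_iff[of "int p" "z ^ 4 + 1" 2] by simp
  qed
  then show ?thesis using Legendre_eq_0_iff[of "1 + z\<^sup>2" "int p"] Legendre_values[of "1 + z\<^sup>2" "int p"] by auto
qed

lemma frobenius_congruence:
  assumes \<sigma>: "\<sigma> \<in> carrier octic_gal" "\<sigma> alpha = of_int eps * alpha" "\<sigma> rt2 = rt2"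
    and x: "x \<in> integers_of octic_field"
  shows "\<sigma> x - x ^ p \<in> P"
proof -
  note h = Gal_rat_hom[OF \<sigma>(1)] and im = Gal_rat_in[OF \<sigma>(1)]
  have "\<sigma> \<i> = (of_int eps)\<^sup>2 * alpha\<^sup>2 - 1" using octic_hom_i[OF h] \<sigma>(2) by (simp add: power_mult_distrib)
  then have i: "\<sigma> \<i> - \<i> ^ p \<in> P"
    using eps_cases P_0 i_power_p by (auto simp: alpha_square)
  have i2: "\<i>\<^sup>2 \<notin> P" using P_of_int_iff[of "-1"] p_gt_2 by simp
  have sub1: "Qi \<subseteq> octic_field" and sub2: "Qalpha \<subseteq> octic_field" using octic_subsets by auto
  have on_Qi: "\<sigma> x - x ^ p \<in> P" if "x \<in> Qi" "algebraic_int x" for x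
    by (rule frobenius_on_quad_ext[OF h im Qi.quadratic_extension_axioms sub1 _ two_notin i2
          frobenius_on_Rats[OF h] i that])
       (use octic_integers in simp_all)
  have on_Qalpha: "\<sigma> x - x ^ p \<in> P" if "x \<in> Qalpha" "algebraic_int x" for x
    by (rule frobenius_on_quad_ext[OF h im Qalpha.quadratic_extension_axioms sub2 _ two_notin _ on_Qi _ that])
       (use octic_integers one_plus_i_notin alpha_power_p in \<open>simp_all add: \<sigma> alpha_square\<close>)
  show ?thesis
    by (rule frobenius_on_quad_ext[OF h im octic.quadratic_extension_axioms _ _ two_notin _ on_Qalpha])
       (use octic_integers two_notin rt2_power_p x in \<open>simp_all add: \<sigma> rt2_square flip: octic_field_def\<close>)
qed

text \<open>
The congruences \<open>\<sigma> \<surd>2 \<equiv> \<surd>2\<close> and \<open>\<sigma> alpha \<equiv> \<epsilon> alpha\<close> modulo \<open>P\<close> hold for every Frobenius element.  They are equalities,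
as any other possible value would put a power of \<open>2\<close> into \<open>P\<close>.
\<close>

lemma frobenius_values:
  assumes \<sigma>: "\<sigma> \<in> carrier octic_gal" and frob: "\<And>x. x \<in> integers_of octic_field \<Longrightarrow> \<sigma> x - x ^ p \<in> P"
  shows "\<sigma> alpha = of_int eps * alpha" "\<sigma> rt2 = rt2"
proof -
  have "\<sigma> rt2 - rt2 \<in> P"
    using P_diff[OF frob[OF octic_integers(3)] rt2_power_p] by simp
  moreover have "\<sigma> rt2 = - rt2 \<Longrightarrow> - (rt2 * (\<sigma> rt2 - rt2)) = 4"
    using rt2_square by (simp add: power2_eq_square algebra_simps)
  ultimately have "\<sigma> rt2 \<noteq> - rt2"
    using four_notin P_minus[OF P_mult[OF octic_integers(3)]] by metis
  then show "\<sigma> rt2 = rt2" using Gal_octic_rt2[OF \<sigma>] by simp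
  define e where "e = complex_of_int eps"
  have e: "e * e = 1" using eps_cases by (auto simp: e_def)
  have eO: "e * alpha \<in> integers_of octic_field"
    unfolding e_def by (intro integers_closed octic_integers)
  have \<sigma>O: "\<sigma> alpha \<in> integers_of octic_field"
    using octic_integers(2) Gal_rat_in[OF \<sigma>]
      rat_hom_algebraic_int[OF Gal_rat_hom[OF \<sigma>] subfield_octic] by auto
  have cong: "\<sigma> alpha - e * alpha \<in> P"
    using P_diff[OF frob[OF octic_integers(2)] alpha_power_p] by (simp add: e_def)
  then have "(\<sigma> alpha + e * alpha) * (\<sigma> alpha - e * alpha) \<in> P"
    by (intro P_mult integers_closed \<sigma>O eO)
  moreover have "(\<sigma> alpha + e * alpha) * (\<sigma> alpha - e * alpha) = (\<sigma> alpha)\<^sup>2 - e * e * alpha\<^sup>2"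
    by (simp add: power2_eq_square algebra_simps)
  ultimately have sq: "(\<sigma> alpha)\<^sup>2 - alpha\<^sup>2 \<in> P" by (simp add: e)
  have "(\<sigma> alpha)\<^sup>2 \<noteq> (cnj alpha)\<^sup>2"
  proof
    assume "(\<sigma> alpha)\<^sup>2 = (cnj alpha)\<^sup>2"
    then have "(\<sigma> alpha)\<^sup>2 - alpha\<^sup>2 = - 2 * \<i>" by (simp only: alpha_square cnj_alpha_square) simp
    then have "\<i> * (- 2 * \<i>) \<in> P" using P_mult[OF octic_integers(1) sq] by simp
    moreover have "\<i> * (- 2 * \<i>) = 2" by (simp add: algebra_simps)
    ultimately show False using two_notin by metis
  qed
  then have cases: "\<sigma> alpha \<in> {alpha, - alpha}" using Gal_octic_alpha[OF \<sigma>] by auto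
  have "\<sigma> alpha \<noteq> - (e * alpha)"
  proof
    assume "\<sigma> alpha = - (e * alpha)"
    \<comment> \<open>The factor \<open>alpha (1 - \<i>)\<close> is chosen because \<open>alpha\<^sup>2 (1 - \<i>) = 2\<close>.\<close>
    then have "(e * alpha * (1 - \<i>)) * (\<sigma> alpha - e * alpha) = - 2 * (e * e) * (alpha\<^sup>2 * (1 - \<i>))"
      by (simp add: power2_eq_square algebra_simps)
    also have "\<dots> = - 4" by (simp add: e alpha_square algebra_simps)
    finally have "- 4 \<in> P"
      using P_mult[OF integers_closed(7)[OF eO integers_closed(6)[OF integers_closed(2) octic_integers(1)]] cong] by simp
    then show False using four_notin P_minus[of "- 4"] by simp
  qed
  then show "\<sigma> alpha = of_int eps * alpha" using cases eps_cases by (auto simp: e_def)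
qed

end

text \<open>
The sign does not depend on the prime above \<open>p\<close>, which is why there is a single Frobenius element.
\<close>

lemma is_frobenius_octic_iff:
  assumes "prime_1_mod_8 p" and z: "[z ^ 4 = -1] (mod int p)"
  shows "is_frobenius octic_field p \<sigma> \<longleftrightarrow>
    \<sigma> = (if Legendre (1 + z\<^sup>2) (int p) = -1 then central_rot else \<one>\<^bsub>octic_gal\<^esub>)" (is "_ \<longleftrightarrow> \<sigma> = ?\<tau>")
proof -
  interpret prime_1_mod_8 p by fact
  have prime_above: "octic_prime p P z" if "prime_over octic_field p P" for P
    by (intro octic_prime.intro prime_above.intro octic_prime_axioms.intro assms subfield_octic that prime)
  obtain P0 where P0: "prime_over octic_field p P0"
    using prime_over_exists[OF subfield_octic prime] by blast
  let ?eps = "Legendre (1 + z\<^sup>2) (int p)"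
  have eps: "?eps = 1 \<or> ?eps = -1" using octic_prime.eps_cases[OF prime_above[OF P0]] .
  then have \<tau>: "?\<tau> \<in> carrier octic_gal" "?\<tau> alpha = of_int ?eps * alpha" "?\<tau> rt2 = rt2"
    by (auto simp: central_rot_in central_rot_values one_values)
  show ?thesis
  proof
    assume "is_frobenius octic_field p \<sigma>"
    then obtain P where P: "prime_over octic_field p P" and \<sigma>: "\<sigma> \<in> carrier octic_gal"
      and frob: "\<And>x. x \<in> integers_of octic_field \<Longrightarrow> \<sigma> x - x ^ p \<in> P"
      unfolding is_frobenius_def by auto
    from octic_prime.frobenius_values[OF prime_above[OF P] \<sigma> frob]
    show "\<sigma> = ?\<tau>" using \<tau> by (intro Gal_octic_eqI \<sigma>) simp_all
  next
    assume "\<sigma> = ?\<tau>"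
    moreover have "?\<tau> x - x ^ p \<in> P0" if "x \<in> integers_of octic_field" for x
      using octic_prime.frobenius_congruence[OF prime_above[OF P0] \<tau> that] .
    ultimately show "is_frobenius octic_field p \<sigma>"
      using P0 \<tau>(1) unfolding is_frobenius_def by auto
  qed
qed

theorem proposition2p1:
  fixes p :: nat and N M :: "complex set"
  assumes "Factorial_Ring.prime p" and "[p = 1] (mod 8)"
  defines "N \<equiv> generate_field complex_field {complex_of_real (sqrt 2), csqrt (1 + \<i>)}"
    and "M \<equiv> normal_closure_rat
                (generate_field complex_field {complex_of_real (sqrt (1 + sqrt 2))})"
  shows "(\<exists>!\<sigma>. is_frobenius N p \<sigma>) \<and>
         normal_over_rat M \<and> ring.dimension complex_field 8 \<rat> M \<and>
         dihedral_group (Gal_rat M) 4 \<and>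
         (\<exists>!\<sigma>. is_frobenius M p \<sigma>) \<and>
         (let
            S1 = (\<forall>j :: int. [j\<^sup>2 = -1] (mod int p) \<longrightarrow> Legendre (1 + j) (int p) = -1);
            S2 = (\<forall>r :: int. [r\<^sup>2 = 2] (mod int p) \<longrightarrow> Legendre (1 + r) (int p) = -1);
            S3 = (\<forall>r :: int. [r\<^sup>2 = 2] (mod int p) \<longrightarrow>
                    (-1) ^ ((p - 1) div 8) * Legendre r (int p) = -1);
            S4 = (\<forall>a b :: int. int p = a\<^sup>2 + b\<^sup>2 \<longrightarrow> Legendre (a + b) (int p) = -1);
            S5 = (\<forall>a b :: int. int p = a\<^sup>2 + b\<^sup>2 \<longrightarrow> [(a + b)\<^sup>2 = 9] (mod 16));
            S6 = (\<forall>a c :: int. int p = a\<^sup>2 + 4 * c\<^sup>2 \<longrightarrow> \<not> 16 dvd (int p - 1 + 4 * c));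
            S7 = generates_center (Gal_rat N) (frobenius N p);
            S8 = generates_center (Gal_rat M) (frobenius M p)
          in (S1 \<longleftrightarrow> S2) \<and> (S2 \<longleftrightarrow> S3) \<and> (S3 \<longleftrightarrow> S4) \<and> (S4 \<longleftrightarrow> S5) \<and>
             (S5 \<longleftrightarrow> S6) \<and> (S6 \<longleftrightarrow> S7) \<and> (S7 \<longleftrightarrow> S8))"
proof -
  have N: "N = octic_field" unfolding N_def by (rule octic_eq_generate_field[symmetric])
  have M: "M = octic_field" unfolding M_def by (rule octic_eq_normal_closure[symmetric])
  interpret prime_1_mod_8 p using assms(1,2) by unfold_locales
  obtain z where z: "[z ^ 4 = -1] (mod int p)" using eighth_root_exists by blast
  define eps where "eps = Legendre (1 + z\<^sup>2) (int p)"
  define \<tau> where "\<tau> = (if eps = -1 then central_rot else \<one>\<^bsub>octic_gal\<^esub>)"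
  have frob_iff: "is_frobenius octic_field p \<sigma> \<longleftrightarrow> \<sigma> = \<tau>" for \<sigma>
    unfolding \<tau>_def eps_def by (rule is_frobenius_octic_iff[OF prime_1_mod_8_axioms z])
  then have frobenius: "frobenius octic_field p = \<tau>" by (simp add: frobenius_def)
  have j: "[(z\<^sup>2)\<^sup>2 = -1] (mod int p)" using z by simp
  obtain a b where ab: "int p = a\<^sup>2 + b\<^sup>2" using two_squares_exist[OF prime j] by blast

  have all_iff: "(\<forall>x. Q x \<longrightarrow> f x = -1) \<longleftrightarrow> eps = -1"
    if "\<And>x. Q x \<Longrightarrow> f x = eps" "Q y" for Q :: "int \<Rightarrow> bool" and f y
  proof
    assume "\<forall>x. Q x \<longrightarrow> f x = -1"
    then have "f y = -1" using that(2) by blast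
    then show "eps = -1" using that(1)[OF that(2)] by simp
  next
    assume "eps = -1"
    then show "\<forall>x. Q x \<longrightarrow> f x = -1" using that(1) by simp
  qed
  have S1: "(\<forall>j :: int. [j\<^sup>2 = -1] (mod int p) \<longrightarrow> Legendre (1 + j) (int p) = -1) \<longleftrightarrow> eps = -1"
    by (rule all_iff) (erule Legendre_one_plus_i[OF z, folded eps_def], rule j)
  have S2: "(\<forall>r :: int. [r\<^sup>2 = 2] (mod int p) \<longrightarrow> Legendre (1 + r) (int p) = -1) \<longleftrightarrow> eps = -1"
    by (rule all_iff) (erule Legendre_one_plus_sqrt_2[OF z, folded eps_def], rule sqrt_2_square[OF z])
  have S3: "(\<forall>r :: int. [r\<^sup>2 = 2] (mod int p) \<longrightarrow>
      (-1) ^ ((p - 1) div 8) * Legendre r (int p) = -1) \<longleftrightarrow> eps = -1"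
    by (rule all_iff) (erule Legendre_sqrt_2[OF z, folded eps_def], rule sqrt_2_square[OF z])
  have S4: "(\<forall>a b :: int. int p = a\<^sup>2 + b\<^sup>2 \<longrightarrow> Legendre (a + b) (int p) = -1) \<longleftrightarrow> eps = -1"
  proof
    assume "\<forall>a b :: int. int p = a\<^sup>2 + b\<^sup>2 \<longrightarrow> Legendre (a + b) (int p) = -1"
    then have "Legendre (a + b) (int p) = -1" using ab by blast
    then show "eps = -1" using Legendre_sum_two_squares[OF z ab] by (simp add: eps_def)
  next
    assume eps: "eps = -1"
    show "\<forall>a b :: int. int p = a\<^sup>2 + b\<^sup>2 \<longrightarrow> Legendre (a + b) (int p) = -1"
    proof (intro allI impI)
      fix a b :: int assume "int p = a\<^sup>2 + b\<^sup>2"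
      from Legendre_sum_two_squares[OF z this] eps show "Legendre (a + b) (int p) = -1"
        unfolding eps_def by (rule trans)
    qed
  qed
  have S5: "(\<forall>a b :: int. int p = a\<^sup>2 + b\<^sup>2 \<longrightarrow> [(a + b)\<^sup>2 = 9] (mod 16)) \<longleftrightarrow> eps = -1"
  proof -
    have "(int p = a\<^sup>2 + b\<^sup>2 \<longrightarrow> [(a + b)\<^sup>2 = 9] (mod 16)) \<longleftrightarrow>
        (int p = a\<^sup>2 + b\<^sup>2 \<longrightarrow> Legendre (a + b) (int p) = -1)" for a b
      by (rule imp_cong[OF refl]) (rule Legendre_sum_two_squares_iff[symmetric])
    then show ?thesis unfolding S4[symmetric] by (simp only:)
  qed
  have S6: "(\<forall>a c :: int. int p = a\<^sup>2 + 4 * c\<^sup>2 \<longrightarrow> \<not> 16 dvd (int p - 1 + 4 * c)) \<longleftrightarrow> eps = -1"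
    unfolding S5[symmetric]
  proof (intro iffI allI impI)
    fix a b :: int
    assume S6: "\<forall>a c :: int. int p = a\<^sup>2 + 4 * c\<^sup>2 \<longrightarrow> \<not> 16 dvd (int p - 1 + 4 * c)"
      and ab: "int p = a\<^sup>2 + b\<^sup>2"
    have even: "[(a + 2 * c)\<^sup>2 = 9] (mod 16)" if "int p = a\<^sup>2 + (2 * c)\<^sup>2" for a c
      using S6 cong_9_mod_16_iff_not_dvd[of a c] that by simp
    from parity_two_squares[OF ab] show "[(a + b)\<^sup>2 = 9] (mod 16)"
      using even[of a "b div 2"] even[of b "a div 2"] ab by (auto simp: add.commute)
  next
    fix a c :: int
    assume S5: "\<forall>a b :: int. int p = a\<^sup>2 + b\<^sup>2 \<longrightarrow> [(a + b)\<^sup>2 = 9] (mod 16)"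
      and ac: "int p = a\<^sup>2 + 4 * c\<^sup>2"
    then have "[(a + 2 * c)\<^sup>2 = 9] (mod 16)" by simp
    then show "\<not> 16 dvd (int p - 1 + 4 * c)" using cong_9_mod_16_iff_not_dvd[OF ac] by simp
  qed
  have S7: "generates_center octic_gal (frobenius octic_field p) \<longleftrightarrow> eps = -1"
    unfolding frobenius using generates_center_Gal_octic_iff[of \<tau>] central_rot_neq_one
    by (auto simp: \<tau>_def)
  show ?thesis
    unfolding N M Let_def S1 S2 S3 S4 S5 S6 S7
    using frob_iff normal_octic dimension_octic dihedral_Gal_octic by auto
qed

end
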